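(* Let $K\ge 2$ and $M\ge 1$. The DoF region of the $K$-user $M$-antenna interference channel is $$\mathcal{D}=\Big\{(d_1,d_2,\dots,d_K)\in\mathbb{R}^K_+ :\ d_i+d_j\le M,\quad \forall\, 1\le i,j\le K,\ i\ne j\Big\}.$$
   Context: $\mathbb{R}^K_+=\{(x_1,\dots,x_K)\in\mathbb{R}^K : x_k\ge 0 \text{ for all } k\}$. $K$-user $M$-antenna interference channel: there are $K$ transmitters and $K$ receivers, each with $M$ antennas. Transmitter $k$ has exactly one message (message $k$); the $K$ messages are independent (each uniformly distributed on its message set). Receiver $j$ requests message $j$ only. At (discrete) time $t$ receiver $j$ observes $$\boldsymbol{y}_j(t)=\sum_{k=1}^K \boldsymbol{H}_{jk}(t)\boldsymbol{x}_k(t)+\boldsymbol{z}_j(t)\in\mathbb{C}^M,$$ where $\boldsymbol{x}_k(t)\in\mathbb{C}^M$ is the signal of transmitter $k$, subject to the power constraint $\mathrm{E}(\|\boldsymbol{x}_k(t)\|^2)\le P$, $\boldsymbol{H}_{jk}(t)\in\mathbb{C}^{M\times M}$ is the channel matrix from transmitter $k$ to receiver $j$, and the noise $\boldsymbol{z}_j(t)$ has i.i.d. circularly symmetric complex Gaussian $\mathcal{CN}(0,1)$ entries, independent over receivers and time and independent of messages and channels. The entries of all channel matrices, for all transmitters, receivers and time instants, are drawn independently from some continuous distribution, and their absolute values are bounded between a positive minimum value and a finite maximum value. There is perfect channel state information at the receivers and global channel state information at the transmitters: all channel matrices over the whole coding block are known to all transmitters and all receivers. Capacity region $C(P)$: a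 rate tuple $(R_1,\dots,R_K)$ is achievable at power $P$ if there is a sequence of block codes of length $n\to\infty$ in which transmitter $k$ encodes a message from a set of size at least $2^{nR_k}$ (as a function of its own message and the channel matrices) meeting the power constraint, such that every receiver $j$ decodes message $j$ from its received signals and the channel matrices with error probability tending to $0$. $C(P)$ is the closure of the set of achievable rate tuples. DoF region: $$\mathcal{D}=\Big\{\boldsymbol{d}\in\mathbb{R}^K_+ : \exists\,(R_1(P),\dots,R_K(P))\in C(P)\text{ such that } d_k=\lim_{P\to\infty}\frac{R_k(P)}{\log P},\ 1\le k\le K\Big\},$$ with logarithm in the same base as the rates. *)

theory Defs
  imports "HOL-Probability.Probability"
begin

text \<open>
  Users are indexed by a finite type \<open>'k\<close>, so that \<open>K = CARD('k)\<close>, and the antennas of each node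
  by a finite type \<open>'m\<close>, so that \<open>M = CARD('m)\<close>.  The channel uses of a block of length \<open>n\<close> are
  the times \<open>t < n\<close>.

  A channel realisation \<open>h\<close> over a block assigns to \<open>(t, j, k, a, b)\<close> the gain at time \<open>t\<close> from
  antenna \<open>b\<close> of transmitter \<open>k\<close> to antenna \<open>a\<close> of receiver \<open>j\<close>.  A noise realisation assigns to
  \<open>(t, j, a)\<close> the noise at time \<open>t\<close> on antenna \<open>a\<close> of receiver \<open>j\<close>.
\<close>

type_synonym ('k, 'm) gains = "nat \<times> 'k \<times> 'k \<times> 'm \<times> 'm \<Rightarrow> complex"
type_synonym ('k, 'm) noises = "nat \<times> 'k \<times> 'm \<Rightarrow> complex"

definition channel_matrix ::
    "('k, 'm::finite) gains \<Rightarrow> 'k \<Rightarrow> 'k \<Rightarrow> nat \<Rightarrow> complex ^ 'm ^ 'm" where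
  "channel_matrix h j k t = (\<chi> a b. h (t, j, k, a, b))"

definition noise_vector :: "('k, 'm::finite) noises \<Rightarrow> 'k \<Rightarrow> nat \<Rightarrow> complex ^ 'm" where
  "noise_vector z j t = (\<chi> a. z (t, j, a))"

text \<open>All gains are independent with common law \<open>\<mu>\<close>.\<close>

definition channel_space :: "complex measure \<Rightarrow> nat \<Rightarrow> ('k, 'm) gains measure" where
  "channel_space \<mu> n = PiM ({..<n} \<times> UNIV) (\<lambda>_. \<mu>)"

text \<open>The law \<open>CN(0,1)\<close>: the real and the imaginary part are independent, each of variance \<open>1/2\<close>.\<close>

definition std_complex_normal :: "complex measure" where
  "std_complex_normal =
    distr (density lborel (normal_density 0 (sqrt (1/2))) \<Otimes>\<^sub>M
           density lborel (normal_density 0 (sqrt (1/2))))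
      borel (\<lambda>(x, y). Complex x y)"

definition noise_space :: "nat \<Rightarrow> ('k, 'm) noises measure" where
  "noise_space n = PiM ({..<n} \<times> UNIV) (\<lambda>_. std_complex_normal)"

definition message_space :: "('k \<Rightarrow> nat) \<Rightarrow> ('k \<Rightarrow> nat) measure" where
  "message_space L = PiM UNIV (\<lambda>k. uniform_count_measure {..<L k})"

definition joint_space ::
    "complex measure \<Rightarrow> nat \<Rightarrow> ('k \<Rightarrow> nat) \<Rightarrow>
      (('k, 'm) gains \<times> ('k \<Rightarrow> nat) \<times> ('k, 'm) noises) measure" where
  "joint_space \<mu> n L = channel_space \<mu> n \<Otimes>\<^sub>M (message_space L \<Otimes>\<^sub>M noise_space n)"

text \<open>
  \<open>enc k w h t\<close> is the vector sent at time \<open>t\<close> by transmitter \<open>k\<close> with message \<open>w\<close>;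
  \<open>dec j h y\<close> is the message decided on by receiver \<open>j\<close> from the received block \<open>y\<close>.
  Both know the gains \<open>h\<close> of the whole block.
\<close>

type_synonym ('k, 'm) encoders = "'k \<Rightarrow> nat \<Rightarrow> ('k, 'm) gains \<Rightarrow> nat \<Rightarrow> complex ^ 'm"
type_synonym ('k, 'm) decoders = "'k \<Rightarrow> ('k, 'm) gains \<Rightarrow> (nat \<Rightarrow> complex ^ 'm) \<Rightarrow> nat"

definition received ::
    "nat \<Rightarrow> ('k::finite, 'm::finite) encoders \<Rightarrow> 'k \<Rightarrow>
      ('k, 'm) gains \<Rightarrow> ('k \<Rightarrow> nat) \<Rightarrow> ('k, 'm) noises \<Rightarrow> nat \<Rightarrow> complex ^ 'm" where
  "received n enc j h w z =
    (\<lambda>t\<in>{..<n}. (\<Sum>k\<in>UNIV. channel_matrix h j k t *v enc k (w k) h t) + noise_vector z j t)"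

text \<open>
  Message \<open>k\<close> is uniform on \<open>{..<L k}\<close>.  The power is a nonnegative integral in \<open>ennreal\<close>, so that
  an infinite power violates the constraint.  The measurability conditions make this integral and
  the error events below well defined.
\<close>

definition block_code ::
    "complex measure \<Rightarrow> real \<Rightarrow> nat \<Rightarrow> ('k \<Rightarrow> nat) \<Rightarrow>
      ('k::finite, 'm::finite) encoders \<Rightarrow> ('k, 'm) decoders \<Rightarrow> bool" where
  "block_code \<mu> P n L enc dec \<longleftrightarrow>
    (\<forall>k. L k > 0) \<and>
    (\<forall>k. \<forall>w<L k. \<forall>t<n. (\<lambda>h. enc k w h t) \<in> borel_measurable (channel_space \<mu> n)) \<and>
    (\<forall>j. (\<lambda>(h, y). dec j h y)
       \<in> channel_space \<mu> n \<Otimes>\<^sub>M PiM {..<n} (\<lambda>_. borel) \<rightarrow>\<^sub>M count_space UNIV) \<and>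
    (\<forall>k. \<forall>t<n.
       (\<integral>\<^sup>+(h, w, z). ennreal ((norm (enc k (w k) h t))\<^sup>2)
          \<partial>(joint_space \<mu> n L :: (('k, 'm) gains \<times> ('k \<Rightarrow> nat) \<times> ('k, 'm) noises) measure))
       \<le> ennreal P)"

definition error_prob ::
    "complex measure \<Rightarrow> nat \<Rightarrow> ('k \<Rightarrow> nat) \<Rightarrow>
      ('k::finite, 'm::finite) encoders \<Rightarrow> ('k, 'm) decoders \<Rightarrow> 'k \<Rightarrow> real" where
  "error_prob \<mu> n L enc dec j =
    measure (joint_space \<mu> n L)
      {(h, w, z) \<in> space (joint_space \<mu> n L). dec j h (received n enc j h w z) \<noteq> w j}"

text \<open>
  The number of antennas does not occur in the type of a rate tuple and is passed as a type
  argument.  Rates are in bits per channel use.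
\<close>

definition achievable ::
    "'m::finite itself \<Rightarrow> complex measure \<Rightarrow> real \<Rightarrow> real ^ 'k::finite \<Rightarrow> bool" where
  "achievable TYPE('m) \<mu> P R \<longleftrightarrow>
    (\<forall>k. 0 \<le> R $ k) \<and>
    (\<exists>(L :: nat \<Rightarrow> 'k \<Rightarrow> nat) (enc :: nat \<Rightarrow> ('k, 'm) encoders) (dec :: nat \<Rightarrow> ('k, 'm) decoders).
       (\<forall>n. block_code \<mu> P n (L n) (enc n) (dec n)) \<and>
       (\<forall>n k. 2 powr (real n * R $ k) \<le> real (L n k)) \<and>
       (\<forall>j. (\<lambda>n. error_prob \<mu> n (L n) (enc n) (dec n) j) \<longlonglongrightarrow> 0))"

definition capacity_region ::
    "'m::finite itself \<Rightarrow> complex measure \<Rightarrow> real \<Rightarrow> (real ^ 'k::finite) set" where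
  "capacity_region TYPE('m) \<mu> P = closure {R. achievable TYPE('m) \<mu> P R}"

definition dof_region ::
    "'m::finite itself \<Rightarrow> complex measure \<Rightarrow> (real ^ 'k::finite) set" where
  "dof_region TYPE('m) \<mu> =
    {d. (\<forall>k. 0 \<le> d $ k) \<and>
        (\<exists>R. (\<forall>P>0. R P \<in> capacity_region TYPE('m) \<mu> P) \<and>
             (\<forall>k. ((\<lambda>P. R P $ k / log 2 P) \<longlongrightarrow> d $ k) at_top))}"

end

theory Submission imports Defs begin

text \<open>
  Converse: suppose receivers \<open>i\<close> and \<open>j\<close> both decode.  Knowing message \<open>i\<close>, receiver \<open>i\<close> can
  predict \<open>y\<^sub>j\<close> from \<open>y\<^sub>i\<close> up to bounded noise at every time at which the matrix from transmitter \<open>j\<close>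
  to receiver \<open>i\<close> is well conditioned, which is almost every time.  So the sets of pairs \<open>(y\<^sub>i, y\<^sub>j)\<close>
  decoded correctly are disjoint, and \<open>y\<^sub>j\<close> contributes only a constant factor per time to the volume
  that they share: the number of message pairs is at most \<open>(c P)\<close> to the power \<open>n M\<close>, up to an
  arbitrarily small loss in the exponent.  Gaussian weights replace volumes of balls.

  Achievability: for a fixed power all cross gains are quantised finely enough and two times with
  the same quantised cross gains are paired, which leaves boundedly many times unpaired.  Every
  transmitter repeats its vector at both times of a pair, and every receiver subtracts its two
  observations: the interference cancels up to a bounded remainder, while the direct channel becomes
  the difference of two independent matrices, which is almost surely invertible.  This gives each user
  \<open>M/2\<close> degrees of freedom.  If one coordinate of the target exceeds \<open>M/2\<close>, that user
  additionally transmits alone for a fraction of the time.  The vectors have entries in a finite grid; a slot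
  is received wrongly with a small probability, independently of the other slots given the cross
  gains, and an outer code of large minimum distance over this alphabet corrects these errors.
\<close>

section \<open>Product measures and random coding\<close>

text \<open>The gain law is only bounded and free of atoms: it may lack a density and any symmetry,
  so a realisation need not have a complementary one that cancels the interference by addition.
  Hence equal cross gains are sought and subtracted. The quantisation ignores the direct gains, so
  that these stay independent of the pairing.

  The order of choices matters. The thresholds \<open>\<eta>\<close> and \<open>\<rho>\<close>
  depend only on the failure probability wanted for a slot; the grid spacing grows like a small
  power of \<open>P\<close> and passes them for large \<open>P\<close>; the number of cells depends
  on \<open>P\<close> but not on the block length, so unpaired times do not affect the rate. The
  failure probability of a slot stays fixed as the block grows, so some slots do fail, whence the
  outer code.

  In the converse the inverse of a channel matrix has no uniform bound. At a weak time the
  prediction is replaced by the centre 0 with variance \<open>P\<close>, which costs one more factor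
  \<open>P\<close> per antenna; the fraction of such times can be made small before \<open>P\<close>
  is chosen.\<close>

lemma AE_PiM_separately_affine_nonzero:
  fixes f :: "('i \<Rightarrow> complex) \<Rightarrow> complex"
  assumes \<mu>: "prob_space \<mu>" "sets \<mu> = sets borel" "\<And>x. measure \<mu> {x} = 0"
    and "finite I" and "f \<in> borel_measurable (PiM I (\<lambda>_. \<mu>))"
    and "\<And>x i. \<exists>c d. \<forall>v. f (x(i := v)) = c + d * v"
    and "x0 \<in> extensional I" "f x0 \<noteq> 0"
  shows "AE x in PiM I (\<lambda>_. \<mu>). f x \<noteq> 0"
  using assms(4-)
proof (induction I arbitrary: f x0)
  case empty
  have "AE x in PiM {} (\<lambda>_. \<mu>). x = x0"
    using empty by (intro AE_I2) (auto simp: space_PiM)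
  then show ?case using empty by auto
next
  case (insert i I)
  interpret mu: prob_space \<mu> by fact
  interpret product_prob_space "\<lambda>_. \<mu>" by (intro product_prob_spaceI \<mu>)
  note [measurable] = insert.prems(1)
  have [measurable_cong]: "sets \<mu> = sets borel" by fact
  have space_mu: "space \<mu> = UNIV" using \<mu>(2) by (metis sets_eq_imp_space_eq space_borel)
  \<comment> \<open>Freezing coordinate \<open>i\<close> at its value in the witness
    \<open>x0\<close> gives a function on fewer coordinates that is nonzero at the rest of
    \<open>x0\<close>, so the induction hypothesis applies. Where \<open>g x \<noteq> 0\<close>, the
    affine function of coordinate \<open>i\<close> is not identically zero, so it has at most one
    root, and a point is a null set.\<close>
  define g where "g = (\<lambda>x. f (x(i := x0 i)))"
  have gm[measurable]: "g \<in> borel_measurable (PiM I (\<lambda>_. \<mu>))"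
    unfolding g_def
    by (rule measurable_compose[OF _ insert.prems(1)])
       (rule measurable_fun_upd[where J=I], auto simp: space_mu)
  have ga: "\<exists>c d. \<forall>v. g (x(j := v)) = c + d * v" for x j
  proof (cases "j = i")
    case True then show ?thesis unfolding g_def by (intro exI[of _ "g x"] exI[of _ 0]) (simp add: g_def)
  next
    case False then show ?thesis unfolding g_def
      using insert.prems(2)[of "x(i := x0 i)" j] by (simp add: fun_upd_twist[OF False] del: fun_upd_apply)
  qed
  have g0: "g (x0(i := undefined)) \<noteq> 0" using insert.prems by (simp add: g_def)
  have e0: "x0(i := undefined) \<in> extensional I" using insert.prems(3) by (auto simp: extensional_def)
  from insert.IH[OF gm ga e0 g0] have AEg: "AE x in PiM I (\<lambda>_. \<mu>). g x \<noteq> 0" .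
  have inner: "(\<integral>\<^sup>+ y. indicator {x. \<not> f x \<noteq> 0} (x(i := y)) \<partial>\<mu>) = 0" if "g x \<noteq> 0" for x
  proof -
    obtain c d where cd: "\<And>v. f (x(i := v)) = c + d * v" using insert.prems(2)[of x i] by blast
    have "(\<integral>\<^sup>+ y. indicator {x. \<not> f x \<noteq> 0} (x(i := y)) \<partial>\<mu>) \<le> (\<integral>\<^sup>+ y. indicator {- c / d} y \<partial>\<mu>)"
    proof (rule nn_integral_mono)
      fix y
      have "y = - c / d" if "c + d * y = 0"
      proof -
        have "d \<noteq> 0" using cd[of "x0 i"] \<open>g x \<noteq> 0\<close> that by (auto simp: g_def)
        then show ?thesis using that by (simp add: field_simps eq_neg_iff_add_eq_0)
      qed
      then show "(indicator {x. \<not> f x \<noteq> 0} (x(i := y))::ennreal) \<le> indicator {- c / d} y"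
        by (auto simp: indicator_def cd)
    qed
    also have "\<dots> = emeasure \<mu> {- c / d}" using \<mu>(2) by (subst nn_integral_indicator) auto
    also have "\<dots> = 0" using \<mu>(3)[of "- c / d"] by (simp add: mu.emeasure_eq_measure)
    finally show ?thesis by simp
  qed
  have "integral\<^sup>N (PiM (insert i I) (\<lambda>_. \<mu>)) (indicator {x \<in> space (PiM (insert i I) (\<lambda>_. \<mu>)). \<not> f x \<noteq> 0})
      = (\<integral>\<^sup>+ x. (\<integral>\<^sup>+ y. indicator {x \<in> space (PiM (insert i I) (\<lambda>_. \<mu>)). \<not> f x \<noteq> 0} (x(i := y)) \<partial>\<mu>) \<partial>PiM I (\<lambda>_. \<mu>))"
    using insert.hyps by (intro product_nn_integral_insert) auto
  also have "\<dots> \<le> (\<integral>\<^sup>+ x. (\<integral>\<^sup>+ y. indicator {x. \<not> f x \<noteq> 0} (x(i := y)) \<partial>\<mu>) \<partial>PiM I (\<lambda>_. \<mu>))"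
    by (intro nn_integral_mono) (auto simp: indicator_def)
  also have "\<dots> = (\<integral>\<^sup>+ x. 0 \<partial>PiM I (\<lambda>_. \<mu>))"
    using AEg by (intro nn_integral_cong_AE) (auto elim!: eventually_mono simp: inner[simplified])
  finally have "integral\<^sup>N (PiM (insert i I) (\<lambda>_. \<mu>)) (indicator {x \<in> space (PiM (insert i I) (\<lambda>_. \<mu>)). \<not> f x \<noteq> 0}) = 0"
    by simp
  then have "emeasure (PiM (insert i I) (\<lambda>_. \<mu>)) {x \<in> space (PiM (insert i I) (\<lambda>_. \<mu>)). \<not> f x \<noteq> 0} = 0"
    by (subst (asm) nn_integral_indicator) auto
  then show ?case by (intro AE_I'[of "{x \<in> space (PiM (insert i I) (\<lambda>_. \<mu>)). \<not> f x \<noteq> 0}"]) (auto simp: null_sets_def)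
qed

text \<open>Coordinates of a product measure are independent, hence so are their restrictions to
  disjoint blocks. The injection \<open>f s\<close> relabels a block by a standard index set
  \<open>J s\<close>, so that slots sitting at different times can share one event.\<close>

lemma prob_PiM_blocks:
  assumes \<nu>: "prob_space \<nu>" and "finite I" "finite S"
    and f: "\<And>s. s \<in> S \<Longrightarrow> inj_on (f s) (J s)" "\<And>s. s \<in> S \<Longrightarrow> f s \<in> J s \<rightarrow> I"
    and ne: "\<And>s. s \<in> S \<Longrightarrow> J s \<noteq> {}"
    and disj: "disjoint_family_on (\<lambda>s. f s ` J s) S"
    and A: "\<And>s. s \<in> S \<Longrightarrow> A s \<in> sets (PiM (J s) (\<lambda>_. \<nu>))"
  shows "measure (PiM I (\<lambda>_. \<nu>)) {x \<in> space (PiM I (\<lambda>_. \<nu>)). \<forall>s\<in>S. (\<lambda>j\<in>J s. x (f s j)) \<in> A s}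
    = (\<Prod>s\<in>S. measure (PiM (J s) (\<lambda>_. \<nu>)) (A s))"
proof (cases "S = {}")
  case True
  interpret P: prob_space "PiM I (\<lambda>_. \<nu>)" using \<nu> by (intro prob_space_PiM)
  show ?thesis using True by (simp add: P.prob_space)
next
  case False
  let ?M = "\<lambda>_. \<nu>"
  interpret P: prob_space "PiM I ?M" using \<nu> by (intro prob_space_PiM)
  have "I \<noteq> {}" using False f(2) ne by fastforce
  have "P.indep_vars ?M (\<lambda>i x. x i) I"
  proof (subst P.indep_vars_iff_distr_eq_PiM')
    have "distr (PiM I ?M) (PiM I ?M) (\<lambda>x. \<lambda>i\<in>I. x i) = distr (PiM I ?M) (PiM I ?M) (\<lambda>x. x)"
      by (intro distr_cong) (auto simp: space_PiM)
    also have "\<dots> = PiM I ?M" by (rule distr_id2) simp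
    also have "\<dots> = PiM I (\<lambda>i. distr (PiM I ?M) \<nu> (\<lambda>x. x i))"
      using \<nu> by (intro PiM_cong refl distr_PiM_component[symmetric])
    finally show "distr (PiM I ?M) (PiM I ?M) (\<lambda>x. \<lambda>i\<in>I. x i) = PiM I (\<lambda>i. distr (PiM I ?M) \<nu> (\<lambda>x. x i))" .
  qed (use \<open>I \<noteq> {}\<close> in auto)
  then have "P.indep_vars (\<lambda>s. PiM (f s ` J s) ?M) (\<lambda>s \<omega>. restrict (\<lambda>i. \<omega> i) (f s ` J s)) S"
    by (rule P.indep_vars_restrict) (use f disj in auto)
  then have "P.indep_vars (\<lambda>s. PiM (J s) ?M)
      (\<lambda>s \<omega>. (\<lambda>y. \<lambda>j\<in>J s. y (f s j)) (restrict (\<lambda>i. \<omega> i) (f s ` J s))) S"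
    by (rule P.indep_vars_compose2) (intro measurable_restrict measurable_component_singleton, auto)
  then have "P.indep_vars (\<lambda>s. PiM (J s) ?M) (\<lambda>s \<omega>. \<lambda>j\<in>J s. \<omega> (f s j)) S"
    by (rule P.indep_vars_cong[THEN iffD1, rotated -1]) (auto simp: fun_eq_iff)
  then have "P.prob (\<Inter>s\<in>S. (\<lambda>\<omega>. \<lambda>j\<in>J s. \<omega> (f s j)) -` A s \<inter> space (PiM I ?M)) =
    (\<Prod>s\<in>S. P.prob ((\<lambda>\<omega>. \<lambda>j\<in>J s. \<omega> (f s j)) -` A s \<inter> space (PiM I ?M)))"
    by (rule P.indep_varsD_finite) (use False \<open>finite S\<close> A in auto)
  also have "\<dots> = (\<Prod>s\<in>S. measure (PiM (J s) ?M) (A s))"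
  proof (intro prod.cong refl)
    fix s assume s: "s \<in> S"
    have "measure (PiM (J s) ?M) (A s) = measure (distr (PiM I ?M) (PiM (J s) ?M) (\<lambda>\<omega>. \<lambda>j\<in>J s. \<omega> (f s j))) (A s)"
      using distr_PiM_reindex[of I ?M "f s" "J s"] \<nu> f[OF s] by simp
    also have "\<dots> = P.prob ((\<lambda>\<omega>. \<lambda>j\<in>J s. \<omega> (f s j)) -` A s \<inter> space (PiM I ?M))"
      using f[OF s] A[OF s] by (intro measure_distr) (auto intro!: measurable_restrict measurable_component_singleton)
    finally show "P.prob ((\<lambda>\<omega>. \<lambda>j\<in>J s. \<omega> (f s j)) -` A s \<inter> space (PiM I ?M)) = measure (PiM (J s) ?M) (A s)" ..
  qed
  also have "(\<Inter>s\<in>S. (\<lambda>\<omega>. \<lambda>j\<in>J s. \<omega> (f s j)) -` A s \<inter> space (PiM I ?M))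
      = {x \<in> space (PiM I ?M). \<forall>s\<in>S. (\<lambda>j\<in>J s. x (f s j)) \<in> A s}"
    using False by auto
  finally show ?thesis .
qed

text \<open>A crude substitute for a Chernoff bound: a union bound over the sets of events that
  occur, of which there are at most \<open>2 ^ N\<close>. The factor is harmless because
  \<open>p\<close> is later made small enough for \<open>p ^ m\<close> to beat it.\<close>

lemma (in prob_space) prob_card_ge_le:
  assumes ev: "\<And>s. s < N \<Longrightarrow> B s \<in> events" and p: "0 \<le> p" "p \<le> 1"
    and le: "\<And>S. S \<subseteq> {..<N} \<Longrightarrow> prob {x \<in> space M. \<forall>s\<in>S. x \<in> B s} \<le> p ^ card S"
  shows "prob {x \<in> space M. m \<le> card {s. s < N \<and> x \<in> B s}} \<le> 2 ^ N * p ^ m"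
proof -
  let ?F = "{S. S \<subseteq> {..<N} \<and> m \<le> card S}"
  have fin: "finite ?F" by (rule finite_subset[of _ "Pow {..<N}"]) auto
  have m: "{x \<in> space M. \<forall>s\<in>S. x \<in> B s} \<in> events" if "S \<subseteq> {..<N}" for S
  proof (cases "S = {}")
    case False
    have "{x \<in> space M. x \<in> B s} = B s" if "s < N" for s
      using sets.sets_into_space[OF ev[OF that]] by auto
    then show ?thesis
      using False that finite_subset[OF that] ev by (intro sets.sets_Collect_finite_All') (auto simp: subset_eq)
  qed simp
  have "prob {x \<in> space M. m \<le> card {s. s < N \<and> x \<in> B s}} \<le> prob (\<Union>S\<in>?F. {x \<in> space M. \<forall>s\<in>S. x \<in> B s})"
    using m by (intro finite_measure_mono sets.finite_UN fin) (auto intro!: exI[of _ "{s. s < N \<and> _ \<in> B s}"])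
  also have "\<dots> \<le> (\<Sum>S\<in>?F. prob {x \<in> space M. \<forall>s\<in>S. x \<in> B s})"
    using m by (intro finite_measure_subadditive_finite fin) auto
  also have "\<dots> \<le> (\<Sum>S\<in>?F. p ^ m)"
    using le p by (intro sum_mono) (auto intro!: order_trans[OF le] power_decreasing)
  also have "\<dots> = real (card ?F) * p ^ m" by simp
  also have "\<dots> \<le> 2 ^ N * p ^ m"
  proof (intro mult_right_mono)
    have "card ?F \<le> card (Pow {..<N})" by (intro card_mono) auto
    then show "real (card ?F) \<le> 2 ^ N" by (simp add: card_Pow)
  qed (use p in auto)
  finally show ?thesis .
qed

lemma prob_PiM_blocks_card_ge_le:
  fixes N m :: nat
  assumes \<nu>: "prob_space \<nu>" and I: "finite I"
    and f: "\<And>s. s < N \<Longrightarrow> inj_on (f s) (J s)" "\<And>s. s < N \<Longrightarrow> f s \<in> J s \<rightarrow> I"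
    and ne: "\<And>s. s < N \<Longrightarrow> J s \<noteq> {}"
    and disj: "disjoint_family_on (\<lambda>s. f s ` J s) {..<N}"
    and A: "\<And>s. s < N \<Longrightarrow> A s \<in> sets (PiM (J s) (\<lambda>_. \<nu>))"
    and p: "0 \<le> p" "p \<le> 1" "\<And>s. s < N \<Longrightarrow> measure (PiM (J s) (\<lambda>_. \<nu>)) (A s) \<le> p"
  shows "measure (PiM I (\<lambda>_. \<nu>)) {x \<in> space (PiM I (\<lambda>_. \<nu>)). m \<le> card {s. s < N \<and> (\<lambda>j\<in>J s. x (f s j)) \<in> A s}}
    \<le> 2 ^ N * p ^ m"
proof -
  interpret P: prob_space "PiM I (\<lambda>_. \<nu>)" using \<nu> by (intro prob_space_PiM)
  let ?B = "\<lambda>s. {x \<in> space (PiM I (\<lambda>_. \<nu>)). (\<lambda>j\<in>J s. x (f s j)) \<in> A s}"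
  have "P.prob {x \<in> space (PiM I (\<lambda>_. \<nu>)). m \<le> card {s. s < N \<and> x \<in> ?B s}} \<le> 2 ^ N * p ^ m"
  proof (rule P.prob_card_ge_le)
    fix s assume s: "s < N"
    have "(\<lambda>x. \<lambda>j\<in>J s. x (f s j)) \<in> PiM I (\<lambda>_. \<nu>) \<rightarrow>\<^sub>M PiM (J s) (\<lambda>_. \<nu>)"
      using f(2)[OF s] by (intro measurable_restrict measurable_component_singleton) auto
    from measurable_sets[OF this A[OF s]]
    show "?B s \<in> P.events" by (simp add: vimage_def Int_def conj_commute)
  next
    fix S assume S: "S \<subseteq> {..<N}"
    then have "finite S" by (rule finite_subset) simp
    have "{x \<in> space (PiM I (\<lambda>_. \<nu>)). \<forall>s\<in>S. x \<in> ?B s}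
      = {x \<in> space (PiM I (\<lambda>_. \<nu>)). \<forall>s\<in>S. (\<lambda>j\<in>J s. x (f s j)) \<in> A s}" by auto
    then have "P.prob {x \<in> space (PiM I (\<lambda>_. \<nu>)). \<forall>s\<in>S. x \<in> ?B s}
      = (\<Prod>s\<in>S. measure (PiM (J s) (\<lambda>_. \<nu>)) (A s))"
      using prob_PiM_blocks[OF \<nu> I \<open>finite S\<close>, of f J A] S f ne A disjoint_family_on_mono[OF S disj]
      by (auto simp: subset_eq)
    also have "\<dots> \<le> (\<Prod>s\<in>S. p)" using S p by (intro prod_mono) auto
    finally show "P.prob {x \<in> space (PiM I (\<lambda>_. \<nu>)). \<forall>s\<in>S. x \<in> ?B s} \<le> p ^ card S" by simp
  qed (use p in auto)
  also have "{x \<in> space (PiM I (\<lambda>_. \<nu>)). m \<le> card {s. s < N \<and> x \<in> ?B s}}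
    = {x \<in> space (PiM I (\<lambda>_. \<nu>)). m \<le> card {s. s < N \<and> (\<lambda>j\<in>J s. x (f s j)) \<in> A s}}"
    by (intro Collect_cong conj_cong refl) auto
  finally show ?thesis .
qed

section \<open>Pairing of equally coloured times and codes of large distance\<close>

lemma exists_pairing:
  fixes c :: "nat \<Rightarrow> 'c"
  assumes "finite X" "finite C" "c ` X \<subseteq> C"
  shows "\<exists>ps. length ps = (card X - card C) div 2 \<and> distinct (map fst ps @ map snd ps)
    \<and> set (map fst ps @ map snd ps) \<subseteq> X \<and> (\<forall>(s, t) \<in> set ps. c s = c t)"
  using assms
proof (induction "card X" arbitrary: X rule: less_induct)
  case less
  show ?case
  proof (cases "card X \<le> card C + 1")
    \<comment> \<open>With at most one point more than colours the truncated quotient is 0 and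
      nothing has to be paired.\<close>
    case True then show ?thesis by (intro exI[of _ "[]"]) auto
  next
    case False
    \<comment> \<open>Pigeonhole: there are more points than colours, so two share one. Removing
      them lowers the required length by exactly one.\<close>
    have "\<not> inj_on c X"
    proof
      assume "inj_on c X"
      then have "card X = card (c ` X)" by (simp add: card_image)
      also have "\<dots> \<le> card C" using less.prems by (intro card_mono) auto
      finally show False using False by simp
    qed
    then obtain s t where st: "s \<in> X" "t \<in> X" "s \<noteq> t" "c s = c t" by (auto simp: inj_on_def)
    let ?X = "X - {s, t}"
    have cX: "card ?X = card X - 2" using st less.prems by (simp add: card_Diff_subset)
    have "card ?X < card X" using cX False by simp
    moreover have "finite ?X" "c ` ?X \<subseteq> C" using less.prems by auto
    ultimately obtain ps where ps: "length ps = (card ?X - card C) div 2"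
      "distinct (map fst ps @ map snd ps)" "set (map fst ps @ map snd ps) \<subseteq> ?X" "\<forall>(s, t) \<in> set ps. c s = c t"
      using less.hyps[of ?X] \<open>finite C\<close> by blast
    show ?thesis
    proof (intro exI[of _ "(s, t) # ps"] conjI)
      show "length ((s, t) # ps) = (card X - card C) div 2" using ps(1) cX False by auto
    qed (use ps st in auto)
  qed
qed

text \<open>A maximal code is covering, since an uncovered word could be added to it. A ball of
  radius \<open>D\<close> has at most \<open>2 ^ N * card A ^ D\<close> points: choose the changed
  positions, then the letters there. The crude \<open>2 ^ N\<close> costs one bit per slot, while
  the bits carried by a letter grow with the power.\<close>

lemma gilbert_varshamov:
  fixes A :: "'a set"
  assumes "finite A" "A \<noteq> {}"
  shows "\<exists>L (cw :: nat \<Rightarrow> nat \<Rightarrow> 'a). (\<forall>w<L. \<forall>s<N. cw w s \<in> A) \<and>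
    (\<forall>w<L. \<forall>w'<L. w \<noteq> w' \<longrightarrow> D \<le> card {s. s < N \<and> cw w s \<noteq> cw w' s}) \<and>
    card A ^ N \<le> L * (2 ^ N * card A ^ D)"
proof -
  let ?W = "PiE {..<N} (\<lambda>_. A)"
  let ?d = "\<lambda>x y. card {s. s < N \<and> x s \<noteq> y s}"
  define good where "good = (\<lambda>C. C \<subseteq> ?W \<and> (\<forall>x\<in>C. \<forall>y\<in>C. x \<noteq> y \<longrightarrow> D \<le> ?d x y))"
  have finW: "finite ?W" using assms by (intro finite_PiE) auto
  have "finite {C. good C}" by (rule finite_subset[of _ "Pow ?W"]) (auto simp: good_def finW)
  moreover have "good {}" by (simp add: good_def)
  ultimately obtain C where C: "good C" "\<And>C'. good C' \<Longrightarrow> C \<subseteq> C' \<Longrightarrow> C' = C"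
    using finite_has_maximal[of "{C. good C}"] by auto
  have CW: "C \<subseteq> ?W" using C(1) by (auto simp: good_def)
  have finC: "finite C" using finite_subset[OF CW finW] .
  have cA: "card A \<ge> 1" using assms by (simp add: Suc_leI card_gt_0_iff)
  let ?ball = "\<lambda>c S. {x \<in> ?W. \<forall>s\<in>{..<N} - S. x s = c s}"
  let ?T = "{S. S \<subseteq> {..<N} \<and> card S \<le> D}"
  have finT: "finite ?T" by (rule finite_subset[of _ "Pow {..<N}"]) auto
  have "?W \<subseteq> (\<Union>c\<in>C. \<Union>S\<in>?T. ?ball c S)"
  proof
    fix x assume x: "x \<in> ?W"
    show "x \<in> (\<Union>c\<in>C. \<Union>S\<in>?T. ?ball c S)"
    proof (cases "x \<in> C")
      case True then show ?thesis using x by (intro UN_I[of x] UN_I[of "{}"]) auto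
    next
      case False
      then have "\<not> good (insert x C)" using C(2)[of "insert x C"] by auto
      then obtain c where c: "c \<in> C" "\<not> D \<le> ?d x c"
      proof -
        have sym: "?d y z = ?d z y" for y z :: "nat \<Rightarrow> 'a" by (metis)
        have "\<exists>c\<in>C. \<not> D \<le> ?d x c"
        proof (rule ccontr)
          assume "\<not> (\<exists>c\<in>C. \<not> D \<le> ?d x c)"
          then have *: "D \<le> ?d x c" "D \<le> ?d c x" if "c \<in> C" for c using that sym[of x c] by auto
          have "good (insert x C)" unfolding good_def
          proof (intro conjI ballI impI)
            fix y z assume "y \<in> insert x C" "z \<in> insert x C" "y \<noteq> z"
            then consider "y \<in> C" "z \<in> C" | "y = x" "z \<in> C" | "y \<in> C" "z = x" by auto
            then show "D \<le> ?d y z"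
              by cases (use C(1) \<open>y \<noteq> z\<close> * in \<open>auto simp: good_def\<close>)
          qed (use x CW in auto)
          with \<open>\<not> good (insert x C)\<close> show False by simp
        qed
        then show thesis using that by blast
      qed
      have "x \<in> ?ball c {s. s < N \<and> x s \<noteq> c s}" using x by auto
      then show ?thesis using c by (intro UN_I[of c] UN_I[of "{s. s < N \<and> x s \<noteq> c s}"]) auto
    qed
  qed
  then have "card ?W \<le> card (\<Union>c\<in>C. \<Union>S\<in>?T. ?ball c S)"
    by (rule card_mono[rotated]) (intro finite_UN_I finC finT finite_subset[OF _ finW], auto)
  also have "\<dots> \<le> (\<Sum>c\<in>C. card (\<Union>S\<in>?T. ?ball c S))" by (rule card_UN_le[OF finC])
  also have "\<dots> \<le> (\<Sum>c\<in>C. \<Sum>S\<in>?T. card (?ball c S))" by (intro sum_mono card_UN_le finT)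
  also have "\<dots> \<le> (\<Sum>c\<in>C. \<Sum>S\<in>?T. card A ^ D)"
  proof (intro sum_mono)
    fix c S assume S: "S \<in> ?T"
    have "finite S" using S finite_subset by auto
    \<comment> \<open>Off \<open>S\<close> a word of the ball agrees with \<open>c\<close>, so its
      restriction to \<open>S\<close> determines it.\<close>
    have "card (?ball c S) \<le> card (PiE S (\<lambda>_. A))"
    proof (rule card_inj_on_le[where f="\<lambda>x. restrict x S"])
      show "inj_on (\<lambda>x. restrict x S) (?ball c S)"
      proof (rule inj_onI)
        fix x y assume x: "x \<in> ?ball c S" and y: "y \<in> ?ball c S" and eq: "restrict x S = restrict y S"
        show "x = y"
        proof
          fix s show "x s = y s"
          proof (cases "s \<in> S")
            case True then show ?thesis using fun_cong[OF eq, of s] by simp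
          next
            case False then show ?thesis using x y by (cases "s < N") (auto simp: PiE_def extensional_def)
          qed
        qed
      qed
      show "finite (PiE S (\<lambda>_. A))" using assms \<open>finite S\<close> by (intro finite_PiE) auto
    qed (use S in auto)
    also have "\<dots> = card A ^ card S" using \<open>finite S\<close> by (simp add: card_PiE)
    also have "\<dots> \<le> card A ^ D" using S cA by (intro power_increasing) auto
    finally show "card (?ball c S) \<le> card A ^ D" .
  qed
  also have "\<dots> = card C * (card ?T * card A ^ D)" by simp
  also have "\<dots> \<le> card C * (2 ^ N * card A ^ D)"
  proof -
    have "card ?T \<le> card (Pow {..<N})" by (intro card_mono) auto
    then show ?thesis by (simp add: card_Pow)
  qed
  finally have cnt: "card A ^ N \<le> card C * (2 ^ N * card A ^ D)" by (simp add: card_PiE)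
  obtain cw where cw: "bij_betw cw {..<card C} C"
    using ex_bij_betw_nat_finite[OF finC] by (auto simp: atLeast0LessThan)
  show ?thesis
  proof (intro exI[of _ "card C"] exI[of _ cw] conjI allI impI)
    fix w s assume "w < card C" "s < N"
    then show "cw w s \<in> A" using cw CW by (auto simp: bij_betw_def PiE_def Pi_def)
  next
    fix w w' assume "w < card C" "w' < card C" "w \<noteq> w'"
    then have "cw w \<in> C" "cw w' \<in> C" "cw w \<noteq> cw w'" using cw by (auto simp: bij_betw_def inj_on_def)
    then show "D \<le> ?d (cw w) (cw w')" using C(1) by (auto simp: good_def)
  qed (rule cnt)
qed

section \<open>Square complex matrices bounded from below\<close>

lemma norm_matrix_vector_mult_le:
  fixes A :: "complex ^ 'm ^ 'n"
  assumes "\<And>a b. norm (A $ a $ b) \<le> c"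
  shows "norm (A *v v) \<le> real CARD('n) * real CARD('m) * c * norm v"
proof -
  have c: "0 \<le> c" using assms[of undefined undefined] norm_ge_zero order_trans by blast
  have "norm (A *v v) \<le> (\<Sum>a\<in>UNIV. norm ((A *v v) $ a))"
    unfolding norm_vec_def by (rule L2_set_le_sum) simp
  also have "\<dots> \<le> (\<Sum>a\<in>(UNIV::'n set). real CARD('m) * c * norm v)"
  proof (intro sum_mono)
    fix a
    have "norm ((A *v v) $ a) \<le> (\<Sum>b\<in>UNIV. norm (A $ a $ b * v $ b))"
      by (simp add: matrix_vector_mult_def norm_sum)
    also have "\<dots> \<le> (\<Sum>b\<in>(UNIV::'m set). c * norm v)"
      unfolding norm_mult by (intro sum_mono mult_mono assms Finite_Cartesian_Product.norm_nth_le c norm_ge_zero)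
    finally show "norm ((A *v v) $ a) \<le> real CARD('m) * c * norm v" by (simp add: mult_ac)
  qed
  finally show ?thesis by (simp add: mult_ac)
qed

text \<open>The least singular value of \<open>G\<close> is at least \<open>\<eta>\<close>. This
  quantifies invertibility by a closed condition, which makes measurability immediate.\<close>

definition bounded_below :: "real \<Rightarrow> complex ^ 'm ^ 'm \<Rightarrow> bool" where
  "bounded_below \<eta> G \<longleftrightarrow> (\<forall>v. \<eta> * norm v \<le> norm (G *v v))"

lemma continuous_on_matrix_vector_mult [continuous_intros]:
  fixes A :: "'a::topological_space \<Rightarrow> complex ^ 'm ^ 'n"
  assumes "continuous_on S A" "continuous_on S v"
  shows "continuous_on S (\<lambda>x. A x *v v x)"
  unfolding matrix_vector_mult_def
  by (intro continuous_intros assms continuous_on_vec_lambda)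

lemma borel_measurable_vec_lambda [measurable]:
  fixes f :: "'a \<Rightarrow> 'n::finite \<Rightarrow> 'b::euclidean_space"
  assumes "\<And>a. (\<lambda>x. f x a) \<in> borel_measurable M"
  shows "(\<lambda>x. \<chi> a. f x a) \<in> borel_measurable M"
proof (subst borel_measurable_euclidean_space, safe)
  fix i :: "'b ^ 'n" assume "i \<in> Basis"
  then obtain k u where "i = axis k u" "u \<in> Basis" by (auto simp: Basis_vec_def)
  then show "(\<lambda>x. (\<chi> a. f x a) \<bullet> i) \<in> borel_measurable M"
    using assms by (simp add: inner_axis)
qed

lemma borel_measurable_vec_nth [measurable]:
  fixes f :: "'a \<Rightarrow> 'b::euclidean_space ^ 'n"
  assumes "f \<in> borel_measurable M"
  shows "(\<lambda>x. f x $ a) \<in> borel_measurable M"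
  by (rule measurable_compose[OF assms borel_measurable_continuous_onI]) (intro continuous_intros)

lemma borel_measurable_matrix_vector_mult [measurable]:
  fixes A :: "'a \<Rightarrow> complex ^ 'm ^ 'n"
  assumes [measurable]: "A \<in> borel_measurable M" "v \<in> borel_measurable M"
  shows "(\<lambda>x. A x *v v x) \<in> borel_measurable M"
  unfolding matrix_vector_mult_def by measurable

lemma measurable_bounded_below [measurable]:
  "Measurable.pred borel (bounded_below \<eta> :: complex ^ 'm ^ 'm \<Rightarrow> bool)"
proof -
  have "closed {G :: complex ^ 'm ^ 'm. bounded_below \<eta> G}"
    unfolding bounded_below_def
    by (intro closed_Collect_all closed_Collect_le continuous_intros)
  then show ?thesis by (simp add: pred_def borel_closed)
qed

lemma bounded_below_mono: "bounded_below \<eta> G \<Longrightarrow> \<eta>' \<le> \<eta> \<Longrightarrow> bounded_below \<eta>' G"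
  unfolding bounded_below_def by (meson mult_right_mono norm_ge_zero order_trans)

text \<open>A left inverse has finite norm, and the reciprocal of a bound on it is the required
  \<open>\<eta>\<close>.\<close>

lemma bounded_below_if_det_nonzero:
  fixes G :: "complex ^ 'm ^ 'm"
  assumes "det G \<noteq> 0"
  shows "\<exists>\<eta>>0. bounded_below \<eta> G"
proof -
  obtain B where B: "B ** G = mat 1" using assms by (auto simp: invertible_det_nz[symmetric] invertible_def)
  define c where "c = (\<Sum>a\<in>UNIV. \<Sum>b\<in>UNIV. norm (B $ a $ b))"
  have c: "norm (B $ a $ b) \<le> c" for a b
  proof -
    have "norm (B $ a $ b) \<le> (\<Sum>b\<in>UNIV. norm (B $ a $ b))" by (rule member_le_sum) auto
    also have "\<dots> \<le> c" unfolding c_def by (rule member_le_sum) (auto intro: sum_nonneg)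
    finally show ?thesis .
  qed
  define C where "C = real CARD('m) * real CARD('m) * c + 1"
  have "C > 0" using order_trans[OF norm_ge_zero c] unfolding C_def by (simp add: add_nonneg_pos)
  have "norm v \<le> C * norm (G *v v)" for v
  proof -
    have "norm v = norm (B *v (G *v v))" using B by (simp add: matrix_vector_mul_assoc)
    also have "\<dots> \<le> real CARD('m) * real CARD('m) * c * norm (G *v v)"
      by (rule norm_matrix_vector_mult_le[OF c])
    also have "\<dots> \<le> C * norm (G *v v)" unfolding C_def by (intro mult_right_mono) auto
    finally show ?thesis .
  qed
  then have "bounded_below (1 / C) G" using \<open>C > 0\<close> by (simp add: bounded_below_def field_simps)
  then show ?thesis using \<open>C > 0\<close> by (intro exI[of _ "1 / C"]) auto
qed

text \<open>The events for \<open>\<eta> = 1 / (n + 1)\<close> decrease to a null event, because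
  almost every matrix is invertible. Continuity from above gives no rate, only some threshold, and
  that is enough.\<close>

lemma (in prob_space) prob_not_bounded_below_le:
  fixes G :: "'a \<Rightarrow> complex ^ 'm ^ 'm"
  assumes [measurable]: "G \<in> borel_measurable M" and "AE x in M. det (G x) \<noteq> 0" and "0 < p"
  shows "\<exists>\<eta>>0. prob {x \<in> space M. \<not> bounded_below \<eta> (G x)} \<le> p"
proof -
  define A where "A = (\<lambda>n. {x \<in> space M. \<not> bounded_below (1 / real (Suc n)) (G x)})"
  have meas: "A n \<in> events" for n unfolding A_def by measurable
  have "decseq A"
  proof (rule decseq_SucI, rule subsetI)
    fix n x assume "x \<in> A (Suc n)"
    moreover have "1 / real (Suc (Suc n)) \<le> 1 / real (Suc n)" by (intro divide_left_mono) auto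
    ultimately show "x \<in> A n" using bounded_below_mono unfolding A_def by blast
  qed
  then have "(\<lambda>n. prob (A n)) \<longlonglongrightarrow> prob (\<Inter>n. A n)"
    using meas by (intro finite_Lim_measure_decseq) auto
  moreover have "prob (\<Inter>n. A n) = 0"
  proof -
    have "AE x in M. x \<notin> (\<Inter>n. A n)" using assms(2)
    proof eventually_elim
      case (elim x)
      obtain \<eta> where "\<eta> > 0" "bounded_below \<eta> (G x)" using bounded_below_if_det_nonzero[OF elim] by blast
      moreover obtain n where "inverse (real (Suc n)) < \<eta>" using reals_Archimedean[OF \<open>\<eta> > 0\<close>] by blast
      ultimately have "bounded_below (1 / real (Suc n)) (G x)"
        by (metis bounded_below_mono inverse_eq_divide less_imp_le)
      then show ?case by (auto simp: A_def)
    qed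
    then show ?thesis using meas by (simp add: prob_eq_0)
  qed
  ultimately have "eventually (\<lambda>n. prob (A n) < p) sequentially"
    using \<open>0 < p\<close> by (metis order_tendstoD(2))
  then obtain n where "prob (A n) < p" by (auto dest: eventually_happens)
  then show ?thesis unfolding A_def by (intro exI[of _ "1 / real (Suc n)"]) auto
qed

text \<open>Row \<open>i\<close> is the row with entry \<open>j\<close> cleared plus
  \<open>v\<close> times a unit row, and the determinant is linear in this row.\<close>

lemma det_affine_in_entry:
  fixes A :: "'a::comm_ring_1 ^ 'm ^ 'm"
  shows "\<exists>c d. \<forall>v. det (\<chi> a b. if a = i \<and> b = j then v else A $ a $ b) = c + d * v"
proof -
  have "det (\<chi> a b. if a = i \<and> b = j then v else A $ a $ b)
    = det (\<chi> a. if a = i then (\<chi> b. if b = j then 0 else A $ i $ b) else A $ a)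
      + v * det (\<chi> a. if a = i then (\<chi> b. if b = j then 1 else 0) else A $ a)" for v
  proof -
    have "(\<chi> a b. if a = i \<and> b = j then v else A $ a $ b)
      = (\<chi> a. if a = i then (\<chi> b. if b = j then 0 else A $ i $ b) + v *s (\<chi> b. if b = j then 1 else 0) else A $ a)"
      by (auto simp: vec_eq_iff)
    then show ?thesis by (simp add: det_row_add det_row_mul)
  qed
  then show ?thesis by (intro exI allI) (simp add: mult.commute)
qed

lemma det_measurable [measurable]: "det \<in> borel_measurable (borel :: (complex ^ 'm ^ 'm) measure)"
  unfolding det_def[abs_def] by (intro borel_measurable_continuous_onI continuous_intros)

text \<open>The determinant is affine in every entry, and at \<open>B\<close> plus the identity it
  equals 1; a law without atoms then does not charge its zero set.\<close>

lemma AE_det_minus_nonzero: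
  fixes B :: "complex ^ 'm ^ 'm"
  assumes \<mu>: "prob_space \<mu>" "sets \<mu> = sets borel" "\<And>x. measure \<mu> {x} = 0"
  shows "AE x in PiM UNIV (\<lambda>_. \<mu>). det ((\<chi> a b. x (a, b)) - B) \<noteq> 0"
proof (rule AE_PiM_separately_affine_nonzero[OF \<mu>, where ?x0.0 = "\<lambda>(a, b). B $ a $ b + (if a = b then 1 else 0)"])
  have [measurable_cong]: "sets \<mu> = sets borel" by fact
  have [measurable]: "(\<lambda>x. x (a, b)) \<in> borel_measurable (PiM UNIV (\<lambda>_. \<mu>))" for a b :: 'm
    by (rule measurable_compose[OF measurable_component_singleton]) (auto simp: measurable_cong_sets[OF \<mu>(2) refl])
  show "(\<lambda>x. det ((\<chi> a b. x (a, b)) - B)) \<in> borel_measurable (PiM UNIV (\<lambda>_. \<mu>))"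
    by measurable
  show "\<exists>c d. \<forall>v. det ((\<chi> a b. (x(i := v)) (a, b)) - B) = c + d * v" for x :: "'m \<times> 'm \<Rightarrow> complex" and i
  proof -
    obtain p q where i: "i = (p, q)" by (cases i)
    obtain c d where cd: "\<And>v. det (\<chi> a b. if a = p \<and> b = q then v else ((\<chi> a b. x (a, b)) - B) $ a $ b) = c + d * v"
      using det_affine_in_entry[of p q "(\<chi> a b. x (a, b)) - B"] by blast
    have "det ((\<chi> a b. (x(i := v)) (a, b)) - B) = c + d * (v - B $ p $ q)" for v
    proof -
      have "(\<chi> a b. (x(i := v)) (a, b)) - B
        = (\<chi> a b. if a = p \<and> b = q then v - B $ p $ q else ((\<chi> a b. x (a, b)) - B) $ a $ b)"
        by (auto simp: vec_eq_iff i)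
      then show ?thesis by (simp only: cd)
    qed
    then show ?thesis by (intro exI[of _ "c - d * B $ p $ q"] exI[of _ d]) (simp add: algebra_simps)
  qed
  have "(\<chi> a b. (case (a, b) of (a, b) \<Rightarrow> B $ a $ b + (if a = b then 1 else 0))) - B = mat 1"
    by (auto simp: vec_eq_iff mat_def)
  then show "det ((\<chi> a b. (case (a, b) of (a, b) \<Rightarrow> B $ a $ b + (if a = b then 1 else 0))) - B) \<noteq> 0"
    by (simp only: det_I) simp
qed auto

section \<open>Complex Gaussian noise\<close>

text \<open>A measure that gives every box its area is Lebesgue measure. This lets complex integrals
  be iterated over real and imaginary parts.\<close>

lemma lborel_complex_eq:
  "(lborel :: complex measure) = distr (lborel \<Otimes>\<^sub>M lborel) borel (\<lambda>(x, y). Complex x y)"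
proof (rule lborel_eqI)
  have [measurable]: "(\<lambda>(x, y). Complex x y) \<in> borel_measurable (lborel \<Otimes>\<^sub>M lborel)"
    unfolding Complex_eq by measurable
  fix l u :: complex
  assume le: "\<And>b. b \<in> Basis \<Longrightarrow> l \<bullet> b \<le> u \<bullet> b"
  have "Re l \<le> Re u" "Im l \<le> Im u" using le[of 1] le[of \<i>] by (auto simp: Basis_complex_def)
  moreover have "(\<lambda>(x, y). Complex x y) -` box l u \<inter> space (lborel \<Otimes>\<^sub>M lborel) = {Re l<..<Re u} \<times> {Im l<..<Im u}"
    by (auto simp: box_def Basis_complex_def space_pair_measure)
  ultimately show "emeasure (distr (lborel \<Otimes>\<^sub>M lborel) borel (\<lambda>(x, y). Complex x y)) (box l u)
      = (\<Prod>b\<in>Basis. (u - l) \<bullet> b)"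
    by (simp add: emeasure_distr lborel.emeasure_pair_measure_Times Basis_complex_def ennreal_mult)
qed simp

lemma nn_integral_lborel_complex:
  fixes f :: "complex \<Rightarrow> ennreal"
  assumes [measurable]: "f \<in> borel_measurable borel"
  shows "(\<integral>\<^sup>+ z. f z \<partial>lborel) = (\<integral>\<^sup>+ x. (\<integral>\<^sup>+ y. f (Complex x y) \<partial>lborel) \<partial>lborel)"
proof -
  have [measurable]: "(\<lambda>(x, y). Complex x y) \<in> borel_measurable (lborel \<Otimes>\<^sub>M lborel)"
    unfolding Complex_eq by measurable
  have "(\<integral>\<^sup>+ z. f z \<partial>lborel) = (\<integral>\<^sup>+ p. f (case p of (x, y) \<Rightarrow> Complex x y) \<partial>(lborel \<Otimes>\<^sub>M lborel))"
    by (subst lborel_complex_eq, subst nn_integral_distr) auto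
  also have "\<dots> = (\<integral>\<^sup>+ x. (\<integral>\<^sup>+ y. f (Complex x y) \<partial>lborel) \<partial>lborel)"
    by (subst lborel.nn_integral_fst[symmetric]) auto
  finally show ?thesis .
qed

abbreviation (input) half_normal :: "real \<Rightarrow> real" where
  "half_normal \<equiv> normal_density 0 (sqrt (1/2))"

lemma nn_integral_std_complex_normal:
  fixes f :: "complex \<Rightarrow> ennreal"
  assumes [measurable]: "f \<in> borel_measurable borel"
  shows "(\<integral>\<^sup>+ z. f z \<partial>std_complex_normal) =
    (\<integral>\<^sup>+ x. (\<integral>\<^sup>+ y. half_normal x * (half_normal y * f (Complex x y)) \<partial>lborel) \<partial>lborel)"
proof -
  let ?D = "density lborel (\<lambda>x. ennreal (half_normal x))"
  have [measurable]: "(\<lambda>(x, y). Complex x y) \<in> borel_measurable (lborel \<Otimes>\<^sub>M lborel)"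
    unfolding Complex_eq by measurable
  have m: "(\<lambda>(x, y). Complex x y) \<in> ?D \<Otimes>\<^sub>M ?D \<rightarrow>\<^sub>M borel"
    unfolding Complex_eq by measurable
  interpret D: prob_space ?D by (rule prob_space_normal_density) simp
  have "(\<integral>\<^sup>+ z. f z \<partial>std_complex_normal) = (\<integral>\<^sup>+ p. f (case p of (x, y) \<Rightarrow> Complex x y) \<partial>(?D \<Otimes>\<^sub>M ?D))"
    unfolding std_complex_normal_def by (subst nn_integral_distr[OF m]) auto
  also have "\<dots> = (\<integral>\<^sup>+ x. (\<integral>\<^sup>+ y. f (Complex x y) \<partial>?D) \<partial>?D)"
    using measurable_compose[OF m] by (subst D.nn_integral_fst[symmetric]) auto
  also have "\<dots> = (\<integral>\<^sup>+ x. half_normal x * (\<integral>\<^sup>+ y. half_normal y * f (Complex x y) \<partial>lborel) \<partial>lborel)"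
    by (subst nn_integral_density) (auto simp: nn_integral_density)
  also have "\<dots> = (\<integral>\<^sup>+ x. (\<integral>\<^sup>+ y. half_normal x * (half_normal y * f (Complex x y)) \<partial>lborel) \<partial>lborel)"
    by (simp add: nn_integral_cmult)
  finally show ?thesis .
qed

lemma prob_space_std_complex_normal: "prob_space std_complex_normal"
proof -
  let ?D = "density lborel (\<lambda>x. ennreal (half_normal x))"
  interpret D: prob_space ?D by (rule prob_space_normal_density) simp
  interpret DD: pair_prob_space ?D ?D ..
  show ?thesis unfolding std_complex_normal_def Complex_eq by (intro DD.prob_space_distr) measurable
qed

lemma sets_std_complex_normal [measurable_cong, simp]: "sets std_complex_normal = sets borel"
  by (simp add: std_complex_normal_def)

lemma space_std_complex_normal [simp]: "space std_complex_normal = UNIV"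
  by (simp add: std_complex_normal_def)

lemma half_normal_le: "half_normal x \<le> 1 / sqrt pi"
  unfolding normal_density_def by (simp add: divide_right_mono)

text \<open>The noise density is at most \<open>1 / pi\<close> and Lebesgue measure is translation
  invariant, so the bound does not depend on \<open>c\<close>. With \<open>c\<close> the noiseless
  output, this removes the codewords from the estimate.\<close>

lemma nn_integral_std_complex_normal_shift_le:
  fixes f :: "complex \<Rightarrow> ennreal"
  assumes [measurable]: "f \<in> borel_measurable borel"
  shows "(\<integral>\<^sup>+ z. f (c + z) \<partial>std_complex_normal) \<le> ennreal (1 / pi) * (\<integral>\<^sup>+ z. f z \<partial>lborel)"
proof -
  have "(\<integral>\<^sup>+ z. f (c + z) \<partial>std_complex_normal)
    = (\<integral>\<^sup>+ x. (\<integral>\<^sup>+ y. half_normal x * (half_normal y * f (c + Complex x y)) \<partial>lborel) \<partial>lborel)"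
    by (subst nn_integral_std_complex_normal) auto
  also have "\<dots> \<le> (\<integral>\<^sup>+ x. (\<integral>\<^sup>+ y. ennreal (1 / pi) * f (c + Complex x y) \<partial>lborel) \<partial>lborel)"
  proof (intro nn_integral_mono)
    fix x y
    have "half_normal x * half_normal y \<le> (1 / sqrt pi) * (1 / sqrt pi)"
      by (intro mult_mono half_normal_le) auto
    then have "ennreal (half_normal x) * ennreal (half_normal y) \<le> ennreal (1 / pi)"
      by (simp add: ennreal_mult[symmetric] ennreal_leI)
    then show "half_normal x * (half_normal y * f (c + Complex x y)) \<le> ennreal (1 / pi) * f (c + Complex x y)"
      by (subst mult.assoc[symmetric]) (rule mult_right_mono, auto)
  qed
  also have "\<dots> = (\<integral>\<^sup>+ z. ennreal (1 / pi) * f (c + z) \<partial>lborel)"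
    by (subst nn_integral_lborel_complex[of "\<lambda>z. ennreal (1 / pi) * f (c + z)"]) auto
  also have "\<dots> = ennreal (1 / pi) * (\<integral>\<^sup>+ z. f (c + z) \<partial>lborel)" by (simp add: nn_integral_cmult)
  also have "(\<integral>\<^sup>+ z. f (c + z) \<partial>lborel) = (\<integral>\<^sup>+ z. f z \<partial>lborel)"
    by (subst (2) lborel_distr_plus[of c, symmetric], subst nn_integral_distr) auto
  finally show ?thesis .
qed

lemma nn_integral_gauss:
  assumes "0 < v"
  shows "(\<integral>\<^sup>+ x. ennreal (exp (- (x\<^sup>2 / v))) \<partial>lborel) = ennreal (sqrt (pi * v))"
proof -
  \<comment> \<open>The integrand is an unnormalised normal density of variance
    \<open>v / 2\<close>.\<close>
  let ?n = "normal_density 0 (sqrt (v / 2))"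
  have "exp (- (x\<^sup>2 / v)) = sqrt (pi * v) * ?n x" for x
    using assms by (simp add: normal_density_def)
  then have "(\<integral>\<^sup>+ x. ennreal (exp (- (x\<^sup>2 / v))) \<partial>lborel) = (\<integral>\<^sup>+ x. ennreal (sqrt (pi * v)) * ennreal (?n x) \<partial>lborel)"
    using assms by (simp add: ennreal_mult)
  also have "\<dots> = ennreal (sqrt (pi * v)) * emeasure (density lborel ?n) UNIV"
    by (subst nn_integral_cmult) (auto simp: emeasure_density)
  also have "emeasure (density lborel ?n) UNIV = 1"
    using prob_space.emeasure_space_1[OF prob_space_normal_density[of "sqrt (v / 2)" 0]] assms by simp
  finally show ?thesis by simp
qed

lemma nn_integral_complex_gauss:
  assumes "0 < v"
  shows "(\<integral>\<^sup>+ z. ennreal (exp (- ((cmod (z - \<theta>))\<^sup>2 / v))) \<partial>lborel) = ennreal (pi * v)"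
proof -
  have "(\<integral>\<^sup>+ z. ennreal (exp (- ((cmod (z - \<theta>))\<^sup>2 / v))) \<partial>lborel)
    = (\<integral>\<^sup>+ z. ennreal (exp (- ((cmod z)\<^sup>2 / v))) \<partial>lborel)"
    by (subst lborel_distr_plus[of \<theta>, symmetric], subst nn_integral_distr) auto
  also have "\<dots> = (\<integral>\<^sup>+ x. (\<integral>\<^sup>+ y. ennreal (exp (- (x\<^sup>2 / v))) * ennreal (exp (- (y\<^sup>2 / v))) \<partial>lborel) \<partial>lborel)"
    by (subst nn_integral_lborel_complex)
       (auto simp: cmod_power2 add_divide_distrib exp_add[symmetric] ennreal_mult[symmetric])
  also have "\<dots> = ennreal (sqrt (pi * v)) * ennreal (sqrt (pi * v))"
    using assms by (simp add: nn_integral_cmult nn_integral_multc nn_integral_gauss)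
  also have "\<dots> = ennreal (pi * v)" using assms by (simp add: ennreal_mult[symmetric])
  finally show ?thesis .
qed

lemma nn_integral_half_normal_square:
  "(\<integral>\<^sup>+ x. ennreal (half_normal x) * ennreal (x\<^sup>2) \<partial>lborel) = ennreal (1 / 2)"
proof -
  have "has_bochner_integral lborel (\<lambda>x. half_normal x * (x - 0) ^ (2 * 1))
      (fact (2 * 1) / ((2 / (sqrt (1/2))\<^sup>2) ^ 1 * fact 1))"
    by (rule normal_moment_even) simp
  then have "has_bochner_integral lborel (\<lambda>x. half_normal x * x\<^sup>2) (1 / 2)"
    by (simp add: fact_numeral power2_eq_square)
  then have "(\<integral>\<^sup>+ x. ennreal (half_normal x * x\<^sup>2) \<partial>lborel) = ennreal (1 / 2)"
    using nn_integral_eq_integral[of lborel "\<lambda>x. half_normal x * x\<^sup>2"]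
    unfolding has_bochner_integral_iff by (metis (no_types, lifting) AE_I2 mult_nonneg_nonneg normal_density_nonneg zero_le_power2)
  then show ?thesis by (simp add: ennreal_mult)
qed

lemma nn_integral_std_complex_normal_norm_square:
  "(\<integral>\<^sup>+ z. ennreal ((cmod z)\<^sup>2) \<partial>std_complex_normal) = 1"
proof -
  have half1: "(\<integral>\<^sup>+ x. ennreal (half_normal x) \<partial>lborel) = 1"
    using prob_space.emeasure_space_1[OF prob_space_normal_density[of "sqrt (1/2)" 0]]
    by (simp add: emeasure_density)
  have "(\<integral>\<^sup>+ z. ennreal ((cmod z)\<^sup>2) \<partial>std_complex_normal)
    = (\<integral>\<^sup>+ x. (\<integral>\<^sup>+ y. (ennreal (half_normal x) * ennreal (x\<^sup>2)) * ennreal (half_normal y)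
        + ennreal (half_normal x) * (ennreal (half_normal y) * ennreal (y\<^sup>2)) \<partial>lborel) \<partial>lborel)"
    by (subst nn_integral_std_complex_normal)
       (auto simp: cmod_power2 ennreal_plus distrib_left mult_ac intro!: nn_integral_cong simp del: ennreal_plus[symmetric])
  also have "\<dots> = (\<integral>\<^sup>+ x. ennreal (half_normal x) * ennreal (x\<^sup>2) + ennreal (half_normal x) * ennreal (1 / 2) \<partial>lborel)"
    by (intro nn_integral_cong) (simp add: nn_integral_add nn_integral_cmult half1 nn_integral_half_normal_square)
  also have "\<dots> = ennreal (1 / 2) + ennreal (1 / 2)"
    by (simp add: nn_integral_add nn_integral_multc half1 nn_integral_half_normal_square)
  also have "\<dots> = 1" using ennreal_plus[of "1/2" "1/2"] by (metis field_sum_of_halves ennreal_1 half_nonnegative_int_iff divide_nonneg_nonneg zero_le_one zero_le_numeral)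
  finally show ?thesis .
qed

text \<open>The scalar bound is applied to one coordinate at a time: integrating it out against
  Lebesgue measure leaves the function \<open>g\<close> of the other coordinates, to which the
  induction hypothesis applies.\<close>

lemma nn_integral_PiM_std_complex_normal_shift_le:
  fixes f :: "('r \<Rightarrow> complex) \<Rightarrow> ennreal"
  assumes "finite J" "f \<in> borel_measurable (PiM J (\<lambda>_. borel))"
  shows "(\<integral>\<^sup>+ z. f (\<lambda>r\<in>J. c r + z r) \<partial>PiM J (\<lambda>_. std_complex_normal))
    \<le> ennreal (1 / pi) ^ card J * (\<integral>\<^sup>+ y. f y \<partial>PiM J (\<lambda>_. lborel))"
  using assms
proof (induction J arbitrary: f)
  case empty
  then show ?case by (simp add: space_PiM nn_integral_count_space_finite PiM_empty restrict_def)
next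
  case (insert i I)
  interpret S: product_prob_space "\<lambda>_. std_complex_normal"
    by (intro product_prob_spaceI prob_space_std_complex_normal)
  interpret L: product_sigma_finite "\<lambda>_. lborel :: complex measure" by standard
  note [measurable] = insert.prems
  have upd[measurable]: "(\<lambda>x. f ((fst x)(i := snd x))) \<in> borel_measurable (PiM I (\<lambda>_. borel) \<Otimes>\<^sub>M borel)"
    by (rule measurable_compose[OF _ insert.prems])
       (rule measurable_fun_upd[where J=I], auto)
  define g where "g = (\<lambda>x. \<integral>\<^sup>+ y. f (x(i := y)) \<partial>lborel)"
  have g[measurable]: "g \<in> borel_measurable (PiM I (\<lambda>_. borel))"
    unfolding g_def using upd
    by (intro lborel.borel_measurable_nn_integral) (simp add: split_beta' measurable_cong_sets[OF sets_pair_measure_cong[OF refl sets_lborel] refl])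
  have fm: "(\<lambda>z. f (\<lambda>r\<in>insert i I. c r + z r)) \<in> borel_measurable (PiM (insert i I) (\<lambda>_. std_complex_normal))"
    by (rule measurable_compose[OF _ insert.prems]) measurable
  have "(\<integral>\<^sup>+ z. f (\<lambda>r\<in>insert i I. c r + z r) \<partial>PiM (insert i I) (\<lambda>_. std_complex_normal))
    = (\<integral>\<^sup>+ x. (\<integral>\<^sup>+ y. f (\<lambda>r\<in>insert i I. c r + (x(i := y)) r) \<partial>std_complex_normal) \<partial>PiM I (\<lambda>_. std_complex_normal))"
    by (rule S.product_nn_integral_insert[OF insert.hyps fm])
  also have "\<dots> = (\<integral>\<^sup>+ x. (\<integral>\<^sup>+ y. f ((\<lambda>r\<in>I. c r + x r)(i := c i + y)) \<partial>std_complex_normal) \<partial>PiM I (\<lambda>_. std_complex_normal))"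
    using insert.hyps by (intro nn_integral_cong arg_cong[where f=f]) (auto simp: fun_eq_iff)
  also have "\<dots> \<le> (\<integral>\<^sup>+ x. ennreal (1 / pi) * g (\<lambda>r\<in>I. c r + x r) \<partial>PiM I (\<lambda>_. std_complex_normal))"
    unfolding g_def
  proof (intro nn_integral_mono nn_integral_std_complex_normal_shift_le)
    fix x
    have "(\<lambda>r\<in>I. c r + x r) \<in> space (PiM I (\<lambda>_. borel))" by (simp add: space_PiM)
    from measurable_compose[OF measurable_Pair1'[OF this] upd]
    show "(\<lambda>y. f ((\<lambda>r\<in>I. c r + x r)(i := y))) \<in> borel_measurable borel" by simp
  qed
  also have "\<dots> = ennreal (1 / pi) * (\<integral>\<^sup>+ x. g (\<lambda>r\<in>I. c r + x r) \<partial>PiM I (\<lambda>_. std_complex_normal))"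
    by (intro nn_integral_cmult measurable_compose[OF _ g]) measurable
  also have "\<dots> \<le> ennreal (1 / pi) * (ennreal (1 / pi) ^ card I * (\<integral>\<^sup>+ y. g y \<partial>PiM I (\<lambda>_. lborel)))"
    by (intro mult_left_mono insert.IH g) auto
  also have "(\<integral>\<^sup>+ y. g y \<partial>PiM I (\<lambda>_. lborel)) = (\<integral>\<^sup>+ y. f y \<partial>PiM (insert i I) (\<lambda>_. lborel))"
    unfolding g_def using insert.hyps by (subst L.product_nn_integral_insert) auto
  finally show ?case using insert.hyps by (simp add: mult.assoc)
qed

lemma nn_integral_PiM_gauss:
  fixes v :: "'r \<Rightarrow> real"
  assumes "finite J" "\<And>r. r \<in> J \<Longrightarrow> 0 < v r"
  shows "(\<integral>\<^sup>+ y. ennreal (exp (- (\<Sum>r\<in>J. (cmod (y r - \<theta> r))\<^sup>2 / v r))) \<partial>PiM J (\<lambda>_. lborel)) = ennreal (\<Prod>r\<in>J. pi * v r)"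
proof -
  interpret L: product_sigma_finite "\<lambda>_. lborel :: complex measure" by standard
  have "(\<integral>\<^sup>+ y. ennreal (exp (- (\<Sum>r\<in>J. (cmod (y r - \<theta> r))\<^sup>2 / v r))) \<partial>PiM J (\<lambda>_. lborel))
    = (\<integral>\<^sup>+ y. (\<Prod>r\<in>J. ennreal (exp (- ((cmod (y r - \<theta> r))\<^sup>2 / v r)))) \<partial>PiM J (\<lambda>_. lborel))"
    using assms by (simp add: sum_negf[symmetric] exp_sum prod_ennreal)
  also have "\<dots> = (\<Prod>r\<in>J. ennreal (pi * v r))"
    using assms by (subst L.product_nn_integral_prod) (auto intro!: prod.cong simp: nn_integral_complex_gauss)
  also have "\<dots> = ennreal (\<Prod>r\<in>J. pi * v r)" using assms by (intro prod_ennreal) (auto intro: less_imp_le)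
  finally show ?thesis .
qed

section \<open>Packing two decoders\<close>

text \<open>The noises of two distinct receivers are disjoint blocks of coordinates, so their joint
  law is a product. The condition \<open>0 < n\<close> makes the blocks nonempty, as
  \<open>prob_PiM_blocks\<close> requires.\<close>

lemma distr_noise_space_two_nodes:
  fixes i j :: "'k::finite"
  assumes "i \<noteq> j" "0 < n"
  defines "J \<equiv> {..<n} \<times> (UNIV :: 'm::finite set)"
  defines "Q \<equiv> PiM J (\<lambda>_. std_complex_normal)"
  shows "distr (noise_space n) (Q \<Otimes>\<^sub>M Q) (\<lambda>z. (\<lambda>r\<in>J. z (fst r, i, snd r), \<lambda>r\<in>J. z (fst r, j, snd r))) = Q \<Otimes>\<^sub>M Q"
proof (rule pair_measure_eqI[symmetric])
  interpret Q: prob_space Q unfolding Q_def by (intro prob_space_PiM prob_space_std_complex_normal)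
  show "sigma_finite_measure Q" "sigma_finite_measure Q" by unfold_locales
  interpret N: prob_space "noise_space n :: ('k, 'm) noises measure"
    unfolding noise_space_def by (intro prob_space_PiM prob_space_std_complex_normal)
  let ?N = "noise_space n :: ('k, 'm) noises measure"
  let ?p = "\<lambda>z. (\<lambda>r\<in>J. z (fst r, i, snd r), \<lambda>r\<in>J. z (fst r, j, snd r))"
  have m: "?p \<in> ?N \<rightarrow>\<^sub>M Q \<Otimes>\<^sub>M Q"
    unfolding Q_def noise_space_def J_def
    by (intro measurable_Pair measurable_restrict measurable_component_singleton) auto
  fix A B assume A: "A \<in> sets Q" and B: "B \<in> sets Q"
  let ?f = "\<lambda>s r. (fst r, s, snd r)"
  have "N.prob {z \<in> space ?N. \<forall>s\<in>{i, j}. (\<lambda>r\<in>J. z (?f s r)) \<in> (if s = i then A else B)}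
    = (\<Prod>s\<in>{i, j}. measure Q (if s = i then A else B))"
    unfolding noise_space_def Q_def
    by (intro prob_PiM_blocks prob_space_std_complex_normal)
       (use assms A B in \<open>auto simp: J_def Q_def inj_on_def disjoint_family_on_def\<close>)
  moreover have "{z \<in> space ?N. \<forall>s\<in>{i, j}. (\<lambda>r\<in>J. z (?f s r)) \<in> (if s = i then A else B)}
      = ?p -` (A \<times> B) \<inter> space ?N"
    using assms(1) by auto
  ultimately have "N.prob (?p -` (A \<times> B) \<inter> space ?N) = measure Q A * measure Q B"
    using assms(1) by simp
  then show "emeasure Q A * emeasure Q B = emeasure (distr ?N (Q \<Otimes>\<^sub>M Q) ?p) (A \<times> B)"
    using A B m by (subst emeasure_distr)
      (auto simp: N.emeasure_eq_measure Q.emeasure_eq_measure ennreal_mult[symmetric])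
qed simp

lemma borel_measurable_exp_neg_sum:
  fixes f :: "'r \<Rightarrow> 'a \<Rightarrow> real"
  assumes "\<And>r. r \<in> J \<Longrightarrow> f r \<in> borel_measurable M"
  shows "(\<lambda>x. ennreal (exp (- (\<Sum>r\<in>J. f r x)))) \<in> borel_measurable M"
  by (intro measurable_compose[OF _ measurable_ennreal] measurable_compose[OF _ borel_measurable_exp]
        borel_measurable_uminus borel_measurable_sum assms)

text \<open>Decision regions for distinct messages are disjoint, so at most one summand is
  nonzero.\<close>

lemma sum_indicator_decision_le:
  fixes g :: ennreal
  shows "(\<Sum>b<L. indicator {b} (D::nat) * g) \<le> g"
proof -
  have "(\<Sum>b<L. indicator {b} D * g) = (if D < L then g else 0)"
    by (subst sum.cong[OF refl, where h="\<lambda>b. if b = D then g else 0"]) (auto simp: indicator_def)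
  then show ?thesis by simp
qed

text \<open>On the typical event both sums are linear in the block length, so up to an exponential factor this weight
  dominates the indicator of correct decoding by both receivers.\<close>

definition packing_weight :: "'r set \<Rightarrow> real \<Rightarrow> ('r \<Rightarrow> real) \<Rightarrow>
    (('r \<Rightarrow> complex) \<Rightarrow> nat) \<Rightarrow> (('r \<Rightarrow> complex) \<Rightarrow> nat) \<Rightarrow> (nat \<Rightarrow> ('r \<Rightarrow> complex) \<Rightarrow> 'r \<Rightarrow> complex) \<Rightarrow>
    nat \<Rightarrow> nat \<Rightarrow> ('r \<Rightarrow> complex) \<times> ('r \<Rightarrow> complex) \<Rightarrow> ennreal" where
  "packing_weight J P v D1 D2 \<theta> a b = (\<lambda>(y1, y2). indicator {a} (D1 y1) * (indicator {b} (D2 y2) *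
    (ennreal (exp (- (\<Sum>r\<in>J. (cmod (y1 r))\<^sup>2 / P))) * ennreal (exp (- (\<Sum>r\<in>J. (cmod (y2 r - \<theta> a y1 r))\<^sup>2 / v r))))))"

lemma borel_measurable_packing_weight:
  fixes D1 D2 :: "('r \<Rightarrow> complex) \<Rightarrow> nat" and \<theta> :: "nat \<Rightarrow> ('r \<Rightarrow> complex) \<Rightarrow> 'r \<Rightarrow> complex"
  assumes D [measurable]: "D1 \<in> PiM J (\<lambda>_. borel) \<rightarrow>\<^sub>M count_space UNIV"
      "D2 \<in> PiM J (\<lambda>_. borel) \<rightarrow>\<^sub>M count_space UNIV"
    and \<theta> [measurable]: "\<And>a r. r \<in> J \<Longrightarrow> (\<lambda>y. \<theta> a y r) \<in> borel_measurable (PiM J (\<lambda>_. borel))"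
  shows "packing_weight J P v D1 D2 \<theta> a b \<in> borel_measurable (PiM J (\<lambda>_. borel) \<Otimes>\<^sub>M PiM J (\<lambda>_. borel))"
proof -
  have comp: "(\<lambda>y. y r) \<in> borel_measurable (PiM J (\<lambda>_. borel))" if "r \<in> J" for r
    using that by (rule measurable_component_singleton)
  show ?thesis
    unfolding packing_weight_def split_beta'
    by (intro borel_measurable_times_ennreal borel_measurable_exp_neg_sum
          measurable_compose[OF measurable_compose[OF measurable_fst D(1)], where g="indicator {a}"]
          measurable_compose[OF measurable_compose[OF measurable_snd D(2)], where g="indicator {b}"])
       (auto intro!: borel_measurable_divide borel_measurable_power borel_measurable_norm borel_measurable_diff
          measurable_compose[OF measurable_fst comp] measurable_compose[OF measurable_snd comp]
          measurable_compose[OF measurable_fst \<theta>])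
qed

lemma borel_measurable_packing_weight_shift:
  fixes D1 D2 :: "('r \<Rightarrow> complex) \<Rightarrow> nat" and \<theta> :: "nat \<Rightarrow> ('r \<Rightarrow> complex) \<Rightarrow> 'r \<Rightarrow> complex"
  assumes "D1 \<in> PiM J (\<lambda>_. borel) \<rightarrow>\<^sub>M count_space UNIV"
      "D2 \<in> PiM J (\<lambda>_. borel) \<rightarrow>\<^sub>M count_space UNIV"
    and "\<And>a r. r \<in> J \<Longrightarrow> (\<lambda>y. \<theta> a y r) \<in> borel_measurable (PiM J (\<lambda>_. borel))"
  shows "(\<lambda>z. packing_weight J P v D1 D2 \<theta> a b (\<lambda>r\<in>J. c r + fst z r, \<lambda>r\<in>J. d r + snd z r))
    \<in> borel_measurable (PiM J (\<lambda>_. std_complex_normal) \<Otimes>\<^sub>M PiM J (\<lambda>_. std_complex_normal))"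
proof -
  let ?B = "PiM J (\<lambda>_. borel) :: ('r \<Rightarrow> complex) measure"
  let ?Q = "PiM J (\<lambda>_. std_complex_normal)"
  have sQ: "sets ?Q = sets ?B" by (intro sets_PiM_cong) auto
  have sh: "(\<lambda>z. \<lambda>r\<in>J. e r + z r) \<in> ?B \<rightarrow>\<^sub>M ?B" for e by measurable
  have "(\<lambda>z. (\<lambda>r\<in>J. c r + fst z r, \<lambda>r\<in>J. d r + snd z r)) \<in> ?B \<Otimes>\<^sub>M ?B \<rightarrow>\<^sub>M ?B \<Otimes>\<^sub>M ?B"
    by (intro measurable_Pair measurable_compose[OF measurable_fst sh] measurable_compose[OF measurable_snd sh])
  from measurable_compose[OF this borel_measurable_packing_weight[OF assms]]
  show ?thesis by (simp add: measurable_cong_sets[OF sets_pair_measure_cong[OF sQ sQ] refl])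
qed

text \<open>For fixed \<open>y1\<close> only one \<open>a\<close> contributes, hence only one centre \<open>\<theta> a y1\<close>, and then the
  regions of \<open>y2\<close> for distinct \<open>b\<close> are disjoint.\<close>

lemma two_receiver_packing:
  fixes D1 D2 :: "('r \<Rightarrow> complex) \<Rightarrow> nat" and \<theta> :: "nat \<Rightarrow> ('r \<Rightarrow> complex) \<Rightarrow> 'r \<Rightarrow> complex"
  assumes "finite J" and D [measurable]: "D1 \<in> PiM J (\<lambda>_. borel) \<rightarrow>\<^sub>M count_space UNIV"
      "D2 \<in> PiM J (\<lambda>_. borel) \<rightarrow>\<^sub>M count_space UNIV"
    and \<theta> [measurable]: "\<And>a r. r \<in> J \<Longrightarrow> (\<lambda>y. \<theta> a y r) \<in> borel_measurable (PiM J (\<lambda>_. borel))"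
    and P: "0 < P" and v: "\<And>r. r \<in> J \<Longrightarrow> 0 < v r"
  defines "Q \<equiv> PiM J (\<lambda>_. std_complex_normal)"
  defines "\<phi> \<equiv> packing_weight J P v D1 D2 \<theta>"
  shows "(\<Sum>a<L1. \<Sum>b<L2. \<integral>\<^sup>+ z. \<phi> a b (\<lambda>r\<in>J. c a b r + fst z r, \<lambda>r\<in>J. d a b r + snd z r) \<partial>(Q \<Otimes>\<^sub>M Q))
    \<le> ennreal (P ^ card J * (\<Prod>r\<in>J. v r))"
proof -
  let ?B = "PiM J (\<lambda>_. borel) :: ('r \<Rightarrow> complex) measure"
  let ?L = "PiM J (\<lambda>_. lborel) :: ('r \<Rightarrow> complex) measure"
  interpret Q: prob_space Q unfolding Q_def by (intro prob_space_PiM prob_space_std_complex_normal)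
  interpret L: product_sigma_finite "\<lambda>_. lborel :: complex measure" by standard
  interpret LJ: sigma_finite_measure ?L using \<open>finite J\<close> by (rule L.sigma_finite)
  have sQ [measurable_cong]: "sets Q = sets ?B" unfolding Q_def by (intro sets_PiM_cong) auto
  have sL [measurable_cong]: "sets ?L = sets ?B" by (intro sets_PiM_cong) auto
  have comp [measurable]: "(\<lambda>y. y r) \<in> borel_measurable ?B" if "r \<in> J" for r
    using that by (rule measurable_component_singleton)
  have \<phi> [measurable]: "\<phi> a b \<in> borel_measurable (?B \<Otimes>\<^sub>M ?B)" for a b
    unfolding \<phi>_def by (rule borel_measurable_packing_weight[OF D \<theta>])
  let ?k = "ennreal (1 / pi) ^ card J"
  \<comment> \<open>Each of the two noises is traded for Lebesgue measure at the price of its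
    density bound. Afterwards the shifts \<open>c\<close> and \<open>d\<close>, which depend on
    \<open>a\<close> and \<open>b\<close>, are gone and the sums can be moved inside the
    integrals.\<close>
  have one: "(\<integral>\<^sup>+ z. \<phi> a b (\<lambda>r\<in>J. c a b r + fst z r, \<lambda>r\<in>J. d a b r + snd z r) \<partial>(Q \<Otimes>\<^sub>M Q))
    \<le> ?k * (?k * (\<integral>\<^sup>+ y1. \<integral>\<^sup>+ y2. \<phi> a b (y1, y2) \<partial>?L \<partial>?L))" (is "?lhs \<le> _") for a b
  proof -
    have sh: "(\<lambda>z. \<lambda>r\<in>J. e r + z r) \<in> ?B \<rightarrow>\<^sub>M ?B" for e by measurable
    have m1: "(\<lambda>y1. \<integral>\<^sup>+ y2. \<phi> a b (y1, y2) \<partial>?L) \<in> borel_measurable ?B"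
      using \<phi> by (intro LJ.borel_measurable_nn_integral) (simp add: split_beta' measurable_cong_sets[OF sets_pair_measure_cong[OF refl sL] refl])
    have "?lhs = (\<integral>\<^sup>+ z1. \<integral>\<^sup>+ z2. \<phi> a b (\<lambda>r\<in>J. c a b r + z1 r, \<lambda>r\<in>J. d a b r + z2 r) \<partial>Q \<partial>Q)"
      using borel_measurable_packing_weight_shift[OF D \<theta>] unfolding \<phi>_def Q_def[symmetric]
      by (subst Q.nn_integral_fst[symmetric]) simp_all
    also have "\<dots> \<le> (\<integral>\<^sup>+ z1. ?k * (\<integral>\<^sup>+ y2. \<phi> a b (\<lambda>r\<in>J. c a b r + z1 r, y2) \<partial>?L) \<partial>Q)"
    proof (rule nn_integral_mono)
      fix z1
      have "(\<lambda>r\<in>J. c a b r + z1 r) \<in> space ?B" by (simp add: space_PiM)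
      from measurable_compose[OF measurable_Pair1'[OF this] \<phi>]
      show "(\<integral>\<^sup>+ z2. \<phi> a b (\<lambda>r\<in>J. c a b r + z1 r, \<lambda>r\<in>J. d a b r + z2 r) \<partial>Q)
        \<le> ?k * (\<integral>\<^sup>+ y2. \<phi> a b (\<lambda>r\<in>J. c a b r + z1 r, y2) \<partial>?L)"
        unfolding Q_def by (rule nn_integral_PiM_std_complex_normal_shift_le[OF \<open>finite J\<close>])
    qed
    also have "\<dots> = ?k * (\<integral>\<^sup>+ z1. (\<integral>\<^sup>+ y2. \<phi> a b (\<lambda>r\<in>J. c a b r + z1 r, y2) \<partial>?L) \<partial>Q)"
      using measurable_compose[OF sh m1] by (intro nn_integral_cmult) (simp add: measurable_cong_sets[OF sQ refl])
    also have "\<dots> \<le> ?k * (?k * (\<integral>\<^sup>+ y1. \<integral>\<^sup>+ y2. \<phi> a b (y1, y2) \<partial>?L \<partial>?L))"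
      unfolding Q_def by (intro mult_left_mono nn_integral_PiM_std_complex_normal_shift_le[OF \<open>finite J\<close> m1]) auto
    finally show ?thesis .
  qed
  have m2: "(\<lambda>y2. \<phi> a b (y1, y2)) \<in> borel_measurable ?L" if "y1 \<in> space ?L" for a b y1
    using measurable_compose[OF measurable_Pair1'[of y1 ?B ?B] \<phi>] that sets_eq_imp_space_eq[OF sL]
    by (simp add: measurable_cong_sets[OF sL refl])
  have m1: "(\<lambda>y1. \<integral>\<^sup>+ y2. \<phi> a b (y1, y2) \<partial>?L) \<in> borel_measurable ?L" for a b
    using \<phi> by (intro LJ.borel_measurable_nn_integral)
      (simp add: split_beta' measurable_cong_sets[OF sets_pair_measure_cong[OF sL sL] refl])
  let ?g = "\<lambda>y1. ennreal (exp (- (\<Sum>r\<in>J. (cmod (y1 r))\<^sup>2 / P)))"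
  let ?V = "ennreal (\<Prod>r\<in>J. pi * v r)"
  have "(\<Sum>a<L1. \<Sum>b<L2. \<integral>\<^sup>+ z. \<phi> a b (\<lambda>r\<in>J. c a b r + fst z r, \<lambda>r\<in>J. d a b r + snd z r) \<partial>(Q \<Otimes>\<^sub>M Q))
    \<le> (\<Sum>a<L1. \<Sum>b<L2. ?k * (?k * (\<integral>\<^sup>+ y1. \<integral>\<^sup>+ y2. \<phi> a b (y1, y2) \<partial>?L \<partial>?L)))"
    by (intro sum_mono one)
  also have "\<dots> = ?k * (?k * (\<integral>\<^sup>+ y1. (\<Sum>a<L1. \<Sum>b<L2. \<integral>\<^sup>+ y2. \<phi> a b (y1, y2) \<partial>?L) \<partial>?L))"
    by (simp add: sum_distrib_left nn_integral_sum m1 borel_measurable_sum)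
  \<comment> \<open>The Gaussian volume \<open>?V\<close> does not depend on the centre
    \<open>\<theta> a y1\<close>, so the sum over \<open>a\<close> can be carried out after the
    integration over \<open>y2\<close>.\<close>
  also have "\<dots> \<le> ?k * (?k * (\<integral>\<^sup>+ y1. ?g y1 * ?V \<partial>?L))"
  proof (intro mult_left_mono nn_integral_mono)
    fix y1 assume y1: "y1 \<in> space ?L"
    have y1': "y1 \<in> space ?B" using y1 sets_eq_imp_space_eq[OF sL] by simp
    let ?h = "\<lambda>a y2. ennreal (exp (- (\<Sum>r\<in>J. (cmod (y2 r - \<theta> a y1 r))\<^sup>2 / v r)))"
    have "(\<Sum>a<L1. \<Sum>b<L2. \<integral>\<^sup>+ y2. \<phi> a b (y1, y2) \<partial>?L) \<le> (\<Sum>a<L1. indicator {a} (D1 y1) * (?g y1 * ?V))"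
    proof (intro sum_mono)
      fix a
      have hm: "?h a \<in> borel_measurable ?L"
        by (rule borel_measurable_exp_neg_sum) measurable
      have "(\<Sum>b<L2. \<integral>\<^sup>+ y2. \<phi> a b (y1, y2) \<partial>?L) = (\<integral>\<^sup>+ y2. (\<Sum>b<L2. \<phi> a b (y1, y2)) \<partial>?L)"
        using m2[OF y1] by (subst nn_integral_sum) auto
      also have "\<dots> \<le> (\<integral>\<^sup>+ y2. (indicator {a} (D1 y1) * ?g y1) * ?h a y2 \<partial>?L)"
      proof (rule nn_integral_mono)
        fix y2
        have "(\<Sum>b<L2. \<phi> a b (y1, y2)) = (\<Sum>b<L2. indicator {b} (D2 y2) * (indicator {a} (D1 y1) * ?g y1 * ?h a y2))"
          by (simp add: \<phi>_def packing_weight_def mult_ac)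
        also have "\<dots> \<le> indicator {a} (D1 y1) * ?g y1 * ?h a y2" by (rule sum_indicator_decision_le)
        finally show "(\<Sum>b<L2. \<phi> a b (y1, y2)) \<le> indicator {a} (D1 y1) * ?g y1 * ?h a y2" .
      qed
      also have "\<dots> = (indicator {a} (D1 y1) * ?g y1) * ?V"
        using hm by (subst nn_integral_cmult) (auto simp: nn_integral_PiM_gauss[OF \<open>finite J\<close> v])
      finally show "(\<Sum>b<L2. \<integral>\<^sup>+ y2. \<phi> a b (y1, y2) \<partial>?L) \<le> indicator {a} (D1 y1) * (?g y1 * ?V)"
        by (simp add: mult.assoc)
    qed
    also have "\<dots> \<le> ?g y1 * ?V" by (rule sum_indicator_decision_le)
    finally show "(\<Sum>a<L1. \<Sum>b<L2. \<integral>\<^sup>+ y2. \<phi> a b (y1, y2) \<partial>?L) \<le> ?g y1 * ?V" .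
  qed auto
  also have "(\<integral>\<^sup>+ y1. ?g y1 * ?V \<partial>?L) = ennreal (\<Prod>r\<in>J. pi * P) * ?V"
  proof (subst nn_integral_multc)
    show "?g \<in> borel_measurable ?L"
      by (rule borel_measurable_exp_neg_sum) measurable
    show "(\<integral>\<^sup>+ y1. ?g y1 \<partial>?L) * ?V = ennreal (\<Prod>r\<in>J. pi * P) * ?V"
      using nn_integral_PiM_gauss[OF \<open>finite J\<close>, of "\<lambda>_. P" "\<lambda>_. 0"] P by simp
  qed
  \<comment> \<open>Each of the \<open>2 * card J\<close> coordinates brings \<open>1 / pi\<close>
    from the density bound and \<open>pi\<close> from its Gaussian integral, and these
    cancel.\<close>
  also have "?k * (?k * (ennreal (\<Prod>r\<in>J. pi * P) * ?V)) = ennreal ((1 / pi) ^ card J * ((1 / pi) ^ card J * ((\<Prod>r\<in>J. pi * P) * (\<Prod>r\<in>J. pi * v r))))"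
  proof -
    have k: "?k = ennreal ((1 / pi) ^ card J)" by (simp add: ennreal_power)
    have nn: "0 \<le> (\<Prod>r\<in>J. pi * P)" "0 \<le> (\<Prod>r\<in>J. pi * v r)" "0 \<le> (1 / pi) ^ card J"
      using P v by (auto intro!: prod_nonneg mult_nonneg_nonneg simp: less_imp_le)
    show ?thesis unfolding k by (simp only: ennreal_mult[symmetric] nn mult_nonneg_nonneg)
  qed
  also have "(1 / pi) ^ card J * ((1 / pi) ^ card J * ((\<Prod>r\<in>J. pi * P) * (\<Prod>r\<in>J. pi * v r))) = P ^ card J * (\<Prod>r\<in>J. v r)"
    by (simp add: prod.distrib power_mult_distrib field_simps)
  finally show ?thesis .
qed

section \<open>Norm estimates for received and predicted vectors\<close>

lemma sum_norm_square_le: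
  fixes f :: "'k::finite \<Rightarrow> 'a::real_normed_vector"
  shows "(norm (sum f UNIV))\<^sup>2 \<le> real CARD('k) * (\<Sum>k\<in>UNIV. (norm (f k))\<^sup>2)"
proof -
  have "(norm (sum f UNIV))\<^sup>2 \<le> (\<Sum>k\<in>UNIV. 1 * norm (f k))\<^sup>2"
    by (intro power_mono) (auto intro: norm_sum)
  also have "\<dots> \<le> (\<Sum>k\<in>(UNIV::'k set). 1\<^sup>2) * (\<Sum>k\<in>UNIV. (norm (f k))\<^sup>2)"
    by (rule Cauchy_Schwarz_ineq_sum)
  finally show ?thesis by simp
qed

lemma norm_add_square_le:
  fixes x y :: "'a::real_normed_vector"
  shows "(norm (x + y))\<^sup>2 \<le> 2 * (norm x)\<^sup>2 + 2 * (norm y)\<^sup>2"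
proof -
  have "(norm (x + y))\<^sup>2 \<le> (norm x + norm y)\<^sup>2" by (intro power_mono norm_triangle_ineq) auto
  also have "\<dots> \<le> 2 * (norm x)\<^sup>2 + 2 * (norm y)\<^sup>2"
    using sum_squares_bound[of "norm x" "norm y"] by (simp add: power2_sum)
  finally show ?thesis .
qed

lemma norm_received_square_le:
  fixes A :: "'k::finite \<Rightarrow> complex ^ 'm ^ 'm" and u :: "'k \<Rightarrow> complex ^ 'm"
  assumes "\<And>k a b. norm (A k $ a $ b) \<le> c"
  defines "g \<equiv> real CARD('m) * real CARD('m) * c"
  shows "(norm ((\<Sum>k\<in>UNIV. A k *v u k) + z))\<^sup>2
    \<le> 2 * (real CARD('k) * g\<^sup>2 * (\<Sum>k\<in>UNIV. (norm (u k))\<^sup>2)) + 2 * (norm z)\<^sup>2"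
proof -
  have "(norm (\<Sum>k\<in>UNIV. A k *v u k))\<^sup>2 \<le> real CARD('k) * (\<Sum>k\<in>UNIV. (norm (A k *v u k))\<^sup>2)"
    by (rule sum_norm_square_le)
  also have "\<dots> \<le> real CARD('k) * (\<Sum>k\<in>UNIV. (g * norm (u k))\<^sup>2)"
    unfolding g_def by (intro mult_left_mono sum_mono power_mono norm_matrix_vector_mult_le assms) auto
  also have "\<dots> = real CARD('k) * g\<^sup>2 * (\<Sum>k\<in>UNIV. (norm (u k))\<^sup>2)"
    by (simp add: power_mult_distrib sum_distrib_left mult_ac)
  finally show ?thesis using norm_add_square_le[of "\<Sum>k\<in>UNIV. A k *v u k" z] by linarith
qed

text \<open>Boundedness from below by a positive number forces a trivial kernel, and for square
  matrices the resulting left inverse is two-sided. So \<open>matrix_inv\<close> is the genuine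
  inverse, and the lower bound on \<open>G\<close> becomes an upper bound on it.\<close>

lemma bounded_below_imp_right_inverse:
  fixes G :: "complex ^ 'm ^ 'm"
  assumes "bounded_below \<eta> G" "0 < \<eta>"
  shows "G ** matrix_inv G = mat 1" "matrix_inv G ** G = mat 1" "norm (matrix_inv G *v v) \<le> norm v / \<eta>"
proof -
  have "\<forall>x. G *v x = 0 \<longrightarrow> x = 0"
  proof (intro allI impI)
    fix x assume "G *v x = 0"
    then have "\<eta> * norm x \<le> 0" using assms(1) unfolding bounded_below_def by (metis norm_zero)
    then show "x = 0" using assms(2) by (simp add: mult_le_0_iff)
  qed
  then have "\<exists>B. B ** G = mat 1" by (simp add: matrix_left_invertible_ker)
  then have "invertible G" using matrix_left_right_inverse unfolding invertible_def by metis
  then show i: "G ** matrix_inv G = mat 1" and "matrix_inv G ** G = mat 1"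
    unfolding invertible_def matrix_inv_def by (metis (mono_tags, lifting) someI_ex)+
  have "\<eta> * norm (matrix_inv G *v v) \<le> norm (G *v (matrix_inv G *v v))"
    using assms(1) unfolding bounded_below_def by blast
  also have "\<dots> = norm v" using i by (simp add: matrix_vector_mul_assoc)
  finally show "norm (matrix_inv G *v v) \<le> norm v / \<eta>" using assms(2) by (simp add: field_simps)
qed

text \<open>Once receiver \<open>i\<close> knows all messages but \<open>j\<close>, it reproduces the observation of receiver \<open>j\<close> up to
  a bounded amplification of the noise.\<close>

lemma norm_reconstruction_error_square_le:
  fixes A A' :: "'k::finite \<Rightarrow> complex ^ 'm ^ 'm" and u :: "'k \<Rightarrow> complex ^ 'm"
  assumes "\<And>k a b. norm (A' k $ a $ b) \<le> c" "bounded_below \<eta> (A j)" "0 < \<eta>"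
  defines "g \<equiv> real CARD('m) * real CARD('m) * c"
  shows "(norm ((\<Sum>k\<in>UNIV. A' k *v u k) + z' -
      ((A' j ** matrix_inv (A j)) *v ((\<Sum>k\<in>UNIV. A k *v u k) + z - (\<Sum>k\<in>UNIV-{j}. A k *v u k))
        + (\<Sum>k\<in>UNIV-{j}. A' k *v u k))))\<^sup>2
    \<le> 2 * (norm z')\<^sup>2 + 2 * ((g / \<eta>)\<^sup>2 * (norm z)\<^sup>2)"
    (is "(norm ?e)\<^sup>2 \<le> _")
proof -
  let ?B = "A' j ** matrix_inv (A j)"
  have s: "(\<Sum>k\<in>UNIV. C k *v u k) = C j *v u j + (\<Sum>k\<in>UNIV-{j}. C k *v u k)" for C :: "'k \<Rightarrow> complex ^ 'm ^ 'm"
    by (rule sum.remove) auto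
  have B: "?B *v (A j *v x) = A' j *v x" for x
    using bounded_below_imp_right_inverse(2)[OF assms(2,3)]
    by (simp add: matrix_vector_mul_assoc matrix_mul_assoc[symmetric])
  \<comment> \<open>The unknown contribution of transmitter \<open>j\<close> cancels exactly, and
    what remains is the noise of the second receiver minus that of the first seen through
    \<open>?B\<close>.\<close>
  have e: "?e = z' + - (?B *v z)"
    unfolding s[of A] s[of A'] by (simp add: B matrix_vector_right_distrib algebra_simps)
  have "norm (?B *v z) \<le> (g / \<eta>) * norm z"
  proof -
    have "norm (?B *v z) = norm (A' j *v (matrix_inv (A j) *v z))" by (simp add: matrix_vector_mul_assoc)
    also have "\<dots> \<le> g * norm (matrix_inv (A j) *v z)" unfolding g_def by (rule norm_matrix_vector_mult_le[OF assms(1)])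
    also have "\<dots> \<le> g * (norm z / \<eta>)"
    proof (rule mult_left_mono)
      have "0 \<le> c" using order_trans[OF norm_ge_zero assms(1)] .
      then show "0 \<le> g" by (simp add: g_def)
    qed (rule bounded_below_imp_right_inverse(3)[OF assms(2,3)])
    finally show ?thesis by simp
  qed
  then have "(norm (?B *v z))\<^sup>2 \<le> ((g / \<eta>) * norm z)\<^sup>2" by (intro power_mono) auto
  then show ?thesis unfolding e using norm_add_square_le[of z' "- (?B *v z)"] by (simp add: power_mult_distrib power_divide)
qed

section \<open>The joint space\<close>

text \<open>Markov's inequality with the mean bounded as an \<open>ennreal\<close> integral, the
  form in which the power constraint is given.\<close>

lemma (in prob_space) prob_gt_le_if_nn_integral_le:
  assumes [measurable]: "X \<in> borel_measurable M" and "(\<integral>\<^sup>+ x. ennreal (X x) \<partial>M) \<le> ennreal B" and t: "0 < t" "0 \<le> B"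
  shows "prob {x \<in> space M. t < X x} \<le> B / t"
proof -
  have "emeasure M {x \<in> space M. t < X x} = (\<integral>\<^sup>+ x. indicator {x \<in> space M. t < X x} x \<partial>M)"
    by (subst nn_integral_indicator) auto
  also have "\<dots> \<le> (\<integral>\<^sup>+ x. ennreal (1 / t) * ennreal (X x) \<partial>M)"
  proof (rule nn_integral_mono)
    fix x
    show "indicator {x \<in> space M. t < X x} x \<le> ennreal (1 / t) * ennreal (X x)"
      using t by (auto simp: indicator_def ennreal_mult[symmetric] simp flip: ennreal_1 intro!: ennreal_leI)
  qed
  also have "\<dots> \<le> ennreal (1 / t) * ennreal B"
    using assms by (subst nn_integral_cmult) (auto intro!: mult_left_mono)
  also have "\<dots> = ennreal (B / t)" using t by (simp add: ennreal_mult[symmetric])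
  finally show ?thesis using t by (simp add: emeasure_eq_measure ennreal_le_iff)
qed

lemma nn_integral_pair_fst:
  assumes "prob_space M" "prob_space N" and [measurable]: "f \<in> borel_measurable M"
  shows "(\<integral>\<^sup>+ x. f (fst x) \<partial>(M \<Otimes>\<^sub>M N)) = (\<integral>\<^sup>+ x. f x \<partial>M)"
proof -
  interpret N: prob_space N by fact
  show ?thesis by (subst N.nn_integral_fst[symmetric]) (auto simp: N.emeasure_space_1)
qed

lemma nn_integral_pair_snd:
  assumes "prob_space M" "prob_space N" and [measurable]: "f \<in> borel_measurable N"
  shows "(\<integral>\<^sup>+ x. f (snd x) \<partial>(M \<Otimes>\<^sub>M N)) = (\<integral>\<^sup>+ x. f x \<partial>N)"
proof -
  interpret M: prob_space M by fact
  interpret N: prob_space N by fact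
  show ?thesis by (subst N.nn_integral_fst[symmetric]) (auto simp: M.emeasure_space_1)
qed

lemma prob_space_noise_space: "prob_space (noise_space n)"
  unfolding noise_space_def by (intro prob_space_PiM prob_space_std_complex_normal)

lemma prob_space_message_space:
  assumes "\<And>k. 0 < L k"
  shows "prob_space (message_space L)"
  unfolding message_space_def using assms by (intro prob_space_PiM prob_space_uniform_count_measure) (auto simp: lessThan_empty_iff)

lemma measurable_noise [measurable]:
  assumes "t < n"
  shows "(\<lambda>z. z (t, j, a)) \<in> borel_measurable (noise_space n)"
  unfolding noise_space_def
  using assms by (subst measurable_cong_sets[OF refl sets_std_complex_normal[symmetric]])
    (intro measurable_component_singleton, auto)

lemma measurable_noise_vector [measurable]:
  assumes "t < n"
  shows "(\<lambda>z. noise_vector z j t) \<in> borel_measurable (noise_space n)"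
  unfolding noise_vector_def using assms by measurable

lemma measurable_message [measurable]:
  "(\<lambda>w. w k) \<in> message_space L \<rightarrow>\<^sub>M count_space {..<L k}"
proof -
  have "(\<lambda>w. w k) \<in> message_space L \<rightarrow>\<^sub>M uniform_count_measure {..<L k}"
    unfolding message_space_def by (intro measurable_component_singleton) auto
  then show ?thesis by (simp add: measurable_cong_sets[OF refl sets_uniform_count_measure_count_space])
qed

lemma nn_integral_noise_norm_square:
  assumes "t < n"
  shows "(\<integral>\<^sup>+ z. ennreal ((norm (noise_vector z (j::'k) t :: complex ^ 'm::finite))\<^sup>2) \<partial>(noise_space n :: ('k, 'm) noises measure)) = of_nat CARD('m)"
proof -
  have "(norm (noise_vector z j t))\<^sup>2 = (\<Sum>a\<in>UNIV. (cmod (z (t, j, a)))\<^sup>2)" for z :: "('k, 'm) noises"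
    by (simp add: norm_vec_def L2_set_def noise_vector_def real_sqrt_pow2 sum_nonneg)
  then have "(\<integral>\<^sup>+ z. ennreal ((norm (noise_vector z j t :: complex ^ 'm))\<^sup>2) \<partial>(noise_space n :: ('k, 'm) noises measure))
    = (\<Sum>a\<in>UNIV. \<integral>\<^sup>+ z. ennreal ((cmod (z (t, j, a)))\<^sup>2) \<partial>(noise_space n :: ('k, 'm) noises measure))"
    using assms by (subst nn_integral_sum[symmetric]) (auto simp: sum_ennreal)
  also have "\<dots> = (\<Sum>a\<in>(UNIV::'m set). 1)"
  proof (rule sum.cong)
    fix a :: 'm
    have "(\<integral>\<^sup>+ z. ennreal ((cmod (z (t, j, a)))\<^sup>2) \<partial>(noise_space n :: ('k, 'm) noises measure))
      = (\<integral>\<^sup>+ x. ennreal ((cmod x)\<^sup>2) \<partial>distr (noise_space n :: ('k, 'm) noises measure) std_complex_normal (\<lambda>z. z (t, j, a)))"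
      using measurable_noise[OF assms]
      by (subst nn_integral_distr) (auto simp: measurable_cong_sets[OF refl sets_std_complex_normal]
           measurable_cong_sets[OF sets_std_complex_normal refl])
    also have "distr (noise_space n :: ('k, 'm) noises measure) std_complex_normal (\<lambda>z. z (t, j, a)) = std_complex_normal"
      unfolding noise_space_def using assms by (intro distr_PiM_component prob_space_std_complex_normal) auto
    finally show "(\<integral>\<^sup>+ z. ennreal ((cmod (z (t, j, a)))\<^sup>2) \<partial>(noise_space n :: ('k, 'm) noises measure)) = 1"
      by (simp add: nn_integral_std_complex_normal_norm_square)
  qed simp
  finally show ?thesis by simp
qed

locale fading_channel = prob_space \<mu> for \<mu> :: "complex measure" +
  fixes gmax :: real
  assumes sets_gain_law [measurable_cong, simp]: "sets \<mu> = sets borel"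
    and nonatomic: "measure \<mu> {x} = 0"
    and gain_bounded: "AE x in \<mu>. cmod x \<le> gmax"
begin

lemma space_gain_law [simp]: "space \<mu> = UNIV"
  using sets_eq_imp_space_eq[OF sets_gain_law] by simp

lemma prob_space_channel_space: "prob_space (channel_space \<mu> n)"
  unfolding channel_space_def by (intro prob_space_PiM prob_space_axioms)

lemma measurable_gain [measurable]:
  assumes "t < n"
  shows "(\<lambda>h. h (t, i)) \<in> borel_measurable (channel_space \<mu> n)"
  unfolding channel_space_def
  using assms by (subst measurable_cong_sets[OF refl sets_gain_law[symmetric]])
    (intro measurable_component_singleton, auto)

lemma measurable_channel_matrix [measurable]:
  assumes "t < n"
  shows "(\<lambda>h. channel_matrix h j k t) \<in> borel_measurable (channel_space \<mu> n)"
  unfolding channel_matrix_def using assms by measurable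

lemma AE_gains_bounded:
  fixes n :: nat
  shows "AE h in (channel_space \<mu> n :: ('k::finite, 'm::finite) gains measure).
    \<forall>t<n. \<forall>i. cmod (h (t, i)) \<le> gmax"
proof -
  have "AE h in (channel_space \<mu> n :: ('k, 'm) gains measure). \<forall>p\<in>{..<n} \<times> UNIV. cmod (h p) \<le> gmax"
    unfolding channel_space_def
    by (intro AE_finite_allI finite_cartesian_product finite_lessThan finite
          AE_PiM_component[where P="\<lambda>x. cmod x \<le> gmax"] prob_space_axioms gain_bounded)
  then show ?thesis by eventually_elim auto
qed

lemma prob_space_joint_space:
  assumes "\<And>k. 0 < L k"
  shows "prob_space (joint_space \<mu> n L)"
proof -
  interpret C: prob_space "channel_space \<mu> n" by (rule prob_space_channel_space)
  interpret W: prob_space "message_space L" by (rule prob_space_message_space[OF assms])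
  interpret N: prob_space "noise_space n" by (rule prob_space_noise_space)
  interpret WN: pair_prob_space "message_space L" "noise_space n" ..
  interpret CWN: pair_prob_space "channel_space \<mu> n" "message_space L \<Otimes>\<^sub>M noise_space n" ..
  show ?thesis unfolding joint_space_def by (rule CWN.prob_space_axioms)
qed

lemma distr_channel_block:
  assumes "inj_on f J" "f \<in> J \<rightarrow> {..<n} \<times> UNIV"
  shows "distr (channel_space \<mu> n) (PiM J (\<lambda>_. \<mu>)) (\<lambda>h. \<lambda>r\<in>J. h (f r)) = PiM J (\<lambda>_. \<mu>)"
  unfolding channel_space_def
  using distr_PiM_reindex[of "{..<n} \<times> UNIV" "\<lambda>_. \<mu>" f J] assms prob_space_axioms by simp

text \<open>Every channel matrix has the same law, that of a square array of independent gains, so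
  one threshold \<open>\<eta>\<close> serves all times and all links.\<close>

lemma prob_channel_matrix:
  fixes i j :: "'k::finite"
  assumes "t < n" and A: "A \<in> sets borel"
  shows "measure (channel_space \<mu> n) {h \<in> space (channel_space \<mu> n). (channel_matrix h i j t :: complex ^ 'm ^ 'm) \<in> A}
    = measure (PiM UNIV (\<lambda>_. \<mu>)) {x \<in> space (PiM UNIV (\<lambda>_. \<mu>)). (\<chi> a b. x (a, b)) \<in> A}"
proof -
  let ?C = "channel_space \<mu> n :: ('k, 'm) gains measure"
  let ?U = "PiM (UNIV :: ('m \<times> 'm) set) (\<lambda>_. \<mu>)"
  let ?f = "\<lambda>(a, b). (t, i, j, a, b)"
  have [measurable]: "(\<lambda>x. x r) \<in> borel_measurable ?U" for r
    by (subst measurable_cong_sets[OF refl sets_gain_law[symmetric]]) (intro measurable_component_singleton, auto)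
  have S: "{x \<in> space ?U. (\<chi> a b. x (a, b)) \<in> A} \<in> sets ?U"
    using A by measurable
  have f: "inj_on ?f UNIV" "?f \<in> UNIV \<rightarrow> {..<n} \<times> UNIV" using assms(1) by (auto simp: inj_on_def)
  have m: "(\<lambda>h. \<lambda>r\<in>UNIV. h (?f r)) \<in> ?C \<rightarrow>\<^sub>M ?U"
    unfolding channel_space_def using f by (intro measurable_restrict measurable_component_singleton) auto
  have "measure ?U {x \<in> space ?U. (\<chi> a b. x (a, b)) \<in> A}
    = measure (distr ?C ?U (\<lambda>h. \<lambda>r\<in>UNIV. h (?f r))) {x \<in> space ?U. (\<chi> a b. x (a, b)) \<in> A}"
    by (simp only: distr_channel_block[OF f])
  also have "\<dots> = measure ?C {h \<in> space ?C. channel_matrix h i j t \<in> A}"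
    by (subst measure_distr[OF m S]) (auto intro!: arg_cong[where f="measure ?C"] simp: channel_matrix_def space_PiM)
  finally show ?thesis ..
qed

end

section \<open>Measurability of codewords, received blocks and error events\<close>

context fading_channel begin

context
  fixes P :: real and n :: nat and L :: "'k::finite \<Rightarrow> nat"
    and enc :: "('k, 'm::finite) encoders" and dec :: "('k, 'm) decoders"
  assumes code: "block_code \<mu> P n L enc dec"
begin

lemma code_size_pos: "0 < L k"
  using code by (simp add: block_code_def)

text \<open>A message has finitely many values, so it suffices that the encoder is measurable in the
  gains for each fixed message.\<close>

lemma measurable_codeword [measurable]:
  assumes "t < n"
  shows "(\<lambda>(h, w, z). enc k (w k) h t) \<in> borel_measurable (joint_space \<mu> n L)"
proof -
  have "(\<lambda>x. (\<lambda>w h. enc k w h t) (fst (snd x) k) (fst x)) \<in> borel_measurable (joint_space \<mu> n L)"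
    unfolding joint_space_def
  proof (rule measurable_compose_countable'[where I="{..<L k}" and g="\<lambda>x. fst (snd x) k"])
    fix w assume "w \<in> {..<L k}"
    then have "(\<lambda>h. enc k w h t) \<in> borel_measurable (channel_space \<mu> n)"
      using code assms by (auto simp: block_code_def)
    from measurable_compose[OF measurable_fst this]
    show "(\<lambda>x. enc k w (fst x) t) \<in> borel_measurable (channel_space \<mu> n \<Otimes>\<^sub>M (message_space L \<Otimes>\<^sub>M noise_space n))" .
  qed (auto intro: measurable_compose[OF measurable_compose[OF measurable_snd measurable_fst] measurable_message])
  then show ?thesis by (simp add: split_beta')
qed

lemma measurable_received [measurable]:
  "(\<lambda>(h, w, z). received n enc j h w z) \<in> joint_space \<mu> n L \<rightarrow>\<^sub>M PiM {..<n} (\<lambda>_. borel)"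
  unfolding received_def split_beta'
proof (rule measurable_restrict)
  fix t assume "t \<in> {..<n}"
  then have t: "t < n" by simp
  have [measurable]: "(\<lambda>x. enc k (fst (snd x) k) (fst x) t) \<in> borel_measurable (joint_space \<mu> n L)" for k
    using measurable_codeword[OF t] by (simp add: split_beta')
  have [measurable]: "(\<lambda>x. channel_matrix (fst x) j k t) \<in> borel_measurable (joint_space \<mu> n L)" for k
    unfolding joint_space_def by (rule measurable_compose[OF measurable_fst measurable_channel_matrix[OF t]])
  have [measurable]: "(\<lambda>x. noise_vector (snd (snd x)) j t) \<in> borel_measurable (joint_space \<mu> n L)"
    unfolding joint_space_def
    by (rule measurable_compose[OF measurable_compose[OF measurable_snd measurable_snd] measurable_noise_vector[OF t]])
  show "(\<lambda>x. (\<Sum>k\<in>UNIV. channel_matrix (fst x) j k t *v enc k (fst (snd x) k) (fst x) t) + noise_vector (snd (snd x)) j t)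
    \<in> borel_measurable (joint_space \<mu> n L)" by measurable
qed

lemma measurable_decision [measurable]:
  "(\<lambda>(h, w, z). dec j h (received n enc j h w z)) \<in> joint_space \<mu> n L \<rightarrow>\<^sub>M count_space UNIV"
proof -
  have d: "(\<lambda>(h, y). dec j h y) \<in> channel_space \<mu> n \<Otimes>\<^sub>M PiM {..<n} (\<lambda>_. borel) \<rightarrow>\<^sub>M count_space UNIV"
    using code by (simp add: block_code_def)
  have "(\<lambda>x. (fst x, received n enc j (fst x) (fst (snd x)) (snd (snd x))))
    \<in> joint_space \<mu> n L \<rightarrow>\<^sub>M channel_space \<mu> n \<Otimes>\<^sub>M PiM {..<n} (\<lambda>_. borel)"
    using measurable_received by (intro measurable_Pair) (auto simp: joint_space_def split_beta')
  from measurable_compose[OF this d] show ?thesis by (simp add: split_beta')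
qed

lemma measurable_joint_message:
  "(\<lambda>(h, w, z). w k) \<in> joint_space \<mu> n L \<rightarrow>\<^sub>M count_space UNIV"
proof -
  have "(\<lambda>x. fst (snd x) k) \<in> joint_space \<mu> n L \<rightarrow>\<^sub>M count_space {..<L k}"
    unfolding joint_space_def
    by (rule measurable_compose[OF measurable_compose[OF measurable_snd measurable_fst] measurable_message])
  then have "(\<lambda>x. fst (snd x) k) \<in> joint_space \<mu> n L \<rightarrow>\<^sub>M count_space UNIV"
    by (rule measurable_compose) simp
  then show ?thesis by (simp add: split_beta')
qed

lemma error_event [measurable]:
  "{(h, w, z) \<in> space (joint_space \<mu> n L). dec j h (received n enc j h w z) \<noteq> w j} \<in> sets (joint_space \<mu> n L)"
proof -
  have "{x \<in> space (joint_space \<mu> n L). (case x of (h, w, z) \<Rightarrow> dec j h (received n enc j h w z)) = (case x of (h, w, z) \<Rightarrow> w j)}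
    \<in> sets (joint_space \<mu> n L)"
    by (intro measurable_equality_set measurable_compose[OF measurable_decision borel_measurable_count_space]
          measurable_compose[OF measurable_joint_message borel_measurable_count_space])
  then have "space (joint_space \<mu> n L) - {x \<in> space (joint_space \<mu> n L). (case x of (h, w, z) \<Rightarrow> dec j h (received n enc j h w z)) = (case x of (h, w, z) \<Rightarrow> w j)}
    \<in> sets (joint_space \<mu> n L)" by (rule sets.compl_sets)
  then show ?thesis by (rule back_subst[of "\<lambda>A. A \<in> sets (joint_space \<mu> n L)"]) auto
qed

end

end

section \<open>Converse\<close>

lemma nn_integral_uniform_count:
  fixes f :: "nat \<Rightarrow> ennreal"
  assumes "0 < L"
  shows "(\<integral>\<^sup>+ a. f a \<partial>uniform_count_measure {..<L}) = ennreal (1 / real L) * (\<Sum>a<L. f a)"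
  using assms by (simp add: uniform_count_measure_def nn_integral_point_measure_finite sum_distrib_left)

text \<open>With all other messages fixed, the uniform law turns a bound on a sum over message pairs
  into the same bound divided by the number of pairs. Here the code sizes enter the
  converse.\<close>

lemma nn_integral_message_space_le:
  fixes f :: "('k::finite \<Rightarrow> nat) \<Rightarrow> ennreal"
  assumes L: "\<And>k. 0 < L k" and "i \<noteq> j" and f: "f \<in> borel_measurable (message_space L)"
    and le: "\<And>x. (\<Sum>a<L i. \<Sum>b<L j. f (x(j := b, i := a))) \<le> B"
  shows "(\<integral>\<^sup>+ w. f w \<partial>message_space L) \<le> ennreal (1 / (real (L i) * real (L j))) * B"
proof -
  let ?U = "\<lambda>k. uniform_count_measure {..<L k}"
  interpret U: product_prob_space ?U
    using L by (intro product_prob_spaceI prob_space_uniform_count_measure) (auto simp: lessThan_empty_iff)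
  define R where "R = UNIV - {i, j}"
  have U: "UNIV = insert i (insert j R)" by (auto simp: R_def)
  have R: "finite R" "j \<notin> R" "i \<notin> insert j R" using assms(2) by (auto simp: R_def)
  interpret PR: prob_space "PiM R ?U" by (rule prob_space_PiM) (rule U.M.prob_space_axioms)
  have f': "f \<in> borel_measurable (PiM (insert i (insert j R)) ?U)"
    using f by (simp add: message_space_def U)
  have upd: "(\<lambda>x. f (x(i := a))) \<in> borel_measurable (PiM (insert j R) ?U)" if "a < L i" for a
    by (rule measurable_compose[OF _ f']) (rule measurable_fun_upd[where J="insert j R"], use that in \<open>auto simp: space_uniform_count_measure\<close>)
  have "(\<integral>\<^sup>+ w. f w \<partial>message_space L) = (\<integral>\<^sup>+ x. (\<integral>\<^sup>+ a. f (x(i := a)) \<partial>?U i) \<partial>PiM (insert j R) ?U)"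
    unfolding message_space_def U using R f' by (intro U.product_nn_integral_insert) auto
  also have "\<dots> = (\<integral>\<^sup>+ x. ennreal (1 / real (L i)) * (\<Sum>a<L i. f (x(i := a))) \<partial>PiM (insert j R) ?U)"
    by (simp add: nn_integral_uniform_count[OF L])
  also have "\<dots> = (\<integral>\<^sup>+ x. (\<integral>\<^sup>+ b. ennreal (1 / real (L i)) * (\<Sum>a<L i. f (x(j := b, i := a))) \<partial>?U j) \<partial>PiM R ?U)"
    using R upd by (intro U.product_nn_integral_insert) auto
  also have "\<dots> = (\<integral>\<^sup>+ x. ennreal (1 / real (L j)) * (ennreal (1 / real (L i)) * (\<Sum>a<L i. \<Sum>b<L j. f (x(j := b, i := a)))) \<partial>PiM R ?U)"
    by (simp add: nn_integral_uniform_count[OF L] sum_distrib_left sum.swap[of _ "{..<L i}"])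
  also have "\<dots> \<le> (\<integral>\<^sup>+ x. ennreal (1 / real (L j)) * (ennreal (1 / real (L i)) * B) \<partial>PiM R ?U)"
    by (intro nn_integral_mono mult_left_mono le) auto
  also have "\<dots> = ennreal (1 / (real (L i) * real (L j))) * B"
  proof -
    have "ennreal (1 / real (L j)) * ennreal (1 / real (L i)) = ennreal (1 / (real (L i) * real (L j)))"
      by (subst ennreal_mult[symmetric]) (simp_all add: mult.commute)
    then show ?thesis by (simp add: PR.emeasure_space_1 mult.assoc[symmetric])
  qed
  finally show ?thesis .
qed

lemma sum_block_norm_square:
  fixes V :: "nat \<Rightarrow> complex ^ 'm"
  shows "(\<Sum>r\<in>{..<n} \<times> UNIV. (cmod (V (fst r) $ snd r))\<^sup>2 / v (fst r)) = (\<Sum>t<n. (norm (V t))\<^sup>2 / v t)"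
proof -
  have "(\<Sum>r\<in>{..<n} \<times> UNIV. (cmod (V (fst r) $ snd r))\<^sup>2 / v (fst r)) = (\<Sum>t<n. \<Sum>a\<in>UNIV. (cmod (V t $ a))\<^sup>2 / v t)"
    by (simp add: sum.cartesian_product split_beta')
  also have "\<dots> = (\<Sum>t<n. (norm (V t))\<^sup>2 / v t)"
    by (simp add: norm_vec_def L2_set_def real_sqrt_pow2 sum_nonneg sum_divide_distrib)
  finally show ?thesis .
qed

definition total_power :: "nat \<Rightarrow> ('k::finite, 'm::finite) encoders \<Rightarrow> ('k, 'm) gains \<Rightarrow> ('k \<Rightarrow> nat) \<Rightarrow> real" where
  "total_power n enc h w = (\<Sum>t<n. \<Sum>k\<in>UNIV. (norm (enc k (w k) h t))\<^sup>2)"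

definition pair_noise :: "nat \<Rightarrow> 'k \<Rightarrow> 'k \<Rightarrow> ('k, 'm::finite) noises \<Rightarrow> real" where
  "pair_noise n i j z = (\<Sum>t<n. (norm (noise_vector z i t))\<^sup>2 + (norm (noise_vector z j t))\<^sup>2)"

definition weak_times :: "nat \<Rightarrow> real \<Rightarrow> 'k \<Rightarrow> 'k \<Rightarrow> ('k, 'm::finite) gains \<Rightarrow> nat set" where
  "weak_times n \<eta> i j h = {t. t < n \<and> \<not> bounded_below \<eta> (channel_matrix h i j t)}"

text \<open>The constants come from Markov's inequality at 8 times the mean: the means are at most
  \<open>n K P\<close> for the power, \<open>2 n M\<close> for the noise and \<open>\<tau> n\<close>
  for the weak times, where \<open>K\<close> and \<open>M\<close> are the numbers of users and
  antennas.\<close>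

definition typical :: "real \<Rightarrow> nat \<Rightarrow> ('k::finite, 'm::finite) encoders \<Rightarrow> ('k, 'm) decoders \<Rightarrow> real \<Rightarrow> real \<Rightarrow>
    'k \<Rightarrow> 'k \<Rightarrow> ('k, 'm) gains \<Rightarrow> ('k \<Rightarrow> nat) \<Rightarrow> ('k, 'm) noises \<Rightarrow> bool" where
  "typical P n enc dec \<eta> \<tau> i j h w z \<longleftrightarrow>
    dec i h (received n enc i h w z) = w i \<and> dec j h (received n enc j h w z) = w j \<and>
    total_power n enc h w \<le> 8 * real CARD('k) * real n * P \<and> pair_noise n i j z \<le> 16 * real n * real CARD('m) \<and>
    real (card (weak_times n \<eta> i j h)) \<le> 8 * \<tau> * real n"

text \<open>\<open>g\<close> bounds the norm of a channel matrix whose entries have size at most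
  \<open>c\<close>. The summands account, per channel use, for the signal part of the outputs
  relative to \<open>P\<close>, for the noise relative to \<open>P\<close>, and for the error of the
  prediction.\<close>

definition packing_exponent :: "real \<Rightarrow> real \<Rightarrow> real \<Rightarrow> real \<Rightarrow> real" where
  "packing_exponent K M c \<eta> = (let g = M * M * c in 32 * K\<^sup>2 * g\<^sup>2 + 32 * M + 32 * (1 + (g / \<eta>)\<^sup>2) * M)"

context fading_channel begin

lemma ex_gain_threshold:
  assumes "0 < p"
  shows "\<exists>\<eta>>0. measure (PiM UNIV (\<lambda>_. \<mu>)) {x \<in> space (PiM UNIV (\<lambda>_. \<mu>)).
    (\<chi> a b. x (a, b)) \<in> {G :: complex ^ 'm ^ 'm. \<not> bounded_below \<eta> G}} \<le> p"
proof -
  let ?U = "PiM (UNIV :: ('m \<times> 'm) set) (\<lambda>_. \<mu>)"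
  interpret U: prob_space ?U by (rule prob_space_PiM) (rule prob_space_axioms)
  have [measurable]: "(\<lambda>x. x r) \<in> borel_measurable ?U" for r
    by (subst measurable_cong_sets[OF refl sets_gain_law[symmetric]]) (intro measurable_component_singleton, auto)
  have "AE x in ?U. det ((\<chi> a b. x (a, b)) - (0 :: complex ^ 'm ^ 'm)) \<noteq> 0"
    by (rule AE_det_minus_nonzero[OF prob_space_axioms sets_gain_law nonatomic])
  then have d: "AE x in ?U. det ((\<chi> a b. x (a, b)) :: complex ^ 'm ^ 'm) \<noteq> 0" by simp
  have m: "(\<lambda>x. (\<chi> a b. x (a, b)) :: complex ^ 'm ^ 'm) \<in> borel_measurable ?U" by measurable
  show ?thesis unfolding mem_Collect_eq by (rule U.prob_not_bounded_below_le[OF m d assms])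
qed

context
  fixes P :: real and n :: nat and L :: "'k::finite \<Rightarrow> nat"
    and enc :: "('k, 'm::finite) encoders" and dec :: "('k, 'm) decoders"
  assumes code: "block_code \<mu> P n L enc dec"
begin

text \<open>For fixed gains and fixed messages of the other users, the typical event is dominated
  pointwise by an exponential factor times the packing weight. The weights sum to at most the volume
  available to \<open>y\<^sub>i\<close> times the volume around the prediction of
  \<open>y\<^sub>j\<close>.\<close>

lemma sum_typical_le:
  fixes i j :: 'k
  assumes ij: "i \<noteq> j" and n: "0 < n" and P: "1 \<le> P" and \<eta>: "0 < \<eta>" and h: "h \<in> space (channel_space \<mu> n)"
    and bd: "\<And>t i. t < n \<Longrightarrow> cmod (h (t, i)) \<le> gmax"
  shows "(\<Sum>a<L i. \<Sum>b<L j. \<integral>\<^sup>+ z. indicator {z. typical P n enc dec \<eta> \<tau> i j h (x(j := b, i := a)) z} z \<partial>noise_space n)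
    \<le> ennreal (exp (packing_exponent (real CARD('k)) (real CARD('m)) gmax \<eta> * real n) * P powr (real n * real CARD('m) * (1 + 8 * \<tau>)))"
proof (cases "real (card (weak_times n \<eta> i j h)) \<le> 8 * \<tau> * real n")
  \<comment> \<open>With too many weak times no outcome is typical, and the left side
    vanishes.\<close>
  case False
  then show ?thesis by (simp add: typical_def)
next
  case True
  define J where "J = {..<n} \<times> (UNIV :: 'm set)"
  have finJ: "finite J" by (simp add: J_def)
  define Q where "Q = PiM J (\<lambda>_. std_complex_normal)"
  let ?B = "PiM J (\<lambda>_. borel) :: (nat \<times> 'm \<Rightarrow> complex) measure"
  define H where "H = (\<lambda>j k t. channel_matrix h j k t :: complex ^ 'm ^ 'm)"
  define good where "good = (\<lambda>t. bounded_below \<eta> (H i j t))"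
  define vec where "vec = (\<lambda>y :: nat \<times> 'm \<Rightarrow> complex. \<lambda>t\<in>{..<n}. (\<chi> a. y (t, a)) :: complex ^ 'm)"
  define D1 where "D1 = (\<lambda>y. dec i h (vec y))"
  define D2 where "D2 = (\<lambda>y. dec j h (vec y))"
  \<comment> \<open>Transmitter \<open>j\<close> is left out, so this depends on \<open>a\<close>
    and on the fixed messages but not on \<open>b\<close>. The centre of the prediction must be
    computable without \<open>b\<close>.\<close>
  define rest where "rest = (\<lambda>l a t. \<Sum>k\<in>UNIV-{j}. H l k t *v enc k ((x(i := a)) k) h t)"
  define pred where "pred = (\<lambda>a y t. if good t then
      (H j j t ** matrix_inv (H i j t)) *v (y - rest i a t) + rest j a t else 0)"
  define \<theta> where "\<theta> = (\<lambda>a y r. pred a (\<chi> \<alpha>. y (fst r, \<alpha>)) (fst r) $ snd r)"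
  \<comment> \<open>At a weak time nothing is predicted, and the variance has the scale of the whole
    output.\<close>
  define vt where "vt = (\<lambda>t. if good t then 1 else P)"
  define v where "v = (\<lambda>r :: nat \<times> 'm. vt (fst r))"
  define w where "w = (\<lambda>a b. x(j := b, i := a))"
  define sig where "sig = (\<lambda>l a b t. \<Sum>k\<in>UNIV. H l k t *v enc k (w a b k) h t)"
  define \<phi> where "\<phi> = packing_weight J P v D1 D2 \<theta>"
  let ?shift = "\<lambda>a b z. (\<lambda>r\<in>J. sig i a b (fst r) $ snd r + fst z r, \<lambda>r\<in>J. sig j a b (fst r) $ snd r + snd z r)"
  let ?p = "\<lambda>z. (\<lambda>r\<in>J. z (fst r, i, snd r), \<lambda>r\<in>J. z (fst r, j, snd r))"
  have vt: "0 < vt t" for t using P by (simp add: vt_def)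
  have comp [measurable]: "(\<lambda>y. y r) \<in> borel_measurable ?B" if "r \<in> J" for r
    using that by (rule measurable_component_singleton)
  have vecm: "vec \<in> ?B \<rightarrow>\<^sub>M PiM {..<n} (\<lambda>_. borel)"
    unfolding vec_def by (intro measurable_restrict borel_measurable_vec_lambda comp) (auto simp: J_def)
  have decm: "(\<lambda>y. dec l h (vec y)) \<in> ?B \<rightarrow>\<^sub>M count_space UNIV" for l
  proof -
    have "(\<lambda>(h, y). dec l h y) \<in> channel_space \<mu> n \<Otimes>\<^sub>M PiM {..<n} (\<lambda>_. borel) \<rightarrow>\<^sub>M count_space UNIV"
      using code by (simp add: block_code_def)
    from measurable_compose[OF measurable_Pair1'[OF h] this]
    show ?thesis by (intro measurable_compose[OF vecm]) simp
  qed
  have \<theta>m: "(\<lambda>y. \<theta> a y r) \<in> borel_measurable ?B" if "r \<in> J" for a r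
  proof -
    have [measurable]: "(\<lambda>y. \<chi> \<alpha>. y (fst r, \<alpha>)) \<in> borel_measurable ?B"
      using that by (intro borel_measurable_vec_lambda comp) (auto simp: J_def)
    show ?thesis unfolding \<theta>_def pred_def by (cases "good (fst r)") (simp_all, measurable)
  qed
  \<comment> \<open>On a typical block the two exponents in the weight add up to at most
    \<open>packing_exponent\<close> times \<open>n\<close>, so the right side is at least 1;
    otherwise the left side is 0.\<close>
  have point: "indicator {z. typical P n enc dec \<eta> \<tau> i j h (w a b) z} z
      \<le> ennreal (exp (packing_exponent (real CARD('k)) (real CARD('m)) gmax \<eta> * real n)) * \<phi> a b (?shift a b (?p z))" for a b z
  proof (cases "typical P n enc dec \<eta> \<tau> i j h (w a b) z")
    case True
    define u where "u = (\<lambda>k t. enc k (w a b k) h t)"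
    define Y where "Y = (\<lambda>l t. (\<Sum>k\<in>UNIV. H l k t *v u k t) + noise_vector z l t)"
    define g where "g = real CARD('m) * real CARD('m) * gmax"
    have recv: "received n enc l h (w a b) z = (\<lambda>t\<in>{..<n}. Y l t)" for l
      by (simp add: received_def Y_def u_def H_def)
    have vecY: "vec (\<lambda>r\<in>J. sig l a b (fst r) $ snd r + (\<lambda>r\<in>J. z (fst r, l, snd r)) r) = (\<lambda>t\<in>{..<n}. Y l t)" for l
      by (auto simp: vec_def J_def Y_def sig_def u_def noise_vector_def fun_eq_iff vec_eq_iff)
    have comps: "(\<lambda>r\<in>J. sig l a b (fst r) $ snd r + (\<lambda>r\<in>J. z (fst r, l, snd r)) r) r = Y l (fst r) $ snd r"
      if "r \<in> J" for l r using that by (auto simp: Y_def sig_def u_def noise_vector_def)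
    have row: "(\<chi> \<alpha>. (\<lambda>r\<in>J. sig i a b (fst r) $ snd r + (\<lambda>r\<in>J. z (fst r, i, snd r)) r) (t, \<alpha>)) = Y i t"
      if "t < n" for t using that comps[of "(t, _)" i] by (auto simp: J_def vec_eq_iff)
    have rest: "rest l a t = (\<Sum>k\<in>UNIV-{j}. H l k t *v u k t)" for l t
      unfolding rest_def u_def w_def using ij by (intro sum.cong) auto
    have D: "D1 (fst (?shift a b (?p z))) = a" "D2 (snd (?shift a b (?p z))) = b"
    proof -
      have "dec i h (received n enc i h (w a b) z) = w a b i" "dec j h (received n enc j h (w a b) z) = w a b j"
        using True unfolding typical_def by blast+
      moreover have "w a b i = a" "w a b j = b" using ij by (auto simp: w_def)
      ultimately show "D1 (fst (?shift a b (?p z))) = a" "D2 (snd (?shift a b (?p z))) = b"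
        unfolding D1_def D2_def fst_conv snd_conv vecY recv by simp_all
    qed
    have e1: "(\<Sum>r\<in>J. (cmod (fst (?shift a b (?p z)) r))\<^sup>2 / P) = (\<Sum>t<n. (norm (Y i t))\<^sup>2 / P)"
    proof -
      have "(\<Sum>r\<in>J. (cmod (fst (?shift a b (?p z)) r))\<^sup>2 / P) = (\<Sum>r\<in>{..<n}\<times>UNIV. (cmod (Y i (fst r) $ snd r))\<^sup>2 / P)"
        using comps[of _ i] by (intro sum.cong) (auto simp: J_def)
      also have "\<dots> = (\<Sum>t<n. (norm (Y i t))\<^sup>2 / P)" by (rule sum_block_norm_square)
      finally show ?thesis .
    qed
    have e2: "(\<Sum>r\<in>J. (cmod (snd (?shift a b (?p z)) r - \<theta> a (fst (?shift a b (?p z))) r))\<^sup>2 / v r)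
      = (\<Sum>t<n. (norm (Y j t - pred a (Y i t) t))\<^sup>2 / vt t)"
    proof -
      have "(\<Sum>r\<in>J. (cmod (snd (?shift a b (?p z)) r - \<theta> a (fst (?shift a b (?p z))) r))\<^sup>2 / v r)
        = (\<Sum>r\<in>{..<n}\<times>UNIV. (cmod ((Y j (fst r) - pred a (Y i (fst r)) (fst r)) $ snd r))\<^sup>2 / vt (fst r))"
      proof (rule sum.cong)
        fix r assume "r \<in> {..<n} \<times> (UNIV :: 'm set)"
        then have r: "r \<in> J" "fst r < n" by (auto simp: J_def)
        show "(cmod (snd (?shift a b (?p z)) r - \<theta> a (fst (?shift a b (?p z))) r))\<^sup>2 / v r
          = (cmod ((Y j (fst r) - pred a (Y i (fst r)) (fst r)) $ snd r))\<^sup>2 / vt (fst r)"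
          using comps[OF r(1), of j] row[OF r(2)] by (simp add: \<theta>_def v_def)
      qed (simp add: J_def)
      also have "\<dots> = (\<Sum>t<n. (norm (Y j t - pred a (Y i t) t))\<^sup>2 / vt t)" by (rule sum_block_norm_square)
      finally show ?thesis .
    qed
    have Hbd: "cmod (H l k t $ \<alpha> $ \<beta>) \<le> gmax" if "t < n" for l k t \<alpha> \<beta>
      using bd[OF that] by (simp add: H_def channel_matrix_def)
    define X where "X = (\<lambda>t. \<Sum>k\<in>UNIV. (norm (u k t))\<^sup>2)"
    define N where "N = (\<lambda>l t. (norm (noise_vector z l t :: complex ^ 'm))\<^sup>2)"
    have X0: "0 \<le> X t" and N0: "0 \<le> N l t" for t l by (auto simp: X_def N_def intro: sum_nonneg)
    have Yb: "(norm (Y l t))\<^sup>2 \<le> 2 * (real CARD('k) * g\<^sup>2 * X t) + 2 * N l t" if "t < n" for l t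
      unfolding Y_def X_def N_def g_def by (rule norm_received_square_le) (rule Hbd[OF that])
    \<comment> \<open>One bound for both kinds of time: the first two terms are the prediction error
      at a good time, the last is the whole output relative to \<open>P\<close> at a weak
      one.\<close>
    have Eb: "(norm (Y j t - pred a (Y i t) t))\<^sup>2 / vt t
        \<le> 2 * N j t + 2 * ((g / \<eta>)\<^sup>2 * N i t) + (2 * (real CARD('k) * g\<^sup>2 * X t) + 2 * N j t) / P" if "t < n" for t
    proof (cases "good t")
      case True
      then have "(norm (Y j t - pred a (Y i t) t))\<^sup>2 \<le> 2 * N j t + 2 * ((g / \<eta>)\<^sup>2 * N i t)"
        unfolding pred_def rest Y_def N_def g_def
        using norm_reconstruction_error_square_le[of "\<lambda>k. H j k t" gmax \<eta> "\<lambda>k. H i k t" j "\<lambda>k. u k t" "noise_vector z j t" "noise_vector z i t"]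
          Hbd[OF that] \<eta> by (simp add: good_def)
      moreover have "0 \<le> (2 * (real CARD('k) * g\<^sup>2 * X t) + 2 * N j t) / P"
        using P X0 N0 by (intro divide_nonneg_nonneg add_nonneg_nonneg mult_nonneg_nonneg) auto
      ultimately show ?thesis using True by (simp add: vt_def)
    next
      case False
      then have "(norm (Y j t - pred a (Y i t) t))\<^sup>2 / vt t = (norm (Y j t))\<^sup>2 / P"
        by (simp add: pred_def vt_def)
      also have "\<dots> \<le> (2 * (real CARD('k) * g\<^sup>2 * X t) + 2 * N j t) / P"
        using Yb[OF that, of j] P by (intro divide_right_mono) auto
      also have "\<dots> \<le> 2 * N j t + 2 * ((g / \<eta>)\<^sup>2 * N i t) + (2 * (real CARD('k) * g\<^sup>2 * X t) + 2 * N j t) / P"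
        using N0 by simp
      finally show ?thesis .
    qed
    have sX: "(\<Sum>t<n. X t) \<le> 8 * real CARD('k) * real n * P"
      using True by (simp add: typical_def total_power_def X_def u_def)
    have sN: "(\<Sum>t<n. N i t) + (\<Sum>t<n. N j t) \<le> 16 * real n * real CARD('m)"
      using True by (simp add: typical_def pair_noise_def N_def sum.distrib)
    have sN0: "0 \<le> (\<Sum>t<n. N l t)" for l by (intro sum_nonneg N0)
    have "(\<Sum>t<n. (norm (Y i t))\<^sup>2 / P) + (\<Sum>t<n. (norm (Y j t - pred a (Y i t) t))\<^sup>2 / vt t)
      \<le> (\<Sum>t<n. (2 * (real CARD('k) * g\<^sup>2 * X t) + 2 * N i t) / P)
        + (\<Sum>t<n. 2 * N j t + 2 * ((g / \<eta>)\<^sup>2 * N i t) + (2 * (real CARD('k) * g\<^sup>2 * X t) + 2 * N j t) / P)"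
      using Yb Eb P by (intro add_mono sum_mono divide_right_mono) auto
    also have "\<dots> = 4 * (real CARD('k) * g\<^sup>2) * ((\<Sum>t<n. X t) / P) + 2 * (((\<Sum>t<n. N i t) + (\<Sum>t<n. N j t)) / P)
        + 2 * (\<Sum>t<n. N j t) + 2 * (g / \<eta>)\<^sup>2 * (\<Sum>t<n. N i t)"
      unfolding sum.distrib sum_divide_distrib[symmetric] sum_distrib_left[symmetric]
      by (simp add: algebra_simps add_divide_distrib)
    also have "\<dots> \<le> 4 * (real CARD('k) * g\<^sup>2) * (8 * real CARD('k) * real n) + 2 * (16 * real n * real CARD('m))
        + 2 * (16 * real n * real CARD('m)) + 2 * (g / \<eta>)\<^sup>2 * (16 * real n * real CARD('m))"
    proof (intro add_mono mult_left_mono)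
      show "(\<Sum>t<n. X t) / P \<le> 8 * real CARD('k) * real n" using sX P by (simp add: divide_le_eq)
      have "((\<Sum>t<n. N i t) + (\<Sum>t<n. N j t)) / P \<le> ((\<Sum>t<n. N i t) + (\<Sum>t<n. N j t)) / 1"
        using P sN0 by (intro divide_left_mono) auto
      then show "((\<Sum>t<n. N i t) + (\<Sum>t<n. N j t)) / P \<le> 16 * real n * real CARD('m)" using sN by simp
      show "(\<Sum>t<n. N j t) \<le> 16 * real n * real CARD('m)" "(\<Sum>t<n. N i t) \<le> 16 * real n * real CARD('m)"
        using sN sN0[of i] sN0[of j] by linarith+
    qed auto
    also have "\<dots> = packing_exponent (real CARD('k)) (real CARD('m)) gmax \<eta> * real n"
      by (simp add: packing_exponent_def Let_def g_def algebra_simps power2_eq_square)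
    finally have ex: "(\<Sum>t<n. (norm (Y i t))\<^sup>2 / P) + (\<Sum>t<n. (norm (Y j t - pred a (Y i t) t))\<^sup>2 / vt t) \<le> packing_exponent (real CARD('k)) (real CARD('m)) gmax \<eta> * real n" .
    have "\<phi> a b (?shift a b (?p z)) = ennreal (exp (- (\<Sum>t<n. (norm (Y i t))\<^sup>2 / P)))
        * ennreal (exp (- (\<Sum>t<n. (norm (Y j t - pred a (Y i t) t))\<^sup>2 / vt t)))"
      using D e1 e2 unfolding \<phi>_def packing_weight_def by (simp only: split_beta' fst_conv snd_conv indicator_simps singletonI mult_1)
    then have "ennreal (exp (packing_exponent (real CARD('k)) (real CARD('m)) gmax \<eta> * real n)) * \<phi> a b (?shift a b (?p z))
      = ennreal (exp (packing_exponent (real CARD('k)) (real CARD('m)) gmax \<eta> * real n - ((\<Sum>t<n. (norm (Y i t))\<^sup>2 / P) + (\<Sum>t<n. (norm (Y j t - pred a (Y i t) t))\<^sup>2 / vt t))))"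
      by (simp add: ennreal_mult[symmetric] exp_add[symmetric] algebra_simps)
    also have "\<dots> \<ge> ennreal 1" using ex by (intro ennreal_leI) simp
    finally show ?thesis using True by simp
  qed simp
  have "(\<Sum>a<L i. \<Sum>b<L j. \<integral>\<^sup>+ z. indicator {z. typical P n enc dec \<eta> \<tau> i j h (w a b) z} z \<partial>noise_space n)
    \<le> (\<Sum>a<L i. \<Sum>b<L j. ennreal (exp (packing_exponent (real CARD('k)) (real CARD('m)) gmax \<eta> * real n)) * (\<integral>\<^sup>+ z. \<phi> a b (?shift a b z) \<partial>(Q \<Otimes>\<^sub>M Q)))"
  proof (intro sum_mono)
    fix a b
    have sm: "(\<lambda>z. \<phi> a b (?shift a b z)) \<in> borel_measurable (Q \<Otimes>\<^sub>M Q)"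
      unfolding \<phi>_def Q_def D1_def D2_def by (rule borel_measurable_packing_weight_shift[OF decm decm \<theta>m])
    have pm: "?p \<in> (noise_space n :: ('k, 'm) noises measure) \<rightarrow>\<^sub>M Q \<Otimes>\<^sub>M Q"
      unfolding Q_def noise_space_def J_def
      by (intro measurable_Pair measurable_restrict measurable_component_singleton) auto
    have "(\<integral>\<^sup>+ z. indicator {z. typical P n enc dec \<eta> \<tau> i j h (w a b) z} z \<partial>noise_space n)
      \<le> (\<integral>\<^sup>+ z. ennreal (exp (packing_exponent (real CARD('k)) (real CARD('m)) gmax \<eta> * real n)) * \<phi> a b (?shift a b (?p z)) \<partial>noise_space n)"
      by (intro nn_integral_mono point)
    also have "\<dots> = ennreal (exp (packing_exponent (real CARD('k)) (real CARD('m)) gmax \<eta> * real n)) * (\<integral>\<^sup>+ z. \<phi> a b (?shift a b (?p z)) \<partial>noise_space n)"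
      by (rule nn_integral_cmult) (rule measurable_compose[OF pm sm])
    also have "(\<integral>\<^sup>+ z. \<phi> a b (?shift a b (?p z)) \<partial>noise_space n)
      = (\<integral>\<^sup>+ z. \<phi> a b (?shift a b z) \<partial>distr (noise_space n :: ('k, 'm) noises measure) (Q \<Otimes>\<^sub>M Q) ?p)"
      by (rule nn_integral_distr[OF pm, symmetric]) (use sm in simp)
    also have "distr (noise_space n :: ('k, 'm) noises measure) (Q \<Otimes>\<^sub>M Q) ?p = Q \<Otimes>\<^sub>M Q"
      unfolding Q_def J_def by (rule distr_noise_space_two_nodes[OF ij n])
    finally show "(\<integral>\<^sup>+ z. indicator {z. typical P n enc dec \<eta> \<tau> i j h (w a b) z} z \<partial>noise_space n)
      \<le> ennreal (exp (packing_exponent (real CARD('k)) (real CARD('m)) gmax \<eta> * real n)) * (\<integral>\<^sup>+ z. \<phi> a b (?shift a b z) \<partial>(Q \<Otimes>\<^sub>M Q))" .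
  qed
  also have "\<dots> = ennreal (exp (packing_exponent (real CARD('k)) (real CARD('m)) gmax \<eta> * real n)) *
      (\<Sum>a<L i. \<Sum>b<L j. \<integral>\<^sup>+ z. \<phi> a b (?shift a b z) \<partial>(Q \<Otimes>\<^sub>M Q))"
    by (simp add: sum_distrib_left)
  also have "\<dots> \<le> ennreal (exp (packing_exponent (real CARD('k)) (real CARD('m)) gmax \<eta> * real n)) * ennreal (P ^ card J * (\<Prod>r\<in>J. v r))"
    unfolding \<phi>_def Q_def
    by (intro mult_left_mono two_receiver_packing[OF finJ _ _ \<theta>m]) (use P vt decm in \<open>auto simp: D1_def D2_def v_def\<close>)
  also have "\<dots> = ennreal (exp (packing_exponent (real CARD('k)) (real CARD('m)) gmax \<eta> * real n) * (P ^ card J * (\<Prod>r\<in>J. v r)))"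
    using P vt by (intro ennreal_mult[symmetric] mult_nonneg_nonneg prod_nonneg) (auto simp: v_def less_imp_le)
  also have "\<dots> \<le> ennreal (exp (packing_exponent (real CARD('k)) (real CARD('m)) gmax \<eta> * real n) * P powr (real n * real CARD('m) * (1 + 8 * \<tau>)))"
  proof (intro ennreal_leI mult_left_mono)
    have cJ: "card J = n * CARD('m)" by (simp add: J_def)
    \<comment> \<open>Only weak times have variance \<open>P\<close>. Each multiplies the volume by
      \<open>P ^ CARD('m)\<close>, and their number is at most \<open>8 * \<tau> * n\<close>, whence
      the exponent.\<close>
    have "(\<Prod>r\<in>J. v r) = (\<Prod>t<n. \<Prod>\<alpha>\<in>(UNIV::'m set). vt t)"
      by (simp only: J_def v_def prod.cartesian_product split_beta')
    also have "\<dots> = (\<Prod>t<n. vt t ^ CARD('m))" by simp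
    also have "\<dots> = (\<Prod>t<n. if t \<in> weak_times n \<eta> i j h then P ^ CARD('m) else 1)"
      by (intro prod.cong) (auto simp: vt_def good_def H_def weak_times_def)
    also have "\<dots> = (P ^ CARD('m)) ^ card ({..<n} \<inter> weak_times n \<eta> i j h)"
      by (simp add: prod.If_cases)
    also have "{..<n} \<inter> weak_times n \<eta> i j h = weak_times n \<eta> i j h" by (auto simp: weak_times_def)
    finally have "P ^ card J * (\<Prod>r\<in>J. v r) = P powr (real n * real CARD('m) + real CARD('m) * real (card (weak_times n \<eta> i j h)))"
      using P by (simp add: cJ powr_add powr_realpow[symmetric] power_mult[symmetric] powr_powr)
    also have "\<dots> \<le> P powr (real n * real CARD('m) * (1 + 8 * \<tau>))"
    proof (rule powr_mono[OF _ P])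
      have "real CARD('m) * real (card (weak_times n \<eta> i j h)) \<le> real CARD('m) * (8 * \<tau> * real n)"
        using True by (intro mult_left_mono) auto
      then show "real n * real CARD('m) + real CARD('m) * real (card (weak_times n \<eta> i j h)) \<le> real n * real CARD('m) * (1 + 8 * \<tau>)"
        by (simp add: algebra_simps)
    qed
    finally show "P ^ card J * (\<Prod>r\<in>J. v r) \<le> P powr (real n * real CARD('m) * (1 + 8 * \<tau>))" .
  qed simp
  finally show ?thesis unfolding w_def .
qed

end

end

section \<open>From typical blocks to a bound on the rates of two users\<close>

context fading_channel begin

context
  fixes P :: real and n :: nat and L :: "'k::finite \<Rightarrow> nat"
    and enc :: "('k, 'm::finite) encoders" and dec :: "('k, 'm) decoders"
  assumes code: "block_code \<mu> P n L enc dec"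
begin

text \<open>A union bound over five events: two decoding errors of probability at most 1/16 and
  three violations of probability at most 1/8 by Markov's inequality, 1/2 in total.\<close>

lemma prob_typical_ge:
  fixes i j :: 'k
  assumes n: "0 < n" and P: "1 \<le> P" and \<tau>: "0 < \<tau>"
    and tail: "measure (PiM UNIV (\<lambda>_. \<mu>)) {x \<in> space (PiM UNIV (\<lambda>_. \<mu>)).
      (\<chi> a b. x (a, b)) \<in> {G :: complex ^ 'm ^ 'm. \<not> bounded_below \<eta> G}} \<le> \<tau>"
    and err: "error_prob \<mu> n L enc dec i \<le> 1 / 16" "error_prob \<mu> n L enc dec j \<le> 1 / 16"
  defines "T \<equiv> {(h, w, z) \<in> space (joint_space \<mu> n L). typical P n enc dec \<eta> \<tau> i j h w z}"
  shows "T \<in> sets (joint_space \<mu> n L)" "1 / 2 \<le> measure (joint_space \<mu> n L) T"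
proof -
  let ?\<Omega> = "joint_space \<mu> n L :: (('k, 'm) gains \<times> ('k \<Rightarrow> nat) \<times> ('k, 'm) noises) measure"
  let ?C = "channel_space \<mu> n :: ('k, 'm) gains measure"
  let ?N = "noise_space n :: ('k, 'm) noises measure"
  have Lpos: "\<And>k. 0 < L k" by (rule code_size_pos[OF code])
  interpret O: prob_space ?\<Omega> by (rule prob_space_joint_space[OF Lpos])
  interpret C: prob_space ?C by (rule prob_space_channel_space)
  interpret W: prob_space "message_space L" by (rule prob_space_message_space[OF Lpos])
  interpret N: prob_space ?N by (rule prob_space_noise_space)
  interpret WN: pair_prob_space "message_space L" ?N ..
  have WN: "prob_space (message_space L \<Otimes>\<^sub>M ?N)" by (rule WN.prob_space_axioms)
  define X1 where "X1 = (\<lambda>x :: ('k, 'm) gains \<times> ('k \<Rightarrow> nat) \<times> ('k, 'm) noises. total_power n enc (fst x) (fst (snd x)))"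
  define X2 where "X2 = (\<lambda>x :: ('k, 'm) gains \<times> ('k \<Rightarrow> nat) \<times> ('k, 'm) noises. pair_noise n i j (snd (snd x)))"
  define X3 where "X3 = (\<lambda>x :: ('k, 'm) gains \<times> ('k \<Rightarrow> nat) \<times> ('k, 'm) noises. real (card (weak_times n \<eta> i j (fst x))))"
  have em: "(\<lambda>x. enc k (fst (snd x) k) (fst x) t) \<in> borel_measurable ?\<Omega>" if "t < n" for k t
    using measurable_codeword[OF code that, of k] by (simp add: split_beta')
  have em2: "(\<lambda>x. ennreal ((norm (enc k (fst (snd x) k) (fst x) t))\<^sup>2)) \<in> borel_measurable ?\<Omega>" if "t < n" for k t
    by (intro measurable_compose[OF _ measurable_ennreal] borel_measurable_power measurable_compose[OF em borel_measurable_norm] that)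
  have X1m [measurable]: "X1 \<in> borel_measurable ?\<Omega>"
    unfolding X1_def total_power_def
    by (intro borel_measurable_sum borel_measurable_power measurable_compose[OF em borel_measurable_norm]) auto
  have X2m [measurable]: "X2 \<in> borel_measurable ?\<Omega>"
    unfolding X2_def pair_noise_def joint_space_def
    by (intro borel_measurable_sum borel_measurable_add borel_measurable_power 
          measurable_compose[OF measurable_compose[OF measurable_compose[OF measurable_snd measurable_snd] measurable_noise_vector] borel_measurable_norm]) auto
  let ?bad = "{G :: complex ^ 'm ^ 'm. \<not> bounded_below \<eta> G}"
  have badm: "?bad \<in> sets borel" by measurable
  \<comment> \<open>As a sum of indicators the number of weak times has mean at most
    \<open>n * \<tau>\<close> by linearity and the common law of the matrices.\<close>
  have X3: "X3 x = (\<Sum>t<n. indicator ?bad (channel_matrix (fst x) i j t))" for x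
  proof -
    have "X3 x = (\<Sum>t\<in>weak_times n \<eta> i j (fst x). 1)" by (simp add: X3_def)
    also have "\<dots> = (\<Sum>t<n. indicator ?bad (channel_matrix (fst x) i j t))"
      by (rule sum.mono_neutral_cong_left) (auto simp: weak_times_def indicator_def)
    finally show ?thesis .
  qed
  have cm: "(\<lambda>h. channel_matrix h i j t) \<in> borel_measurable ?C" if "t < n" for t
    using that by (rule measurable_channel_matrix)
  have im: "(\<lambda>h. indicator ?bad (channel_matrix h i j t) :: real) \<in> borel_measurable ?C" if "t < n" for t
    by (rule measurable_compose[OF cm[OF that]]) (use badm in simp)
  have im': "(\<lambda>h. indicator ?bad (channel_matrix h i j t) :: ennreal) \<in> borel_measurable ?C" if "t < n" for t
    by (rule measurable_compose[OF cm[OF that]]) (use badm in simp)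
  have X3m [measurable]: "X3 \<in> borel_measurable ?\<Omega>"
    unfolding X3[abs_def] joint_space_def
    by (intro borel_measurable_sum measurable_compose[OF measurable_fst im]) auto
  have I1: "(\<integral>\<^sup>+ x. ennreal (X1 x) \<partial>?\<Omega>) \<le> ennreal (real n * real CARD('k) * P)"
  proof -
    have "(\<integral>\<^sup>+ x. ennreal (X1 x) \<partial>?\<Omega>) = (\<Sum>t<n. \<Sum>k\<in>UNIV. \<integral>\<^sup>+ x. ennreal ((norm (enc k (fst (snd x) k) (fst x) t))\<^sup>2) \<partial>?\<Omega>)"
    proof -
      have "(\<integral>\<^sup>+ x. ennreal (X1 x) \<partial>?\<Omega>) = (\<integral>\<^sup>+ x. (\<Sum>t<n. \<Sum>k\<in>UNIV. ennreal ((norm (enc k (fst (snd x) k) (fst x) t))\<^sup>2)) \<partial>?\<Omega>)"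
        by (simp add: X1_def total_power_def sum_ennreal sum_nonneg)
      also have "\<dots> = (\<Sum>t<n. \<integral>\<^sup>+ x. (\<Sum>k\<in>UNIV. ennreal ((norm (enc k (fst (snd x) k) (fst x) t))\<^sup>2)) \<partial>?\<Omega>)"
        by (rule nn_integral_sum) (intro borel_measurable_sum em2, simp)
      also have "\<dots> = (\<Sum>t<n. \<Sum>k\<in>UNIV. \<integral>\<^sup>+ x. ennreal ((norm (enc k (fst (snd x) k) (fst x) t))\<^sup>2) \<partial>?\<Omega>)"
        by (intro sum.cong refl nn_integral_sum em2, simp)
      finally show ?thesis .
    qed
    also have "\<dots> \<le> (\<Sum>t<n. \<Sum>k\<in>(UNIV::'k set). ennreal P)"
    proof (intro sum_mono)
      fix t k assume "t \<in> {..<n}"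
      then show "(\<integral>\<^sup>+ x. ennreal ((norm (enc k (fst (snd x) k) (fst x) t))\<^sup>2) \<partial>?\<Omega>) \<le> ennreal P"
        using code unfolding block_code_def split_beta' by blast
    qed
    also have "\<dots> = ennreal (\<Sum>t<n. \<Sum>k\<in>(UNIV::'k set). P)" using P by (simp add: sum_ennreal sum_nonneg del: sum_constant)
    also have "\<dots> = ennreal (real n * real CARD('k) * P)" by (simp add: mult.assoc)
    finally show ?thesis .
  qed
  have I2: "(\<integral>\<^sup>+ x. ennreal (X2 x) \<partial>?\<Omega>) \<le> ennreal (real n * (2 * real CARD('m)))"
  proof -
    have nm: "(\<lambda>z. ennreal ((norm (noise_vector z l t :: complex ^ 'm))\<^sup>2)) \<in> borel_measurable ?N" if "t < n" for l t
      using measurable_noise_vector[OF that] by measurable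
    have "(\<integral>\<^sup>+ x. ennreal (X2 x) \<partial>?\<Omega>) = (\<integral>\<^sup>+ x. (\<lambda>y. ennreal (pair_noise n i j (snd y))) (snd x) \<partial>?\<Omega>)"
      by (simp add: X2_def)
    also have "\<dots> = (\<integral>\<^sup>+ y. ennreal (pair_noise n i j (snd y)) \<partial>(message_space L \<Otimes>\<^sub>M ?N))"
      unfolding joint_space_def pair_noise_def
      by (rule nn_integral_pair_snd[OF prob_space_channel_space WN])
         (intro measurable_compose[OF _ measurable_ennreal] borel_measurable_sum borel_measurable_add borel_measurable_power 
          measurable_compose[OF measurable_compose[OF measurable_snd measurable_noise_vector] borel_measurable_norm], auto)
    also have "\<dots> = (\<integral>\<^sup>+ z. ennreal (pair_noise n i j z) \<partial>?N)"
      unfolding pair_noise_def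
      by (rule nn_integral_pair_snd[OF W.prob_space_axioms N.prob_space_axioms])
         (intro measurable_compose[OF _ measurable_ennreal] borel_measurable_sum borel_measurable_add borel_measurable_power 
          measurable_compose[OF measurable_noise_vector borel_measurable_norm], auto)
    also have "\<dots> = (\<integral>\<^sup>+ z. (\<Sum>t<n. ennreal ((norm (noise_vector z i t))\<^sup>2) + ennreal ((norm (noise_vector z j t))\<^sup>2)) \<partial>?N)"
      by (simp add: pair_noise_def ennreal_plus[symmetric] sum_ennreal del: ennreal_plus)
    also have "\<dots> = (\<Sum>t<n. (\<integral>\<^sup>+ z. ennreal ((norm (noise_vector z i t))\<^sup>2) \<partial>?N) + (\<integral>\<^sup>+ z. ennreal ((norm (noise_vector z j t))\<^sup>2) \<partial>?N))"
      using nm by (subst nn_integral_sum) (auto simp: nn_integral_add intro!: sum.cong)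
    also have "\<dots> = (\<Sum>t<n. of_nat CARD('m) + of_nat CARD('m))"
      by (intro sum.cong refl arg_cong2[where f="(+)"] nn_integral_noise_norm_square) auto
    also have "\<dots> = ennreal (real n * (2 * real CARD('m)))"
      by (simp add: ennreal_of_nat_eq_real_of_nat ennreal_mult[symmetric] ennreal_plus[symmetric] del: ennreal_plus)
    finally show ?thesis by simp
  qed
  have I3: "(\<integral>\<^sup>+ x. ennreal (X3 x) \<partial>?\<Omega>) \<le> ennreal (real n * \<tau>)"
  proof -
    have "(\<integral>\<^sup>+ x. ennreal (X3 x) \<partial>?\<Omega>) = (\<integral>\<^sup>+ x. (\<lambda>h. \<Sum>t<n. indicator ?bad (channel_matrix h i j t)) (fst x) \<partial>?\<Omega>)"
      by (simp add: X3 sum_ennreal[symmetric] ennreal_indicator)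
    also have "\<dots> = (\<integral>\<^sup>+ h. (\<Sum>t<n. indicator ?bad (channel_matrix h i j t)) \<partial>?C)"
      unfolding joint_space_def
      by (rule nn_integral_pair_fst[OF prob_space_channel_space WN]) (intro borel_measurable_sum im', auto)
    also have "\<dots> = (\<Sum>t<n. \<integral>\<^sup>+ h. indicator ?bad (channel_matrix h i j t) \<partial>?C)"
      using im' by (intro nn_integral_sum) auto
    also have "\<dots> \<le> (\<Sum>t<n. ennreal \<tau>)"
    proof (intro sum_mono)
      fix t assume "t \<in> {..<n}"
      then have t: "t < n" by simp
      let ?S = "{h \<in> space ?C. channel_matrix h i j t \<in> ?bad}"
      have "?S = (\<lambda>h. channel_matrix h i j t) -` ?bad \<inter> space ?C" by auto
      then have S: "?S \<in> sets ?C" using measurable_sets[OF cm[OF t] badm] by simp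
      have "(\<integral>\<^sup>+ h. indicator ?bad (channel_matrix h i j t) \<partial>?C) = (\<integral>\<^sup>+ h. indicator ?S h \<partial>?C)"
        by (intro nn_integral_cong) (auto simp: indicator_def)
      also have "\<dots> = ennreal (C.prob ?S)" using S by (simp add: C.emeasure_eq_measure)
      also have "\<dots> \<le> ennreal \<tau>"
        using tail unfolding prob_channel_matrix[OF t badm, symmetric, of i j] by (rule ennreal_leI)
      finally show "(\<integral>\<^sup>+ h. indicator ?bad (channel_matrix h i j t) \<partial>?C) \<le> ennreal \<tau>" .
    qed
    also have "\<dots> = ennreal (real n * \<tau>)" using \<tau> by (simp add: ennreal_mult ennreal_of_nat_eq_real_of_nat)
    finally show ?thesis .
  qed
  let ?E = "\<lambda>l. {(h, w, z) \<in> space ?\<Omega>. dec l h (received n enc l h w z) \<noteq> w l}"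
  let ?A1 = "{x \<in> space ?\<Omega>. 8 * real CARD('k) * real n * P < X1 x}"
  let ?A2 = "{x \<in> space ?\<Omega>. 16 * real n * real CARD('m) < X2 x}"
  let ?A3 = "{x \<in> space ?\<Omega>. 8 * \<tau> * real n < X3 x}"
  have E: "?E l \<in> O.events" for l by (rule error_event[OF code])
  have A: "?A1 \<in> O.events" "?A2 \<in> O.events" "?A3 \<in> O.events" by measurable
  have p1: "O.prob ?A1 \<le> 1 / 8"
    using O.prob_gt_le_if_nn_integral_le[OF X1m I1, of "8 * real CARD('k) * real n * P"] n P by (simp add: field_simps)
  have p2: "O.prob ?A2 \<le> 1 / 8"
    using O.prob_gt_le_if_nn_integral_le[OF X2m I2, of "16 * real n * real CARD('m)"] n by (simp add: field_simps)
  have p3: "O.prob ?A3 \<le> 1 / 8"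
    using O.prob_gt_le_if_nn_integral_le[OF X3m I3, of "8 * \<tau> * real n"] n \<tau> by (simp add: field_simps)
  have T: "T = space ?\<Omega> - (?E i \<union> ?E j \<union> ?A1 \<union> ?A2 \<union> ?A3)"
    unfolding T_def typical_def X1_def X2_def X3_def by (auto simp: not_less)
  show "T \<in> sets ?\<Omega>" unfolding T using E A by (intro sets.compl_sets sets.Un)
  have "O.prob (?E i \<union> ?E j \<union> ?A1 \<union> ?A2 \<union> ?A3) \<le> O.prob (?E i) + O.prob (?E j) + O.prob ?A1 + O.prob ?A2 + O.prob ?A3"
    by (intro order_trans[OF measure_Un_le] add_mono order_refl sets.Un E A)
  also have "\<dots> \<le> 1 / 16 + 1 / 16 + 1 / 8 + 1 / 8 + 1 / 8"
    using err p1 p2 p3 by (intro add_mono) (auto simp: error_prob_def)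
  finally have "O.prob (?E i \<union> ?E j \<union> ?A1 \<union> ?A2 \<union> ?A3) \<le> 1 / 2" by simp
  moreover have "O.prob T = 1 - O.prob (?E i \<union> ?E j \<union> ?A1 \<union> ?A2 \<union> ?A3)"
    unfolding T using E A by (intro O.prob_compl sets.Un)
  ultimately show "1 / 2 \<le> O.prob T" by simp
qed

text \<open>Typical blocks carry at least half of the probability, while averaging over the messages
  bounds their probability by \<open>?B\<close> divided by the number of message pairs.\<close>

lemma code_size_product_le:
  fixes i j :: 'k
  assumes ij: "i \<noteq> j" and n: "0 < n" and P: "1 \<le> P" and \<tau>: "0 < \<tau>" and \<eta>: "0 < \<eta>"
    and tail: "measure (PiM UNIV (\<lambda>_. \<mu>)) {x \<in> space (PiM UNIV (\<lambda>_. \<mu>)).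
      (\<chi> a b. x (a, b)) \<in> {G :: complex ^ 'm ^ 'm. \<not> bounded_below \<eta> G}} \<le> \<tau>"
    and err: "error_prob \<mu> n L enc dec i \<le> 1 / 16" "error_prob \<mu> n L enc dec j \<le> 1 / 16"
  shows "real (L i) * real (L j) \<le> 2 * (exp (packing_exponent (real CARD('k)) (real CARD('m)) gmax \<eta> * real n)
    * P powr (real n * real CARD('m) * (1 + 8 * \<tau>)))" (is "_ \<le> 2 * ?B")
proof -
  let ?\<Omega> = "joint_space \<mu> n L :: (('k, 'm) gains \<times> ('k \<Rightarrow> nat) \<times> ('k, 'm) noises) measure"
  let ?C = "channel_space \<mu> n :: ('k, 'm) gains measure"
  let ?N = "noise_space n :: ('k, 'm) noises measure"
  let ?W = "message_space L"
  have Lpos: "\<And>k. 0 < L k" by (rule code_size_pos[OF code])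
  interpret O: prob_space ?\<Omega> by (rule prob_space_joint_space[OF Lpos])
  interpret C: prob_space ?C by (rule prob_space_channel_space)
  interpret W: prob_space ?W by (rule prob_space_message_space[OF Lpos])
  interpret N: prob_space ?N by (rule prob_space_noise_space)
  interpret WN: pair_prob_space ?W ?N ..
  let ?T = "{(h, w, z) \<in> space ?\<Omega>. typical P n enc dec \<eta> \<tau> i j h w z}"
  define S where "S = ?T"
  note T = prob_typical_ge[OF n P \<tau> tail err, folded S_def]
  have T': "S \<in> sets (?C \<Otimes>\<^sub>M (?W \<Otimes>\<^sub>M ?N))" using T(1) by (simp add: joint_space_def)
  have "ennreal (1 / 2) \<le> emeasure ?\<Omega> S" using T(2) by (simp only: O.emeasure_eq_measure ennreal_leI)
  also have "\<dots> = (\<integral>\<^sup>+ x. indicator S x \<partial>?\<Omega>)" by (rule nn_integral_indicator[OF T(1), symmetric])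
  also have "\<dots> = (\<integral>\<^sup>+ h. (\<integral>\<^sup>+ y. indicator S (h, y) \<partial>(?W \<Otimes>\<^sub>M ?N)) \<partial>?C)"
    unfolding joint_space_def by (rule WN.nn_integral_fst[OF borel_measurable_indicator[OF T'], symmetric])
  also have "\<dots> \<le> (\<integral>\<^sup>+ h. ennreal (1 / (real (L i) * real (L j))) * ennreal ?B \<partial>?C)"
  \<comment> \<open>The comparison is only almost everywhere because the gains are bounded only
    almost surely.\<close>
  proof (rule nn_integral_mono_AE)
    have "AE h in ?C. h \<in> space ?C" by simp
    with AE_gains_bounded[where 'k='k and 'm='m]
    show "AE h in ?C. (\<integral>\<^sup>+ y. indicator S (h, y) \<partial>(?W \<Otimes>\<^sub>M ?N)) \<le> ennreal (1 / (real (L i) * real (L j))) * ennreal ?B"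
    proof eventually_elim
      case (elim h)
      have m: "(\<lambda>y. indicator S (h, y) :: ennreal) \<in> borel_measurable (?W \<Otimes>\<^sub>M ?N)"
        by (rule measurable_compose[OF measurable_Pair1'[OF elim(2)] borel_measurable_indicator[OF T']])
      have "(\<integral>\<^sup>+ y. indicator S (h, y) \<partial>(?W \<Otimes>\<^sub>M ?N)) = (\<integral>\<^sup>+ w. (\<integral>\<^sup>+ z. indicator S (h, w, z) \<partial>?N) \<partial>?W)"
        by (rule N.nn_integral_fst[OF m, symmetric])
      also have "\<dots> \<le> ennreal (1 / (real (L i) * real (L j))) * ennreal ?B"
      proof (rule nn_integral_message_space_le[OF Lpos ij])
        show "(\<lambda>w. \<integral>\<^sup>+ z. indicator S (h, w, z) \<partial>?N) \<in> borel_measurable ?W"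
          using m by (intro N.borel_measurable_nn_integral) (simp add: split_beta')
        fix x :: "'k \<Rightarrow> nat"
        have "(\<Sum>a<L i. \<Sum>b<L j. \<integral>\<^sup>+ z. indicator S (h, x(j := b, i := a), z) \<partial>?N)
          \<le> (\<Sum>a<L i. \<Sum>b<L j. \<integral>\<^sup>+ z. indicator {z. typical P n enc dec \<eta> \<tau> i j h (x(j := b, i := a)) z} z \<partial>?N)"
          by (intro sum_mono nn_integral_mono) (auto simp: indicator_def S_def)
        also have "\<dots> \<le> ennreal ?B"
          using elim by (intro sum_typical_le[OF code ij n P \<eta>]) auto
        finally show "(\<Sum>a<L i. \<Sum>b<L j. \<integral>\<^sup>+ z. indicator S (h, x(j := b, i := a), z) \<partial>?N) \<le> ennreal ?B" .
      qed
      finally show ?case .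
    qed
  qed
  also have "\<dots> = ennreal (1 / (real (L i) * real (L j)) * ?B)"
    by (subst ennreal_mult) (simp_all add: C.emeasure_space_1)
  finally have "1 / 2 \<le> 1 / (real (L i) * real (L j)) * ?B"
    by (subst (asm) ennreal_le_iff) auto
  then show ?thesis using Lpos[of i] Lpos[of j] by (simp add: field_simps)
qed

end

text \<open>\<open>\<tau>\<close> is fixed before the power, so \<open>\<eta>\<close> and the
  exponent are independent of \<open>P\<close>, and \<open>c\<close> disappears after division by
  \<open>log 2 P\<close>. For each rate tuple a single positive block length with both error
  probabilities at most 1/16 suffices.\<close>

lemma achievable_pair_le:
  fixes i j :: "'k::finite"
  assumes ij: "i \<noteq> j" and \<tau>: "0 < \<tau>"
  shows "\<exists>c. \<forall>P\<ge>1. \<forall>R. achievable TYPE('m::finite) \<mu> P R \<longrightarrow>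
    R $ i + R $ j \<le> c + real CARD('m) * (1 + 8 * \<tau>) * log 2 P"
proof -
  obtain \<eta> where \<eta>: "0 < \<eta>" and tail: "measure (PiM UNIV (\<lambda>_. \<mu>)) {x \<in> space (PiM UNIV (\<lambda>_. \<mu>)).
      (\<chi> a b. x (a, b)) \<in> {G :: complex ^ 'm ^ 'm. \<not> bounded_below \<eta> G}} \<le> \<tau>"
    using ex_gain_threshold[OF \<tau>] by blast
  let ?e = "packing_exponent (real CARD('k)) (real CARD('m)) gmax \<eta>"
  show ?thesis
  \<comment> \<open>The 1 absorbs the factor 2 in the bound on the code sizes, as the block length
    is at least 1; the rest is the packing exponent converted to bits.\<close>
  proof (intro exI[of _ "1 + ?e * log 2 (exp 1)"] allI impI)
    fix P :: real and R :: "real ^ 'k"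
    assume P: "1 \<le> P" and "achievable TYPE('m) \<mu> P R"
    then obtain L and enc :: "nat \<Rightarrow> ('k, 'm) encoders" and dec where
      code: "\<And>n. block_code \<mu> P n (L n) (enc n) (dec n)" and
      rate: "\<And>n k. 2 powr (real n * R $ k) \<le> real (L n k)" and
      err: "\<And>j. (\<lambda>n. error_prob \<mu> n (L n) (enc n) (dec n) j) \<longlonglongrightarrow> 0"
      unfolding achievable_def by blast
    have "\<forall>\<^sub>F n in sequentially. error_prob \<mu> n (L n) (enc n) (dec n) i < 1 / 16"
      "\<forall>\<^sub>F n in sequentially. error_prob \<mu> n (L n) (enc n) (dec n) j < 1 / 16"
      by (intro order_tendstoD(2)[OF err], simp)+
    then have "\<forall>\<^sub>F n in sequentially. error_prob \<mu> n (L n) (enc n) (dec n) i < 1 / 16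
      \<and> error_prob \<mu> n (L n) (enc n) (dec n) j < 1 / 16 \<and> 0 < n"
      using eventually_gt_at_top[of 0] by eventually_elim auto
    then obtain n where n: "0 < n" and e: "error_prob \<mu> n (L n) (enc n) (dec n) i \<le> 1 / 16"
      "error_prob \<mu> n (L n) (enc n) (dec n) j \<le> 1 / 16"
      using eventually_happens[of _ sequentially] by (auto intro: less_imp_le)
    have "2 powr (real n * (R $ i + R $ j)) = 2 powr (real n * R $ i) * 2 powr (real n * R $ j)"
      by (simp add: powr_add[symmetric] distrib_left)
    also have "\<dots> \<le> real (L n i) * real (L n j)" using rate by (intro mult_mono) auto
    also have "\<dots> \<le> 2 * (exp (?e * real n) * P powr (real n * real CARD('m) * (1 + 8 * \<tau>)))"
      by (rule code_size_product_le[OF code ij n P \<tau> \<eta> tail e])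
    finally have "log 2 (2 powr (real n * (R $ i + R $ j)))
      \<le> log 2 (2 * (exp (?e * real n) * P powr (real n * real CARD('m) * (1 + 8 * \<tau>))))"
      using P by (subst log_le_cancel_iff) auto
    also have "\<dots> = 1 + ?e * real n * log 2 (exp 1) + real n * real CARD('m) * (1 + 8 * \<tau>) * log 2 P"
      using P by (simp add: log_mult log_powr log_exp)
    also have "\<dots> \<le> real n * (1 + ?e * log 2 (exp 1) + real CARD('m) * (1 + 8 * \<tau>) * log 2 P)"
      using n by (simp add: algebra_simps)
    finally have "real n * (R $ i + R $ j) \<le> real n * (1 + ?e * log 2 (exp 1) + real CARD('m) * (1 + 8 * \<tau>) * log 2 P)"
      by simp
    then show "R $ i + R $ j \<le> 1 + ?e * log 2 (exp 1) + real CARD('m) * (1 + 8 * \<tau>) * log 2 P"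
      using n by simp
  qed
qed

lemma dof_region_pair_le:
  fixes d :: "real ^ 'k::finite"
  assumes "d \<in> dof_region TYPE('m::finite) \<mu>" and ij: "i \<noteq> j"
  shows "d $ i + d $ j \<le> real CARD('m)"
proof (rule field_le_epsilon)
  fix e :: real assume e: "0 < e"
  define \<tau> where "\<tau> = e / (8 * real CARD('m))"
  have \<tau>: "0 < \<tau>" using e by (simp add: \<tau>_def)
  have \<tau>': "real CARD('m) * (1 + 8 * \<tau>) = real CARD('m) + e" by (simp add: \<tau>_def field_simps)
  obtain c where c: "\<And>P R. 1 \<le> P \<Longrightarrow> achievable TYPE('m) \<mu> P R \<Longrightarrow>
      R $ i + R $ j \<le> c + (real CARD('m) + e) * log 2 P"
    using achievable_pair_le[OF ij \<tau>, where 'm='m] unfolding \<tau>' by blast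
  obtain R where R: "\<And>P. 0 < P \<Longrightarrow> R P \<in> capacity_region TYPE('m) \<mu> P"
    and lim: "\<And>k. ((\<lambda>P. R P $ k / log 2 P) \<longlongrightarrow> d $ k) at_top"
    using assms(1) unfolding dof_region_def by blast
  have cap: "R P $ i + R P $ j \<le> c + (real CARD('m) + e) * log 2 P" if "1 \<le> P" for P
  proof -
    \<comment> \<open>The rate bound describes a closed half-space, so it passes from achievable
      tuples to their closure.\<close>
    have "closed {x :: real ^ 'k. x $ i + x $ j \<le> c + (real CARD('m) + e) * log 2 P}"
      by (intro closed_Collect_le continuous_intros)
    then have "closure {x. achievable TYPE('m) \<mu> P x} \<subseteq> {x :: real ^ 'k. x $ i + x $ j \<le> c + (real CARD('m) + e) * log 2 P}"
      using c[OF that] by (intro closure_minimal) auto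
    then show ?thesis using R[of P] that unfolding capacity_region_def by auto
  qed
  have "((\<lambda>P. R P $ i / log 2 P + R P $ j / log 2 P) \<longlongrightarrow> d $ i + d $ j) at_top"
    by (intro tendsto_add lim)
  moreover have "((\<lambda>P. c / log 2 P + (real CARD('m) + e)) \<longlongrightarrow> 0 + (real CARD('m) + e)) at_top"
  proof (intro tendsto_add tendsto_const)
    have "((\<lambda>P. c * ln 2 / ln P) \<longlongrightarrow> 0) at_top"
      by (intro real_tendsto_divide_at_top[OF tendsto_const] ln_at_top)
    then show "((\<lambda>P. c / log 2 P) \<longlongrightarrow> 0) at_top" by (simp add: log_def)
  qed
  moreover have "\<forall>\<^sub>F P in at_top. R P $ i / log 2 P + R P $ j / log 2 P \<le> c / log 2 P + (real CARD('m) + e)"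
    using eventually_gt_at_top[of 1]
  proof eventually_elim
    case (elim P)
    then have "0 < log 2 P" by simp
    then have "(R P $ i + R P $ j) / log 2 P \<le> (c + (real CARD('m) + e) * log 2 P) / log 2 P"
      using cap[of P] elim by (intro divide_right_mono) auto
    then show ?case using \<open>0 < log 2 P\<close> by (simp add: add_divide_distrib)
  qed
  ultimately have "d $ i + d $ j \<le> 0 + (real CARD('m) + e)"
    by (intro tendsto_le[of at_top]) auto
  then show "d $ i + d $ j \<le> real CARD('m) + e" by simp
qed

end

section \<open>Symbols, cells and slots\<close>

text \<open>A square grid of spacing \<open>a\<close> on each antenna, as in quadrature amplitude
  modulation. It is anchored at the origin instead of centred, which affects the power by a constant
  factor only.\<close>

definition symbol :: "real \<Rightarrow> ('m::finite \<Rightarrow> nat \<times> nat) \<Rightarrow> complex ^ 'm" where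
  "symbol a u = (\<chi> i. complex_of_real a * Complex (real (fst (u i))) (real (snd (u i))))"

abbreviation alphabet :: "nat \<Rightarrow> ('m::finite \<Rightarrow> nat \<times> nat) set" where
  "alphabet Q \<equiv> UNIV \<rightarrow>\<^sub>E {..<Q} \<times> {..<Q}"

lemma card_alphabet: "card (alphabet Q :: ('m::finite \<Rightarrow> nat \<times> nat) set) = (Q * Q) ^ CARD('m)"
  by (simp add: card_PiE)

lemma norm_symbol_square_le:
  fixes u :: "'m::finite \<Rightarrow> nat \<times> nat"
  assumes "u \<in> alphabet Q"
  shows "(norm (symbol a u))\<^sup>2 \<le> 2 * real CARD('m) * (a * real Q)\<^sup>2"
proof -
  have "(norm (symbol a u))\<^sup>2 = (\<Sum>i\<in>UNIV. (cmod (symbol a u $ i))\<^sup>2)"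
    by (simp add: norm_vec_def L2_set_def real_sqrt_pow2 sum_nonneg)
  also have "\<dots> \<le> (\<Sum>i\<in>(UNIV::'m set). 2 * (a * real Q)\<^sup>2)"
  proof (intro sum_mono)
    fix i
    have "fst (u i) < Q" "snd (u i) < Q" using assms by (auto simp: PiE_def Pi_def mem_Times_iff)
    then have "(real (fst (u i)))\<^sup>2 \<le> (real Q)\<^sup>2" "(real (snd (u i)))\<^sup>2 \<le> (real Q)\<^sup>2"
      by (auto intro!: power_mono)
    then have "a\<^sup>2 * ((real (fst (u i)))\<^sup>2 + (real (snd (u i)))\<^sup>2) \<le> a\<^sup>2 * ((real Q)\<^sup>2 + (real Q)\<^sup>2)"
      by (intro mult_left_mono add_mono) auto
    then show "(cmod (symbol a u $ i))\<^sup>2 \<le> 2 * (a * real Q)\<^sup>2"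
      by (simp add: symbol_def norm_mult power_mult_distrib cmod_power2)
  qed
  finally show ?thesis by (simp add: mult_ac)
qed

lemma norm_symbol_diff_ge:
  assumes "u \<noteq> u'" "0 \<le> a"
  shows "a \<le> norm (symbol a u - symbol a u')"
proof -
  obtain i where i: "u i \<noteq> u' i" using assms(1) by auto
  let ?x = "real (fst (u i)) - real (fst (u' i))" and ?y = "real (snd (u i)) - real (snd (u' i))"
  have "1 \<le> \<bar>?x\<bar> \<or> 1 \<le> \<bar>?y\<bar>" using i by (auto simp: prod_eq_iff)
  then have "1 \<le> cmod (Complex ?x ?y)"
    using abs_Re_le_cmod[of "Complex ?x ?y"] abs_Im_le_cmod[of "Complex ?x ?y"] by auto
  then have "a * 1 \<le> a * cmod (Complex ?x ?y)" using assms(2) by (rule mult_left_mono)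
  also have "\<dots> = cmod ((symbol a u - symbol a u') $ i)"
    using assms(2) by (simp add: symbol_def norm_mult right_diff_distrib[symmetric] complex_diff)
  also have "\<dots> \<le> norm (symbol a u - symbol a u')" by (rule Finite_Cartesian_Product.norm_nth_le)
  finally show ?thesis by simp
qed

text \<open>Squares of side \<open>\<epsilon>\<close>. Clamping makes the range finite on all
  complex numbers, so that a pairing exists for every realisation and not merely almost surely; with
  \<open>B\<close> large enough it does not alter gains within the almost sure bound.\<close>

definition clamp_cell :: "real \<Rightarrow> int \<Rightarrow> complex \<Rightarrow> int \<times> int" where
  "clamp_cell \<epsilon> B x = (max (- B) (min B \<lfloor>Re x / \<epsilon>\<rfloor>), max (- B) (min B \<lfloor>Im x / \<epsilon>\<rfloor>))"

lemma clamp_cell_eq_imp_near: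
  assumes \<epsilon>: "0 < \<epsilon>" and B: "g / \<epsilon> + 1 \<le> real_of_int B" and g: "cmod x \<le> g" "cmod y \<le> g"
    and eq: "clamp_cell \<epsilon> B x = clamp_cell \<epsilon> B y"
  shows "cmod (x - y) \<le> 2 * \<epsilon>"
proof -
  \<comment> \<open>The extra 1 in the bound on \<open>B\<close> covers rounding down, since the
    floor of a negative number can be larger in size than the number itself.\<close>
  have in_range: "max (- B) (min B \<lfloor>r / \<epsilon>\<rfloor>) = \<lfloor>r / \<epsilon>\<rfloor>" if "\<bar>r\<bar> \<le> g" for r
  proof -
    have "\<bar>r / \<epsilon>\<bar> \<le> g / \<epsilon>" using that \<epsilon> by (simp add: abs_divide divide_right_mono)
    then have "r / \<epsilon> \<le> real_of_int B - 1" "- (real_of_int B - 1) \<le> r / \<epsilon>" using B by linarith+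
    then have "\<lfloor>r / \<epsilon>\<rfloor> \<le> B" "- B \<le> \<lfloor>r / \<epsilon>\<rfloor>" by linarith+
    then show ?thesis by simp
  qed
  have near: "\<bar>r - r'\<bar> \<le> \<epsilon>" if "\<lfloor>r / \<epsilon>\<rfloor> = \<lfloor>r' / \<epsilon>\<rfloor>" for r r'
  proof -
    have "\<bar>r / \<epsilon> - r' / \<epsilon>\<bar> \<le> 1" using that by linarith
    then have "\<bar>(r - r') / \<epsilon>\<bar> \<le> 1" by (simp add: diff_divide_distrib)
    then show ?thesis using \<epsilon> by (simp add: abs_divide)
  qed
  have "\<bar>Re x\<bar> \<le> g" "\<bar>Im x\<bar> \<le> g" "\<bar>Re y\<bar> \<le> g" "\<bar>Im y\<bar> \<le> g"
    using g abs_Re_le_cmod abs_Im_le_cmod order_trans by blast+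
  then have "\<bar>Re x - Re y\<bar> \<le> \<epsilon>" "\<bar>Im x - Im y\<bar> \<le> \<epsilon>"
    using eq near by (auto simp: clamp_cell_def in_range)
  then show ?thesis using cmod_le[of "x - y"] by simp
qed

lemma clamp_cell_range: "0 \<le> B \<Longrightarrow> clamp_cell \<epsilon> B x \<in> {- B..B} \<times> {- B..B}"
  by (auto simp: clamp_cell_def)

lemma measurable_clamp_cell [measurable]: "clamp_cell \<epsilon> B \<in> borel \<rightarrow>\<^sub>M count_space UNIV"
proof -
  have 1: "(\<lambda>x. max (- B) (min B \<lfloor>Re x / \<epsilon>\<rfloor>)) \<in> borel \<rightarrow>\<^sub>M count_space UNIV" by measurable
  have 2: "(\<lambda>x. max (- B) (min B \<lfloor>Im x / \<epsilon>\<rfloor>)) \<in> borel \<rightarrow>\<^sub>M count_space UNIV" by measurable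
  have "clamp_cell \<epsilon> B -` {c} \<inter> space borel \<in> sets borel" for c
  proof -
    have "clamp_cell \<epsilon> B -` {c} \<inter> space borel =
      ((\<lambda>x. max (- B) (min B \<lfloor>Re x / \<epsilon>\<rfloor>)) -` {fst c} \<inter> space borel) \<inter>
      ((\<lambda>x. max (- B) (min B \<lfloor>Im x / \<epsilon>\<rfloor>)) -` {snd c} \<inter> space borel)"
      by (auto simp: clamp_cell_def prod_eq_iff)
    also have "\<dots> \<in> sets borel" using measurable_sets[OF 1] measurable_sets[OF 2] by auto
    finally show ?thesis .
  qed
  then show ?thesis by (subst measurable_count_space_eq2_countable) auto
qed

lemma (in prob_space) ex_prob_gt_le:
  fixes X :: "'a \<Rightarrow> real"
  assumes [measurable]: "X \<in> borel_measurable M" and "0 < p"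
  shows "\<exists>\<rho>\<ge>c. prob {x \<in> space M. \<rho> < X x} \<le> p"
proof -
  define A where "A = (\<lambda>n. {x \<in> space M. real n < X x})"
  have "(\<lambda>n. prob (A n)) \<longlonglongrightarrow> prob (\<Inter>n. A n)"
    by (rule finite_Lim_measure_decseq) (auto simp: A_def decseq_def)
  moreover have "(\<Inter>n. A n) = {}"
  proof -
    have "\<exists>n. \<not> real n < X x" for x using real_arch_simple[of "X x"] by (auto simp: not_less)
    then show ?thesis by (auto simp: A_def)
  qed
  ultimately have "(\<lambda>n. prob (A n)) \<longlonglongrightarrow> 0" by simp
  then have "eventually (\<lambda>n. prob (A n) < p) sequentially" using \<open>0 < p\<close> by (rule order_tendstoD(2))
  moreover obtain n0 where "c \<le> real n0" using real_arch_simple by blast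
  then have "eventually (\<lambda>n. c \<le> real n) sequentially"
    by (intro eventually_sequentiallyI[of n0]) (meson of_nat_mono order_trans)
  ultimately have "eventually (\<lambda>n. prob (A n) < p \<and> c \<le> real n) sequentially" by eventually_elim auto
  then obtain n where "prob (A n) < p" "c \<le> real n" using eventually_happens by fastforce
  then show ?thesis unfolding A_def by (intro exI[of _ "real n"]) auto
qed

text \<open>The effective channel of a slot: for \<open>b = 1\<close> the difference of the matrices at two paired
  times, for \<open>b = 0\<close> the matrix at a single time.\<close>

definition slot_matrix :: "complex \<Rightarrow> (bool \<times> 'm \<times> 'm \<Rightarrow> complex) \<Rightarrow> complex ^ 'm ^ 'm" where
  "slot_matrix b x = (\<chi> \<alpha> \<beta>. x (True, \<alpha>, \<beta>) - b * x (False, \<alpha>, \<beta>))"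

definition slot_noise :: "complex \<Rightarrow> (bool \<times> 'm \<Rightarrow> complex) \<Rightarrow> complex ^ 'm" where
  "slot_noise b x = (\<chi> \<alpha>. x (True, \<alpha>) - b * x (False, \<alpha>))"

text \<open>A slot with coefficient 0 uses one time only; dropping the second copy keeps the
  coordinates read by a slot distinct.\<close>

definition slot_index :: "complex \<Rightarrow> (bool \<times> 'i) set" where
  "slot_index b = (if b = 0 then {True} \<times> UNIV else UNIV)"

lemma measurable_slot_component:
  assumes "sets \<nu> = sets borel"
  shows "(\<lambda>x. b * x (False, r)) \<in> borel_measurable (PiM (slot_index b) (\<lambda>_. \<nu>))"
    "(\<lambda>x. x (True, r)) \<in> borel_measurable (PiM (slot_index b) (\<lambda>_. \<nu>))"
proof -
  have c: "(\<lambda>x. x i) \<in> borel_measurable (PiM (slot_index b) (\<lambda>_. \<nu>))" if "i \<in> slot_index b" for i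
    using that by (subst measurable_cong_sets[OF refl assms[symmetric]]) (rule measurable_component_singleton)
  show "(\<lambda>x. x (True, r)) \<in> borel_measurable (PiM (slot_index b) (\<lambda>_. \<nu>))"
    by (rule c) (simp add: slot_index_def)
  show "(\<lambda>x. b * x (False, r)) \<in> borel_measurable (PiM (slot_index b) (\<lambda>_. \<nu>))"
    using c[of "(False, r)"] by (cases "b = 0") (auto simp: slot_index_def)
qed

lemma measurable_slot_matrix:
  fixes b :: complex
  assumes "sets \<nu> = sets borel"
  shows "(slot_matrix b :: (bool \<times> 'm::finite \<times> 'm \<Rightarrow> complex) \<Rightarrow> _) \<in> borel_measurable (PiM (slot_index b) (\<lambda>_. \<nu>))"
  unfolding slot_matrix_def
  by (intro borel_measurable_vec_lambda borel_measurable_diff measurable_slot_component assms)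

lemma measurable_slot_noise:
  fixes b :: complex
  assumes "sets \<nu> = sets borel"
  shows "(slot_noise b :: (bool \<times> 'm::finite \<Rightarrow> complex) \<Rightarrow> _) \<in> borel_measurable (PiM (slot_index b) (\<lambda>_. \<nu>))"
  unfolding slot_noise_def
  by (intro borel_measurable_vec_lambda borel_measurable_diff measurable_slot_component assms)

text \<open>The witness is the identity at the first time and 0 at the second, which makes the slot
  matrix the identity whatever \<open>b\<close> is. So subtracting an independent matrix does not
  destroy the direct channel.\<close>

lemma AE_det_slot_matrix_nonzero:
  fixes b :: complex
  assumes \<mu>: "prob_space \<mu>" "sets \<mu> = sets borel" "\<And>x. measure \<mu> {x} = 0"
  shows "AE x in PiM (slot_index b) (\<lambda>_. \<mu>). det (slot_matrix b x :: complex ^ 'm ^ 'm) \<noteq> 0"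
proof (rule AE_PiM_separately_affine_nonzero[OF \<mu>,
      where ?x0.0 = "\<lambda>r\<in>slot_index b. if fst r \<and> fst (snd r) = snd (snd r) then 1 else 0"])
  show "(\<lambda>x. det (slot_matrix b x :: complex ^ 'm ^ 'm)) \<in> borel_measurable (PiM (slot_index b) (\<lambda>_. \<mu>))"
    by (rule measurable_compose[OF measurable_slot_matrix[OF \<mu>(2)] det_measurable])
  show "\<exists>c d. \<forall>v. det (slot_matrix b (x(i := v)) :: complex ^ 'm ^ 'm) = c + d * v" for x i
  proof -
    obtain s p q where i: "i = (s, p, q)" by (cases i)
    obtain c d where cd: "\<And>v. det (\<chi> \<alpha> \<beta>. if \<alpha> = p \<and> \<beta> = q then v else slot_matrix b x $ \<alpha> $ \<beta>) = c + d * v"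
      using det_affine_in_entry[of p q "slot_matrix b x"] by blast
    show ?thesis
    proof (cases s)
      case True
      have "slot_matrix b (x(i := v))
        = (\<chi> \<alpha> \<beta>. if \<alpha> = p \<and> \<beta> = q then v - b * x (False, p, q) else slot_matrix b x $ \<alpha> $ \<beta>)" for v
        using True by (auto simp: vec_eq_iff i slot_matrix_def)
      then have "det (slot_matrix b (x(i := v))) = (c - d * b * x (False, p, q)) + d * v" for v
        by (simp only: cd) (simp add: algebra_simps)
      then show ?thesis by blast
    next
      case False
      have "slot_matrix b (x(i := v))
        = (\<chi> \<alpha> \<beta>. if \<alpha> = p \<and> \<beta> = q then x (True, p, q) - b * v else slot_matrix b x $ \<alpha> $ \<beta>)" for v
        using False by (auto simp: vec_eq_iff i slot_matrix_def)
      then have "det (slot_matrix b (x(i := v))) = (c + d * x (True, p, q)) + (- d * b) * v" for v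
        by (simp only: cd) (simp add: algebra_simps)
      then show ?thesis by blast
    qed
  qed
  have "slot_matrix b (\<lambda>r\<in>slot_index b. if fst r \<and> fst (snd r) = snd (snd r) then 1 else 0) = (mat 1 :: complex ^ 'm ^ 'm)"
    by (auto simp: vec_eq_iff mat_def slot_matrix_def slot_index_def)
  then show "det (slot_matrix b (\<lambda>r\<in>slot_index b. if fst r \<and> fst (snd r) = snd (snd r) then 1 else 0) :: complex ^ 'm ^ 'm) \<noteq> 0"
    by (simp only: det_I) simp
qed (auto simp: slot_index_def)

text \<open>There are only two kinds of slot, paired and single, so the smaller
  \<open>\<eta>\<close> and the larger \<open>\<rho>\<close> serve both. They depend on
  \<open>p\<close> but not on the power.\<close>

lemma (in fading_channel) ex_slot_thresholds:
  assumes "0 < p"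
  shows "\<exists>\<eta>>0. \<exists>\<rho>\<ge>0. \<forall>b\<in>{0, 1}.
    measure (PiM (slot_index b) (\<lambda>_. \<mu>)) {x \<in> space (PiM (slot_index b) (\<lambda>_. \<mu>)).
      \<not> bounded_below \<eta> (slot_matrix b x :: complex ^ 'm ^ 'm)} \<le> p \<and>
    measure (PiM (slot_index b) (\<lambda>_. std_complex_normal)) {x \<in> space (PiM (slot_index b) (\<lambda>_. std_complex_normal)).
      \<rho> < norm (slot_noise b x :: complex ^ 'm)} \<le> p"
proof -
  let ?G = "\<lambda>b. PiM (slot_index b :: (bool \<times> 'm \<times> 'm) set) (\<lambda>_. \<mu>)"
  let ?N = "\<lambda>b. PiM (slot_index b :: (bool \<times> 'm) set) (\<lambda>_. std_complex_normal)"
  interpret G: prob_space "?G b" for b by (rule prob_space_PiM) (rule prob_space_axioms)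
  interpret N: prob_space "?N b" for b by (rule prob_space_PiM) (rule prob_space_std_complex_normal)
  have "\<exists>\<eta>>0. G.prob b {x \<in> space (?G b). \<not> bounded_below \<eta> (slot_matrix b x :: complex ^ 'm ^ 'm)} \<le> p" for b
    by (intro G.prob_not_bounded_below_le measurable_slot_matrix AE_det_slot_matrix_nonzero
        prob_space_axioms sets_gain_law nonatomic assms)
  then have "\<forall>b. \<exists>\<eta>. 0 < \<eta> \<and> G.prob b {x \<in> space (?G b). \<not> bounded_below \<eta> (slot_matrix b x :: complex ^ 'm ^ 'm)} \<le> p"
    by blast
  from choice[OF this] obtain e where e: "\<And>b. 0 < e b"
    "\<And>b. G.prob b {x \<in> space (?G b). \<not> bounded_below (e b) (slot_matrix b x :: complex ^ 'm ^ 'm)} \<le> p" by blast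
  have nm: "(\<lambda>x. norm (slot_noise b x :: complex ^ 'm)) \<in> borel_measurable (?N b)" for b
    by (rule measurable_compose[OF measurable_slot_noise borel_measurable_norm]) simp
  have "\<exists>\<rho>\<ge>0. N.prob b {x \<in> space (?N b). \<rho> < norm (slot_noise b x :: complex ^ 'm)} \<le> p" for b
    by (rule N.ex_prob_gt_le[OF nm assms])
  then have "\<forall>b. \<exists>\<rho>. 0 \<le> \<rho> \<and> N.prob b {x \<in> space (?N b). \<rho> < norm (slot_noise b x :: complex ^ 'm)} \<le> p"
    by blast
  from choice[OF this] obtain r where r: "\<And>b. 0 \<le> r b"
    "\<And>b. N.prob b {x \<in> space (?N b). r b < norm (slot_noise b x :: complex ^ 'm)} \<le> p" by blast
  define \<eta> where "\<eta> = min (e 0) (e 1)"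
  define \<rho> where "\<rho> = max (r 0) (r 1)"
  have pos: "0 < \<eta>" "0 \<le> \<rho>" using e(1) r(1) by (auto simp: \<eta>_def \<rho>_def le_max_iff_disj)
  show ?thesis
  proof (rule exI[of _ \<eta>], rule conjI[OF pos(1)], rule exI[of _ \<rho>], rule conjI[OF pos(2)], intro ballI conjI)
    fix b :: complex assume "b \<in> {0, 1}"
    then have eb: "\<eta> \<le> e b" and rb: "r b \<le> \<rho>" by (auto simp: \<eta>_def \<rho>_def)
    have "G.prob b {x \<in> space (?G b). \<not> bounded_below \<eta> (slot_matrix b x :: complex ^ 'm ^ 'm)}
      \<le> G.prob b {x \<in> space (?G b). \<not> bounded_below (e b) (slot_matrix b x :: complex ^ 'm ^ 'm)}"
    proof (rule G.finite_measure_mono)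
      have [measurable]: "slot_matrix b \<in> borel_measurable (?G b)" by (rule measurable_slot_matrix) simp
      show "{x \<in> space (?G b). \<not> bounded_below (e b) (slot_matrix b x :: complex ^ 'm ^ 'm)} \<in> G.events b" by measurable
    qed (use bounded_below_mono[OF _ eb] in auto)
    then show "G.prob b {x \<in> space (?G b). \<not> bounded_below \<eta> (slot_matrix b x :: complex ^ 'm ^ 'm)} \<le> p"
      using e(2) order_trans by blast
    have "N.prob b {x \<in> space (?N b). \<rho> < norm (slot_noise b x :: complex ^ 'm)}
      \<le> N.prob b {x \<in> space (?N b). r b < norm (slot_noise b x :: complex ^ 'm)}"
    proof (rule N.finite_measure_mono)
      note [measurable] = nm
      show "{x \<in> space (?N b). r b < norm (slot_noise b x :: complex ^ 'm)} \<in> N.events b" by measurable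
    qed (use rb in auto)
    then show "N.prob b {x \<in> space (?N b). \<rho> < norm (slot_noise b x :: complex ^ 'm)} \<le> p"
      using r(2) order_trans by blast
  qed
qed

section \<open>Alignment over paired times\<close>

text \<open>\<open>n1\<close> is the number of times reserved for user \<open>k0\<close>, and
  \<open>D\<close> is the distance of the outer code. \<open>residual\<close> limits the
  interference surviving the subtraction to 1. \<open>separation\<close> keeps the images of two
  symbols in a good slot further apart than two error radii \<open>\<rho> + 1\<close>.\<close>

locale alignment_scheme = fading_channel \<mu> gmax for \<mu> :: "complex measure" and gmax :: real +
  fixes P a \<epsilon> \<eta> \<rho> :: real and Q n n1 D cell_count :: nat and B :: int
    and k0 :: "'k::finite" and L :: "'k \<Rightarrow> nat"
    and cw :: "'k \<Rightarrow> nat \<Rightarrow> nat \<Rightarrow> 'm::finite \<Rightarrow> nat \<times> nat"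
  assumes a_nonneg: "0 \<le> a" and power: "2 * real CARD('m) * (a * real Q)\<^sup>2 \<le> P"
    and eps_pos: "0 < \<epsilon>"
    and residual: "real CARD('k) * (real CARD('m) * real CARD('m) * (2 * \<epsilon>) * sqrt P) \<le> 1"
    and B: "gmax / \<epsilon> + 1 \<le> real_of_int B" "0 \<le> B"
    and cell_count: "cell_count = card (UNIV \<rightarrow>\<^sub>E {- B..B} \<times> {- B..B} :: ('k \<times> 'k \<times> 'm \<times> 'm \<Rightarrow> int \<times> int) set)"
    and eta_pos: "0 < \<eta>" and separation: "2 * (\<rho> + 1) < \<eta> * a"
    and n1: "n1 \<le> n"
    and L_pos: "\<And>k. 0 < L k"
begin

text \<open>Direct gains get a dummy cell: the pairing must not look at them, so that they stay
  independent of it.\<close>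

definition cells :: "('k, 'm) gains \<Rightarrow> nat \<Rightarrow> 'k \<times> 'k \<times> 'm \<times> 'm \<Rightarrow> int \<times> int" where
  "cells h t = (\<lambda>(j, k, \<alpha>, \<beta>). if j = k then (0, 0) else clamp_cell \<epsilon> B (h (t, j, k, \<alpha>, \<beta>)))"

text \<open>Fixed in advance and equal for all realisations, so that the length of the outer code is
  deterministic.\<close>

definition pair_count :: nat where
  "pair_count = (n - n1 - cell_count) div 2"

definition valid :: "(nat \<times> nat) list \<Rightarrow> bool" where
  "valid ps \<longleftrightarrow> length ps = pair_count \<and> distinct (map fst ps @ map snd ps) \<and> set (map fst ps @ map snd ps) \<subseteq> {n1..<n}"

definition history :: "('k, 'm) gains \<Rightarrow> ('k \<times> 'k \<times> 'm \<times> 'm \<Rightarrow> int \<times> int) list" where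
  "history h = map (cells h) [0..<n]"

text \<open>The choice is made from the history and not from \<open>h\<close>, so equal cells give
  equal pairings. As histories are discrete, the choice is also automatically measurable.\<close>

definition schedule :: "('k \<times> 'k \<times> 'm \<times> 'm \<Rightarrow> int \<times> int) list \<Rightarrow> (nat \<times> nat) list" where
  "schedule c = (SOME ps. valid ps \<and> (\<forall>(s, t) \<in> set ps. c ! s = c ! t))"

definition pairing :: "('k, 'm) gains \<Rightarrow> (nat \<times> nat) list" where
  "pairing h = schedule (history h)"

lemma pairing: "valid (pairing h)" "(s, t) \<in> set (pairing h) \<Longrightarrow> cells h s = cells h t"
proof -
  have "\<exists>ps. length ps = (card {n1..<n} - cell_count) div 2 \<and> distinct (map fst ps @ map snd ps)
    \<and> set (map fst ps @ map snd ps) \<subseteq> {n1..<n} \<and> (\<forall>(s, t) \<in> set ps. history h ! s = history h ! t)"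
    unfolding cell_count
  proof (rule exists_pairing)
    show "(!) (history h) ` {n1..<n} \<subseteq> (UNIV \<rightarrow>\<^sub>E {- B..B} \<times> {- B..B})"
      using B(2) clamp_cell_range[OF B(2)] by (auto simp: history_def cells_def)
  qed (auto intro: finite_PiE)
  then have "\<exists>ps. valid ps \<and> (\<forall>(s, t) \<in> set ps. history h ! s = history h ! t)"
    by (simp add: valid_def pair_count_def)
  then have p: "valid (pairing h) \<and> (\<forall>(s, t) \<in> set (pairing h). history h ! s = history h ! t)"
    unfolding pairing_def schedule_def by (rule someI_ex)
  then show "valid (pairing h)" by blast
  assume st: "(s, t) \<in> set (pairing h)"
  then have "s \<in> set (map fst (pairing h))" "t \<in> set (map snd (pairing h))" by force+
  then have "s < n" "t < n" using p by (auto simp: valid_def)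
  then show "cells h s = cells h t" using p st by (auto simp: history_def)
qed

lemma measurable_pairing: "pairing \<in> channel_space \<mu> n \<rightarrow>\<^sub>M count_space (Collect valid)"
proof -
  have cm: "(\<lambda>h. cells h t r) \<in> channel_space \<mu> n \<rightarrow>\<^sub>M count_space UNIV" if t: "t < n" for t r
  proof -
    obtain j k \<alpha> \<beta> where r: "r = (j, k, \<alpha>, \<beta>)" by (cases r)
    show ?thesis
    proof (cases "j = k")
      case True then show ?thesis by (simp add: cells_def r)
    next
      case False
      have "(\<lambda>h. clamp_cell \<epsilon> B (h (t, j, k, \<alpha>, \<beta>))) \<in> channel_space \<mu> n \<rightarrow>\<^sub>M count_space UNIV"
        by (rule measurable_compose[OF measurable_gain[OF t] measurable_clamp_cell])
      then show ?thesis using False by (simp add: cells_def r)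
    qed
  qed
  have "history \<in> channel_space \<mu> n \<rightarrow>\<^sub>M count_space UNIV"
  proof (subst measurable_count_space_eq2_countable, intro conjI ballI)
    fix c
    let ?S = "{h \<in> space (channel_space \<mu> n). \<forall>t\<in>{..<n}. \<forall>r\<in>UNIV. cells h t r = (c ! t) r}"
    have "?S \<in> sets (channel_space \<mu> n)"
    proof (intro sets.sets_Collect_finite_All finite)
      fix t r assume "t \<in> {..<n}"
      then have "(\<lambda>h. cells h t r) -` {(c ! t) r} \<inter> space (channel_space \<mu> n) \<in> sets (channel_space \<mu> n)"
        by (intro measurable_sets[OF cm]) auto
      then show "{h \<in> space (channel_space \<mu> n). cells h t r = (c ! t) r} \<in> sets (channel_space \<mu> n)"
        by (simp add: vimage_def Int_def conj_commute)
    qed simp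
    moreover have "history -` {c} \<inter> space (channel_space \<mu> n) = (if length c = n then ?S else {})"
    proof -
      have "history h = c \<longleftrightarrow> length c = n \<and> (\<forall>t<n. \<forall>r. cells h t r = (c ! t) r)" for h
        unfolding history_def list_eq_iff_nth_eq fun_eq_iff by auto
      then show ?thesis by auto
    qed
    ultimately show "history -` {c} \<inter> space (channel_space \<mu> n) \<in> sets (channel_space \<mu> n)" by simp
  qed simp
  then have "pairing \<in> channel_space \<mu> n \<rightarrow>\<^sub>M count_space UNIV"
    unfolding pairing_def by (rule measurable_compose) simp
  then show ?thesis
    using pairing(1) by (subst measurable_count_space_eq_countable) (auto intro: measurable_sets)
qed

text \<open>The first \<open>pair_count\<close> slots are the paired times; the remaining ones, which only user \<open>k0\<close>
  has, are the times before \<open>n1\<close>.\<close>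

definition slot_count :: "'k \<Rightarrow> nat" where
  "slot_count k = pair_count + (if k = k0 then n1 else 0)"

definition slot_time :: "(nat \<times> nat) list \<Rightarrow> nat \<Rightarrow> bool \<Rightarrow> nat" where
  "slot_time ps s b = (if s < pair_count then (if b then fst (ps ! s) else snd (ps ! s)) else s - pair_count)"

definition slot_coeff :: "nat \<Rightarrow> complex" where
  "slot_coeff s = (if s < pair_count then 1 else 0)"

lemma slot_time_bounds:
  assumes "valid ps" "s < slot_count k"
  shows "slot_time ps s b < n" "s < pair_count \<Longrightarrow> n1 \<le> slot_time ps s b" "\<not> s < pair_count \<Longrightarrow> slot_time ps s b < n1"
proof -
  have "fst (ps ! s) \<in> {n1..<n} \<and> snd (ps ! s) \<in> {n1..<n}" if "s < pair_count"
  proof -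
    have "ps ! s \<in> set ps" using that assms(1) by (auto simp: valid_def)
    then show ?thesis using assms(1) by (auto simp: valid_def)
  qed
  then show "slot_time ps s b < n" "s < pair_count \<Longrightarrow> n1 \<le> slot_time ps s b" "\<not> s < pair_count \<Longrightarrow> slot_time ps s b < n1"
    using assms(2) n1 by (auto simp: slot_time_def slot_count_def split: if_splits)
qed

text \<open>The times of the pairs are the entries of one distinct list, first times at position
  \<open>s\<close> and second times at \<open>pair_count + s\<close>, and all are at least
  \<open>n1\<close>; single slots lie below \<open>n1\<close>. In a single slot both values of
  \<open>b\<close> name the same time, hence the condition on the second claim.\<close>

lemma slot_time_inj:
  assumes v: "valid ps" and s: "s < slot_count k" "s' < slot_count k'" and eq: "slot_time ps s b = slot_time ps s' b'"
  shows "s = s'" "s < pair_count \<Longrightarrow> b = b'"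
proof -
  have d: "distinct (map fst ps @ map snd ps)" and len: "length ps = pair_count" using v by (auto simp: valid_def)
  have "s = s' \<and> (s < pair_count \<longrightarrow> b = b')"
  proof (cases "s < pair_count")
    case True
    have True': "s' < pair_count"
      using slot_time_bounds(2)[OF v s(1) True, of b] slot_time_bounds(3)[OF v s(2), of b'] eq by linarith
    let ?i = "\<lambda>s b. if b then s else pair_count + s"
    have nth: "(map fst ps @ map snd ps) ! ?i s b = slot_time ps s b" if "s < pair_count" for s b
      using that len by (auto simp: nth_append slot_time_def)
    have "?i s b = ?i s' b'"
      using nth_eq_iff_index_eq[OF d, of "?i s b" "?i s' b'"] True True' len nth[OF True, of b] nth[OF True', of b'] eq by auto
    then show ?thesis using True True' by (auto split: if_splits)
  next
    case False
    have "\<not> s' < pair_count"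
      using slot_time_bounds(3)[OF v s(1) False, of b] slot_time_bounds(2)[OF v s(2), of b'] eq by linarith
    then show ?thesis using False eq by (auto simp: slot_time_def)
  qed
  then show "s = s'" "s < pair_count \<Longrightarrow> b = b'" by auto
qed

text \<open>The slot is recovered from the time by \<open>THE\<close>, where uniqueness is
  \<open>slot_time_inj\<close>. At times outside the slots of the user nothing is sent.\<close>

definition signal :: "(nat \<times> nat) list \<Rightarrow> 'k \<Rightarrow> nat \<Rightarrow> nat \<Rightarrow> complex ^ 'm" where
  "signal ps k w t = (if \<exists>s<slot_count k. \<exists>b. t = slot_time ps s b
    then symbol a (cw k w (THE s. s < slot_count k \<and> (\<exists>b. t = slot_time ps s b))) else 0)"

definition encode :: "('k, 'm) encoders" where
  "encode k w h t = signal (pairing h) k w t"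

lemma signal_slot:
  assumes "valid ps" "s < slot_count k"
  shows "signal ps k w (slot_time ps s b) = symbol a (cw k w s)"
proof -
  have "(THE s'. s' < slot_count k \<and> (\<exists>b'. slot_time ps s b = slot_time ps s' b')) = s"
    by (rule the_equality) (use assms slot_time_inj(1)[OF assms(1)] in blast)+
  then show ?thesis using assms(2) unfolding signal_def by auto
qed

lemma signal_silent:
  assumes "valid ps" "k \<noteq> k0" "t < n1"
  shows "signal ps k w t = 0"
proof -
  have "t \<noteq> slot_time ps s b" if "s < slot_count k" for s b
  proof -
    have "s < pair_count" using that assms(2) by (simp add: slot_count_def)
    then show ?thesis using slot_time_bounds(2)[OF assms(1) that, of b] assms(3) by linarith
  qed
  then show ?thesis unfolding signal_def by auto
qed

definition slot_obs :: "(nat \<times> nat) list \<Rightarrow> nat \<Rightarrow> (nat \<Rightarrow> complex ^ 'm) \<Rightarrow> complex ^ 'm" where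
  "slot_obs ps s y = y (slot_time ps s True) - slot_coeff s *s y (slot_time ps s False)"

definition slot_gain :: "(nat \<times> nat) list \<Rightarrow> 'k \<Rightarrow> nat \<Rightarrow> ('k, 'm) gains \<Rightarrow> complex ^ 'm ^ 'm" where
  "slot_gain ps j s h = slot_matrix (slot_coeff s) (\<lambda>(b, \<alpha>, \<beta>). h (slot_time ps s b, j, j, \<alpha>, \<beta>))"

definition slot_pert :: "(nat \<times> nat) list \<Rightarrow> 'k \<Rightarrow> nat \<Rightarrow> ('k, 'm) noises \<Rightarrow> complex ^ 'm" where
  "slot_pert ps j s z = slot_noise (slot_coeff s) (\<lambda>(b, \<alpha>). z (slot_time ps s b, j, \<alpha>))"

text \<open>The radius \<open>\<rho> + 1\<close> is the tolerated noise plus the bound on the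
  surviving interference.\<close>

definition misfits :: "(nat \<times> nat) list \<Rightarrow> 'k \<Rightarrow> ('k, 'm) gains \<Rightarrow> (nat \<Rightarrow> complex ^ 'm) \<Rightarrow> nat \<Rightarrow> nat set" where
  "misfits ps j h y w = {s. s < slot_count j \<and>
    \<rho> + 1 < norm (slot_obs ps s y - slot_gain ps j s h *v symbol a (cw j w s))}"

text \<open>The implication makes the least element exist: it is \<open>L j\<close> if no message passes the test.\<close>

definition decode :: "('k, 'm) decoders" where
  "decode j h y = (LEAST w. w < L j \<longrightarrow> 2 * card (misfits (pairing h) j h y w) < D)"

lemma P_nonneg: "0 \<le> P"
  using power order_trans[OF _ power] by (meson mult_nonneg_nonneg of_nat_0_le_iff zero_le_numeral zero_le_power2)

end

text \<open>A second locale, since the conditions on the outer code refer to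
  \<open>slot_count\<close>.\<close>

locale alignment_code = alignment_scheme \<mu> gmax P a \<epsilon> \<eta> \<rho> Q n n1 D cell_count B k0 L cw
  for \<mu> gmax P a \<epsilon> \<eta> \<rho> Q n n1 D cell_count B and k0 :: "'k::finite" and L
    and cw :: "'k \<Rightarrow> nat \<Rightarrow> nat \<Rightarrow> 'm::finite \<Rightarrow> nat \<times> nat" +
  assumes cw_in: "\<And>k w s. w < L k \<Longrightarrow> s < slot_count k \<Longrightarrow> cw k w s \<in> alphabet Q"
    and cw_dist: "\<And>k w w'. w < L k \<Longrightarrow> w' < L k \<Longrightarrow> w \<noteq> w' \<Longrightarrow>
      D \<le> card {s. s < slot_count k \<and> cw k w s \<noteq> cw k w' s}"
begin

lemma norm_signal_square_le:
  assumes "valid ps" "w < L k"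
  shows "(norm (signal ps k w t))\<^sup>2 \<le> P"
proof (cases "\<exists>s<slot_count k. \<exists>b. t = slot_time ps s b")
  case True
  then obtain s b where s: "s < slot_count k" "t = slot_time ps s b" by blast
  have "(norm (symbol a (cw k w s)))\<^sup>2 \<le> P"
    using norm_symbol_square_le[OF cw_in[OF assms(2) s(1)], of a] power by linarith
  then show ?thesis using signal_slot[OF assms(1) s(1)] s(2) by simp
next
  case False
  then have "signal ps k w t = 0" unfolding signal_def by (rule if_not_P)
  then show ?thesis by (simp add: P_nonneg)
qed

text \<open>Both times of a pair carry the same symbols, so an interferer enters through the
  difference of two matrices from the same cells, with entries at most
  \<open>2 * \<epsilon>\<close>. In a single slot the receiver is \<open>k0\<close> and all other
  users are silent.\<close>

lemma slot_obs_error_le: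
  assumes bd: "\<And>t i. t < n \<Longrightarrow> cmod (h (t, i)) \<le> gmax" and w: "\<And>k. w k < L k" and s: "s < slot_count j"
  defines "ps \<equiv> pairing h"
  shows "norm (slot_obs ps s (received n encode j h w z) - slot_gain ps j s h *v symbol a (cw j (w j) s))
    \<le> norm (slot_pert ps j s z) + 1"
proof -
  have v: "valid ps" unfolding ps_def by (rule pairing)
  define t1 where "t1 = slot_time ps s True"
  define t2 where "t2 = slot_time ps s False"
  define H where "H = (\<lambda>k t. channel_matrix h j k t :: complex ^ 'm ^ 'm)"
  have t: "t1 < n" "t2 < n" unfolding t1_def t2_def by (intro slot_time_bounds(1)[OF v s])+
  let ?x = "symbol a (cw j (w j) s)"
  have rec: "received n encode j h w z t = (\<Sum>k\<in>UNIV. H k t *v signal ps k (w k) t) + noise_vector z j t" if "t < n" for t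
    using that by (simp add: received_def H_def encode_def ps_def)
  have xj: "signal ps j (w j) t1 = ?x" "signal ps j (w j) t2 = ?x"
    unfolding t1_def t2_def by (intro signal_slot v s)+
  have gain: "slot_gain ps j s h = H j t1 - (if s < pair_count then H j t2 else 0)"
    by (auto simp: slot_gain_def slot_matrix_def H_def channel_matrix_def t1_def t2_def slot_coeff_def vec_eq_iff)
  have pert: "slot_pert ps j s z = noise_vector z j t1 - (if s < pair_count then noise_vector z j t2 else 0)"
    by (auto simp: slot_pert_def slot_noise_def noise_vector_def t1_def t2_def slot_coeff_def vec_eq_iff)
  have split: "(\<Sum>k\<in>UNIV. f k) = f j + (\<Sum>k\<in>UNIV-{j}. f k)" for f :: "'k \<Rightarrow> complex ^ 'm"
    by (rule sum.remove) auto
  define rest where "rest = (\<Sum>k\<in>UNIV-{j}. H k t1 *v signal ps k (w k) t1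
    - (if s < pair_count then H k t2 *v signal ps k (w k) t2 else 0))"
  have e: "slot_obs ps s (received n encode j h w z) - slot_gain ps j s h *v ?x = rest + slot_pert ps j s z"
  proof (cases "s < pair_count")
    case True
    then show ?thesis
      unfolding slot_obs_def t1_def[symmetric] t2_def[symmetric] rec[OF t(1)] rec[OF t(2)] gain pert rest_def split
      by (simp add: slot_coeff_def xj matrix_vector_mult_diff_rdistrib sum_subtractf)
  next
    case False
    then show ?thesis
      unfolding slot_obs_def t1_def[symmetric] t2_def[symmetric] rec[OF t(1)] rec[OF t(2)] gain pert rest_def split
      by (simp add: slot_coeff_def xj)
  qed
  have "norm rest \<le> 1"
  proof (cases "s < pair_count")
    case True
    have "rest = (\<Sum>k\<in>UNIV-{j}. (H k t1 - H k t2) *v signal ps k (w k) t1)"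
    proof -
      have "signal ps k (w k) t2 = signal ps k (w k) t1" for k
      proof -
        have "s < slot_count k" using True by (simp add: slot_count_def)
        then show ?thesis unfolding t1_def t2_def by (simp add: signal_slot[OF v])
      qed
      then show ?thesis using True by (simp add: rest_def matrix_vector_mult_diff_rdistrib)
    qed
    also have "norm \<dots> \<le> (\<Sum>k\<in>UNIV-{j}. norm ((H k t1 - H k t2) *v signal ps k (w k) t1))" by (rule norm_sum)
    also have "\<dots> \<le> (\<Sum>k\<in>UNIV-{j}. real CARD('m) * real CARD('m) * (2 * \<epsilon>) * sqrt P)"
    proof (rule sum_mono)
      fix k assume k: "k \<in> UNIV - {j}"
      have "ps ! s \<in> set ps" using True v by (simp add: valid_def)
      then have "(t1, t2) \<in> set ps" using True by (simp add: t1_def t2_def slot_time_def)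
      then have cells: "cells h t1 = cells h t2" unfolding ps_def by (rule pairing(2))
      have "cmod ((H k t1 - H k t2) $ \<alpha> $ \<beta>) \<le> 2 * \<epsilon>" for \<alpha> \<beta>
      proof -
        have "clamp_cell \<epsilon> B (h (t1, j, k, \<alpha>, \<beta>)) = clamp_cell \<epsilon> B (h (t2, j, k, \<alpha>, \<beta>))"
          using fun_cong[OF cells, of "(j, k, \<alpha>, \<beta>)"] k by (simp add: cells_def)
        then have "cmod (h (t1, j, k, \<alpha>, \<beta>) - h (t2, j, k, \<alpha>, \<beta>)) \<le> 2 * \<epsilon>"
          by (intro clamp_cell_eq_imp_near[OF eps_pos B(1)] bd t)
        then show ?thesis by (simp add: H_def channel_matrix_def)
      qed
      then have "norm ((H k t1 - H k t2) *v signal ps k (w k) t1)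
        \<le> real CARD('m) * real CARD('m) * (2 * \<epsilon>) * norm (signal ps k (w k) t1)"
        by (rule norm_matrix_vector_mult_le)
      also have "\<dots> \<le> real CARD('m) * real CARD('m) * (2 * \<epsilon>) * sqrt P"
        using norm_signal_square_le[OF v w, of k t1] eps_pos
        by (intro mult_left_mono real_le_rsqrt mult_nonneg_nonneg) auto
      finally show "norm ((H k t1 - H k t2) *v signal ps k (w k) t1) \<le> real CARD('m) * real CARD('m) * (2 * \<epsilon>) * sqrt P" .
    qed
    also have "\<dots> \<le> real CARD('k) * (real CARD('m) * real CARD('m) * (2 * \<epsilon>) * sqrt P)"
    proof -
      have "card (UNIV - {j}) \<le> CARD('k)" by (rule card_mono) auto
      then show ?thesis unfolding sum_constant using eps_pos P_nonneg
        by (intro mult_right_mono) auto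
    qed
    also have "\<dots> \<le> 1" by (rule residual)
    finally show ?thesis .
  next
    case False
    then have j: "j = k0" using s by (auto simp: slot_count_def split: if_splits)
    have "t1 < n1" unfolding t1_def by (rule slot_time_bounds(3)[OF v s False])
    then have "rest = 0" using False j by (auto simp: rest_def signal_silent[OF v] intro!: sum.neutral)
    then show ?thesis by simp
  qed
  then show ?thesis unfolding e using norm_triangle_ineq[of rest "slot_pert ps j s z"] by linarith
qed

text \<open>Fewer than \<open>D / 2\<close> slots are bad. The true message misfits only in bad
  slots. A wrong one differs from it in at least \<open>D\<close> slots and misfits in all good ones
  among these, thus in more than \<open>D / 2\<close>. So only the true message passes the
  test.\<close>

lemma decode_correct:
  assumes bd: "\<And>t i. t < n \<Longrightarrow> cmod (h (t, i)) \<le> gmax" and w: "\<And>k. w k < L k"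
  defines "ps \<equiv> pairing h"
  assumes few: "2 * card ({s. s < slot_count j \<and> \<not> bounded_below \<eta> (slot_gain ps j s h)}
      \<union> {s. s < slot_count j \<and> \<rho> < norm (slot_pert ps j s z)}) < D"
  shows "decode j h (received n encode j h w z) = w j"
proof -
  let ?y = "received n encode j h w z"
  define bad where "bad = {s. s < slot_count j \<and> \<not> bounded_below \<eta> (slot_gain ps j s h)}
      \<union> {s. s < slot_count j \<and> \<rho> < norm (slot_pert ps j s z)}"
  have fin: "finite bad" by (simp add: bad_def)
  have few: "2 * card bad < D" using few by (simp add: bad_def)
  have fit: "norm (slot_obs ps s ?y - slot_gain ps j s h *v symbol a (cw j (w j) s)) \<le> \<rho> + 1"
    if "s < slot_count j" "s \<notin> bad" for s
    using slot_obs_error_le[where h=h and w=w and s=s and j=j and z=z, OF bd w that(1)] that by (auto simp: ps_def bad_def)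
  have sub: "misfits ps j h ?y (w j) \<subseteq> bad" using fit by (force simp: misfits_def)
  have good: "2 * card (misfits ps j h ?y (w j)) < D"
    using card_mono[OF fin sub] few by linarith
  have wrong: "\<not> 2 * card (misfits ps j h ?y w') < D" if w': "w' < L j" "w' \<noteq> w j" for w'
  proof -
    let ?diff = "{s. s < slot_count j \<and> cw j (w j) s \<noteq> cw j w' s}"
    have "?diff \<subseteq> misfits ps j h ?y w' \<union> bad"
    proof
      fix s assume "s \<in> ?diff"
      then have s: "s < slot_count j" "cw j (w j) s \<noteq> cw j w' s" by auto
      show "s \<in> misfits ps j h ?y w' \<union> bad"
      proof (cases "s \<in> bad")
        case False
        \<comment> \<open>In a good slot the images of the two symbols are at least
          \<open>\<eta> * a\<close> apart; one of them is within \<open>\<rho> + 1\<close> of the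
          observation, so the other is not.\<close>
        let ?G = "slot_gain ps j s h" and ?x = "symbol a (cw j (w j) s)" and ?x' = "symbol a (cw j w' s)"
        have "\<eta> * a \<le> \<eta> * norm (?x - ?x')"
          using eta_pos norm_symbol_diff_ge[OF s(2) a_nonneg] by simp
        also have "\<dots> \<le> norm (?G *v (?x - ?x'))" using False s(1) by (auto simp: bad_def bounded_below_def)
        also have "?G *v (?x - ?x') = (slot_obs ps s ?y - ?G *v ?x') - (slot_obs ps s ?y - ?G *v ?x)"
          by (simp add: matrix_vector_mult_diff_distrib)
        also have "norm \<dots> \<le> norm (slot_obs ps s ?y - ?G *v ?x') + norm (slot_obs ps s ?y - ?G *v ?x)"
          by (rule norm_triangle_ineq4)
        finally have "\<eta> * a \<le> norm (slot_obs ps s ?y - ?G *v ?x') + norm (slot_obs ps s ?y - ?G *v ?x)" .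
        moreover have "c < x" if "e \<le> x + y" "y \<le> c" "2 * c < e" for c e x y :: real using that by linarith
        ultimately have "\<rho> + 1 < norm (slot_obs ps s ?y - ?G *v ?x')" using fit[OF s(1) False] separation by blast
        then show ?thesis using s(1) by (simp add: misfits_def)
      qed simp
    qed
    then have "card ?diff \<le> card (misfits ps j h ?y w' \<union> bad)"
      by (intro card_mono finite_UnI fin) (auto simp: misfits_def)
    also have "\<dots> \<le> card (misfits ps j h ?y w') + card bad" by (rule card_Un_le)
    finally have "D \<le> card (misfits ps j h ?y w') + card bad"
      using cw_dist[OF w w'(1) w'(2)[symmetric]] by linarith
    then show ?thesis using few by linarith
  qed
  have "decode j h ?y = w j"
    unfolding decode_def ps_def[symmetric]
  proof (rule Least_equality)
    show "w j < L j \<longrightarrow> 2 * card (misfits ps j h ?y (w j)) < D" using good by simp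
    fix w' assume "w' < L j \<longrightarrow> 2 * card (misfits ps j h ?y w') < D"
    then show "w j \<le> w'" using wrong[of w'] w[of j] by (cases "w' = w j") (auto simp: not_less intro: less_imp_le)
  qed
  then show ?thesis .
qed

end

section \<open>Measurability and error probability of the alignment code\<close>

lemma pred_card_Collect:
  fixes N :: nat
  assumes "\<And>s. s < N \<Longrightarrow> Measurable.pred M (q s)"
  shows "Measurable.pred M (\<lambda>x. \<phi> (card {s. s < N \<and> q s x}))"
proof -
  \<comment> \<open>A condition on the cardinality is a finite disjunction over the possible values
    of the random set.\<close>
  have "Measurable.pred M (\<lambda>x. \<exists>S\<in>Pow {..<N}. \<phi> (card S) \<and> (\<forall>s\<in>{..<N}. s \<in> S \<longleftrightarrow> q s x))"
    using assms by (intro pred_intros_finite pred_intros_logic) (auto simp: Pow_def)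
  also have "(\<lambda>x. \<exists>S\<in>Pow {..<N}. \<phi> (card S) \<and> (\<forall>s\<in>{..<N}. s \<in> S \<longleftrightarrow> q s x)) = (\<lambda>x. \<phi> (card {s. s < N \<and> q s x}))"
  proof (intro ext iffI)
    fix x assume "\<exists>S\<in>Pow {..<N}. \<phi> (card S) \<and> (\<forall>s\<in>{..<N}. s \<in> S \<longleftrightarrow> q s x)"
    then obtain S where S: "S \<subseteq> {..<N}" "\<phi> (card S)" "\<forall>s\<in>{..<N}. s \<in> S \<longleftrightarrow> q s x" by auto
    then have "S = {s. s < N \<and> q s x}" by auto
    then show "\<phi> (card {s. s < N \<and> q s x})" using S(2) by simp
  next
    fix x assume "\<phi> (card {s. s < N \<and> q s x})"
    then show "\<exists>S\<in>Pow {..<N}. \<phi> (card S) \<and> (\<forall>s\<in>{..<N}. s \<in> S \<longleftrightarrow> q s x)"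
      by (intro bexI[of _ "{s. s < N \<and> q s x}"]) auto
  qed
  finally show ?thesis .
qed

lemma slot_matrix_restrict: "slot_matrix b (restrict x (slot_index b)) = slot_matrix b x"
  by (auto simp: slot_matrix_def slot_index_def vec_eq_iff)

lemma slot_noise_restrict: "slot_noise b (restrict x (slot_index b)) = slot_noise b x"
  by (auto simp: slot_noise_def slot_index_def vec_eq_iff)

context alignment_code
begin

lemma countable_valid: "countable (Collect valid)"
  by (rule countableI_type)

lemma measurable_slot_gain:
  assumes "valid ps" "s < slot_count j"
  shows "(\<lambda>h. slot_gain ps j s h) \<in> borel_measurable (channel_space \<mu> n)"
  unfolding slot_gain_def slot_matrix_def using slot_time_bounds(1)[OF assms]
  by (auto intro!: borel_measurable_vec_lambda borel_measurable_diff borel_measurable_times measurable_gain)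

lemma measurable_slot_pert:
  assumes "valid ps" "s < slot_count j"
  shows "(\<lambda>z. slot_pert ps j s z) \<in> borel_measurable (noise_space n)"
  unfolding slot_pert_def slot_noise_def using slot_time_bounds(1)[OF assms]
  by (auto intro!: borel_measurable_vec_lambda borel_measurable_diff borel_measurable_times measurable_noise)

lemma measurable_slot_obs:
  assumes "valid ps" "s < slot_count j"
  shows "(\<lambda>y. slot_obs ps s y) \<in> borel_measurable (PiM {..<n} (\<lambda>_. borel))"
proof -
  have [measurable]: "(\<lambda>y. y (slot_time ps s b)) \<in> borel_measurable (PiM {..<n} (\<lambda>_. borel :: (complex ^ 'm) measure))" for b
    using slot_time_bounds(1)[OF assms] by (intro measurable_component_singleton) auto
  show ?thesis unfolding slot_obs_def vector_scalar_mult_def by measurable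
qed

text \<open>For each fixed pairing the decision is measurable, and countably many pairings can be
  glued together.\<close>

lemma measurable_decode:
  "(\<lambda>(h, y). decode j h y) \<in> channel_space \<mu> n \<Otimes>\<^sub>M PiM {..<n} (\<lambda>_. borel) \<rightarrow>\<^sub>M count_space UNIV"
proof -
  let ?M = "channel_space \<mu> n \<Otimes>\<^sub>M PiM {..<n} (\<lambda>_. borel)"
  let ?D = "\<lambda>ps x. LEAST w. w < L j \<longrightarrow> 2 * card (misfits ps j (fst x) (snd x) w) < D"
  have "(\<lambda>x. ?D (pairing (fst x)) x) \<in> ?M \<rightarrow>\<^sub>M count_space UNIV"
  proof (rule measurable_compose_countable'[OF _ measurable_compose[OF measurable_fst measurable_pairing] countable_valid])
    fix ps assume "ps \<in> Collect valid"
    then have v: "valid ps" by simp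
    show "(\<lambda>x. ?D ps x) \<in> ?M \<rightarrow>\<^sub>M count_space UNIV"
    proof (rule measurable_Least)
      fix w
      have "Measurable.pred ?M (\<lambda>x. 2 * card (misfits ps j (fst x) (snd x) w) < D)"
        unfolding misfits_def
      proof (rule pred_card_Collect[where \<phi>="\<lambda>c. 2 * c < D"])
        fix s assume s: "s < slot_count j"
        have [measurable]: "(\<lambda>x. slot_gain ps j s (fst x)) \<in> borel_measurable ?M"
          by (rule measurable_compose[OF measurable_fst measurable_slot_gain[OF v s]])
        have [measurable]: "(\<lambda>x. slot_obs ps s (snd x)) \<in> borel_measurable ?M"
          by (rule measurable_compose[OF measurable_snd measurable_slot_obs[OF v s]])
        show "Measurable.pred ?M (\<lambda>x. \<rho> + 1 < norm (slot_obs ps s (snd x) - slot_gain ps j s (fst x) *v symbol a (cw j w s)))"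
          by measurable
      qed
      then show "Measurable.pred ?M (\<lambda>x. w < L j \<longrightarrow> 2 * card (misfits ps j (fst x) (snd x) w) < D)"
        by (intro pred_intros_logic) auto
    qed
  qed
  also have "(\<lambda>x. ?D (pairing (fst x)) x) = (\<lambda>(h, y). decode j h y)"
    by (simp only: decode_def split_beta')
  finally show ?thesis .
qed

lemma block_code: "block_code \<mu> P n L encode decode"
  unfolding block_code_def
proof (intro conjI allI impI)
  show "0 < L k" for k by (rule L_pos)
  show "(\<lambda>h. encode k w h t) \<in> borel_measurable (channel_space \<mu> n)" for k w t
    unfolding encode_def by (rule measurable_compose[OF measurable_pairing]) simp
  show "(\<lambda>(h, y). decode j h y) \<in> channel_space \<mu> n \<Otimes>\<^sub>M PiM {..<n} (\<lambda>_. borel) \<rightarrow>\<^sub>M count_space UNIV" for j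
    by (rule measurable_decode)
  fix k t
  interpret J: prob_space "joint_space \<mu> n L :: (('k, 'm) gains \<times> ('k \<Rightarrow> nat) \<times> ('k, 'm) noises) measure"
    by (rule prob_space_joint_space[OF L_pos])
  \<comment> \<open>The power bound holds pointwise, because every symbol of the grid satisfies
    it.\<close>
  have "(\<integral>\<^sup>+(h, w, z). ennreal ((norm (encode k (w k) h t))\<^sup>2) \<partial>(joint_space \<mu> n L :: (('k, 'm) gains \<times> ('k \<Rightarrow> nat) \<times> ('k, 'm) noises) measure))
    \<le> (\<integral>\<^sup>+x. ennreal P \<partial>(joint_space \<mu> n L :: (('k, 'm) gains \<times> ('k \<Rightarrow> nat) \<times> ('k, 'm) noises) measure))"
  proof (rule nn_integral_mono, clarify)
    fix h w z assume "(h, w, z) \<in> space (joint_space \<mu> n L :: (('k, 'm) gains \<times> ('k \<Rightarrow> nat) \<times> ('k, 'm) noises) measure)"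
    then have "w k < L k"
      by (auto simp: joint_space_def space_pair_measure message_space_def space_PiM space_uniform_count_measure)
    then show "ennreal ((norm (encode k (w k) h t))\<^sup>2) \<le> ennreal P"
      unfolding encode_def by (intro ennreal_leI norm_signal_square_le pairing)
  qed
  also have "\<dots> = ennreal P" by (simp add: J.emeasure_space_1)
  finally show "(\<integral>\<^sup>+(h, w, z). ennreal ((norm (encode k (w k) h t))\<^sup>2) \<partial>(joint_space \<mu> n L :: (('k, 'm) gains \<times> ('k \<Rightarrow> nat) \<times> ('k, 'm) noises) measure)) \<le> ennreal P" .
qed

text \<open>\<open>e\<close> embeds the indices used at one time into those of the whole network, so
  that the same facts serve the noises and the direct gains of a receiver.\<close>

lemma slot_blocks:
  assumes v: "valid ps" and inj: "\<And>i i'. e i = e i' \<Longrightarrow> i = i'"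
  defines "f \<equiv> \<lambda>s (b, i). (slot_time ps s b, e i)"
  shows "s < slot_count j \<Longrightarrow> inj_on (f s) (slot_index (slot_coeff s))"
    and "s < slot_count j \<Longrightarrow> f s \<in> slot_index (slot_coeff s) \<rightarrow> {..<n} \<times> range e"
    and "disjoint_family_on (\<lambda>s. f s ` slot_index (slot_coeff s)) {..<slot_count j}"
proof -
  show "inj_on (f s) (slot_index (slot_coeff s))" if s: "s < slot_count j"
  proof (rule inj_onI, clarify)
    fix b i b' i'
    assume m: "(b, i) \<in> slot_index (slot_coeff s)" "(b', i') \<in> slot_index (slot_coeff s)" and "f s (b, i) = f s (b', i')"
    then have eq: "slot_time ps s b = slot_time ps s b'" and "i = i'" using inj by (auto simp: f_def)
    have "b = b'"
    proof (cases "s < pair_count")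
      case True then show ?thesis using slot_time_inj(2)[OF v s s eq] by simp
    next
      case False then show ?thesis using m by (simp add: slot_index_def slot_coeff_def)
    qed
    with \<open>i = i'\<close> show "b = b' \<and> i = i'" by simp
  qed
  show "f s \<in> slot_index (slot_coeff s) \<rightarrow> {..<n} \<times> range e" if "s < slot_count j"
    using slot_time_bounds(1)[OF v that] by (auto simp: f_def)
  show "disjoint_family_on (\<lambda>s. f s ` slot_index (slot_coeff s)) {..<slot_count j}"
  proof -
    have eq: "s = s'" if "s < slot_count j" "s' < slot_count j" "f s r = f s' r'" for s s' r r'
    proof -
      obtain b i b' i' where "r = (b, i)" "r' = (b', i')" by (cases r, cases r')
      then have "slot_time ps s b = slot_time ps s' b'" using that(3) by (simp add: f_def)
      then show ?thesis by (rule slot_time_inj(1)[OF v that(1,2)])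
    qed
    show ?thesis
      unfolding disjoint_family_on_def
    proof (intro ballI impI equals0I)
      fix s s' x
      assume s: "s \<in> {..<slot_count j}" "s' \<in> {..<slot_count j}" "s \<noteq> s'"
        and "x \<in> f s ` slot_index (slot_coeff s) \<inter> f s' ` slot_index (slot_coeff s')"
      then obtain r r' where "f s r = f s' r'" by auto
      with eq s show False by blast
    qed
  qed
qed

lemma slot_index_nonempty: "slot_index b \<noteq> {}"
  by (auto simp: slot_index_def)

lemma prob_noisy_slots_le:
  assumes v: "valid ps" and p: "0 \<le> p" "p \<le> 1"
    and tail: "\<And>b. b \<in> {0, 1} \<Longrightarrow> measure (PiM (slot_index b) (\<lambda>_. std_complex_normal))
      {x \<in> space (PiM (slot_index b) (\<lambda>_. std_complex_normal)). \<rho> < norm (slot_noise b x :: complex ^ 'm)} \<le> p"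
  shows "measure (noise_space n) {z \<in> space (noise_space n). m \<le> card {s. s < slot_count j \<and> \<rho> < norm (slot_pert ps j s z)}}
    \<le> 2 ^ slot_count j * p ^ m"
proof -
  define f where "f = (\<lambda>s (b, i). (slot_time ps s b, (\<lambda>\<alpha> :: 'm. (j, \<alpha>)) i))"
  let ?J = "\<lambda>s. slot_index (slot_coeff s) :: (bool \<times> 'm) set"
  let ?Q = "\<lambda>s. PiM (?J s) (\<lambda>_. std_complex_normal)"
  let ?A = "\<lambda>s. {x \<in> space (?Q s). \<rho> < norm (slot_noise (slot_coeff s) x :: complex ^ 'm)}"
  have f: "\<And>s. s < slot_count j \<Longrightarrow> inj_on (f s) (?J s)"
      "\<And>s. s < slot_count j \<Longrightarrow> f s \<in> ?J s \<rightarrow> {..<n} \<times> range (\<lambda>\<alpha>. (j, \<alpha>))"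
      "disjoint_family_on (\<lambda>s. f s ` ?J s) {..<slot_count j}"
    unfolding f_def by (intro slot_blocks[where e="\<lambda>\<alpha> :: 'm. (j, \<alpha>)", OF v]; simp)+
  have "measure (PiM ({..<n} \<times> UNIV) (\<lambda>_. std_complex_normal))
      {z \<in> space (PiM ({..<n} \<times> UNIV) (\<lambda>_. std_complex_normal)). m \<le> card {s. s < slot_count j \<and> (\<lambda>r\<in>?J s. z (f s r)) \<in> ?A s}}
    \<le> 2 ^ slot_count j * p ^ m"
  proof (rule prob_PiM_blocks_card_ge_le)
    fix s assume s: "s < slot_count j"
    show "inj_on (f s) (?J s)" by (rule f(1)[OF s])
    show "f s \<in> ?J s \<rightarrow> {..<n} \<times> UNIV"
    proof (rule funcsetI)
      fix r assume "r \<in> ?J s"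
      from funcset_mem[OF f(2)[OF s] this] show "f s r \<in> {..<n} \<times> UNIV" by auto
    qed
    have [measurable]: "slot_noise (slot_coeff s) \<in> borel_measurable (?Q s)" by (rule measurable_slot_noise) simp
    show "?A s \<in> sets (?Q s)" by measurable
    show "measure (?Q s) (?A s) \<le> p" by (rule tail) (simp add: slot_coeff_def)
  qed (use f(3) p slot_index_nonempty in \<open>auto intro: prob_space_std_complex_normal\<close>)
  moreover have "(\<lambda>r\<in>?J s. z (f s r)) \<in> ?A s \<longleftrightarrow> \<rho> < norm (slot_pert ps j s z)" for s z
  proof -
    have "(\<lambda>r. z (f s r)) = (\<lambda>(b, \<alpha>). z (slot_time ps s b, j, \<alpha>))" by (auto simp: f_def fun_eq_iff)
    then show ?thesis by (simp add: space_PiM slot_noise_restrict slot_pert_def)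
  qed
  ultimately show ?thesis unfolding noise_space_def by simp
qed

text \<open>The pairing is random, but a function of the cross gains alone. For fixed cross gains
  the slots read disjoint blocks of direct gains, whose law is unaffected, so Fubini reduces the
  claim to a fixed pairing.\<close>

lemma prob_weak_slots_le:
  fixes j :: 'k and m :: nat
  assumes p: "0 \<le> p" "p \<le> 1"
    and tail: "\<And>b. b \<in> {0, 1} \<Longrightarrow> measure (PiM (slot_index b) (\<lambda>_. \<mu>))
      {x \<in> space (PiM (slot_index b) (\<lambda>_. \<mu>)). \<not> bounded_below \<eta> (slot_matrix b x :: complex ^ 'm ^ 'm)} \<le> p"
  defines "W \<equiv> {h \<in> space (channel_space \<mu> n). m \<le> card {s. s < slot_count j \<and> \<not> bounded_below \<eta> (slot_gain (pairing h) j s h)}}"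
  shows "W \<in> sets (channel_space \<mu> n)" "measure (channel_space \<mu> n) W \<le> 2 ^ slot_count j * p ^ m"
proof -
  let ?C = "channel_space \<mu> n :: ('k, 'm) gains measure"
  interpret C: prob_space ?C by (rule prob_space_channel_space)
  have "Measurable.pred ?C (\<lambda>h. m \<le> card {s. s < slot_count j \<and> \<not> bounded_below \<eta> (slot_gain (pairing h) j s h)})"
  proof (rule measurable_compose_countable'[OF _ measurable_pairing countable_valid])
    fix ps assume "ps \<in> Collect valid"
    then have v: "valid ps" by simp
    show "Measurable.pred ?C (\<lambda>h. m \<le> card {s. s < slot_count j \<and> \<not> bounded_below \<eta> (slot_gain ps j s h)})"
    proof (rule pred_card_Collect[where \<phi>="\<lambda>c. m \<le> c"])
      fix s assume s: "s < slot_count j"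
      note [measurable] = measurable_slot_gain[OF v s]
      show "Measurable.pred ?C (\<lambda>h. \<not> bounded_below \<eta> (slot_gain ps j s h))" by measurable
    qed
  qed
  then show W: "W \<in> sets ?C" unfolding W_def by (rule predE)
  define Dir where "Dir = ({..<n} \<times> {(j, k, r). j = k} :: (nat \<times> 'k \<times> 'k \<times> 'm \<times> 'm) set)"
  define Crs where "Crs = ({..<n} \<times> {(j, k, r). j \<noteq> k} :: (nat \<times> 'k \<times> 'k \<times> 'm \<times> 'm) set)"
  have fin: "finite Crs" "finite Dir" by (auto simp: Crs_def Dir_def)
  have disj: "Crs \<inter> Dir = {}" and un: "Crs \<union> Dir = {..<n} \<times> UNIV" by (auto simp: Crs_def Dir_def)
  interpret PP: product_prob_space "\<lambda>_. \<mu>" by (intro product_prob_spaceI prob_space_axioms)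
  interpret PC: prob_space "PiM Crs (\<lambda>_. \<mu>)" by (rule prob_space_PiM) (rule prob_space_axioms)
  interpret PD: prob_space "PiM Dir (\<lambda>_. \<mu>)" by (rule prob_space_PiM) (rule prob_space_axioms)
  have W': "W \<in> sets (PiM (Crs \<union> Dir) (\<lambda>_. \<mu>))" using W by (simp add: channel_space_def un)
  have "emeasure ?C W = (\<integral>\<^sup>+ h. indicator W h \<partial>PiM (Crs \<union> Dir) (\<lambda>_. \<mu>))"
    using W' by (simp add: channel_space_def un)
  also have "\<dots> = (\<integral>\<^sup>+ x. (\<integral>\<^sup>+ y. indicator W (merge Crs Dir (x, y)) \<partial>PiM Dir (\<lambda>_. \<mu>)) \<partial>PiM Crs (\<lambda>_. \<mu>))"
    using disj fin W' by (intro PP.product_nn_integral_fold) auto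
  also have "\<dots> \<le> (\<integral>\<^sup>+ x. ennreal (2 ^ slot_count j * p ^ m) \<partial>PiM Crs (\<lambda>_. \<mu>))"
  proof (rule nn_integral_mono)
    fix x
    \<comment> \<open>The point \<open>x\<close> stands for the cross gains. The pairing reads
      nothing else, so it will agree with that of the merged gains.\<close>
    define ps where "ps = pairing x"
    have v: "valid ps" unfolding ps_def by (rule pairing)
    define f where "f = (\<lambda>s (b, i). (slot_time ps s b, (\<lambda>(\<alpha> :: 'm, \<beta> :: 'm). (j, j, \<alpha>, \<beta>)) i))"
    let ?J = "\<lambda>s. slot_index (slot_coeff s) :: (bool \<times> 'm \<times> 'm) set"
    let ?Q = "\<lambda>s. PiM (?J s) (\<lambda>_. \<mu>)"
    let ?A = "\<lambda>s. {x \<in> space (?Q s). \<not> bounded_below \<eta> (slot_matrix (slot_coeff s) x :: complex ^ 'm ^ 'm)}"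
    let ?S = "{y \<in> space (PiM Dir (\<lambda>_. \<mu>)). m \<le> card {s. s < slot_count j \<and> (\<lambda>r\<in>?J s. y (f s r)) \<in> ?A s}}"
    have f: "\<And>s. s < slot_count j \<Longrightarrow> inj_on (f s) (?J s)"
        "\<And>s. s < slot_count j \<Longrightarrow> f s \<in> ?J s \<rightarrow> {..<n} \<times> range (\<lambda>(\<alpha>, \<beta>). (j, j, \<alpha>, \<beta>))"
        "disjoint_family_on (\<lambda>s. f s ` ?J s) {..<slot_count j}"
      unfolding f_def by (intro slot_blocks[where e="\<lambda>(\<alpha> :: 'm, \<beta> :: 'm). (j, j, \<alpha>, \<beta>)", OF v]; auto)+
    have f2: "f s \<in> ?J s \<rightarrow> Dir" if "s < slot_count j" for s
    proof (rule funcsetI)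
      fix r assume "r \<in> ?J s"
      from funcset_mem[OF f(2)[OF that] this] show "f s r \<in> Dir" by (auto simp: Dir_def)
    qed
    have Am: "?A s \<in> sets (?Q s)" for s
    proof -
      have [measurable]: "slot_matrix (slot_coeff s) \<in> borel_measurable (?Q s)" by (rule measurable_slot_matrix) simp
      show ?thesis by measurable
    qed
    have bound: "PD.prob ?S \<le> 2 ^ slot_count j * p ^ m"
    proof (rule prob_PiM_blocks_card_ge_le)
      fix s assume s: "s < slot_count j"
      show "measure (?Q s) (?A s) \<le> p" by (rule tail) (simp add: slot_coeff_def)
      show "?A s \<in> sets (?Q s)" by (rule Am)
      show "inj_on (f s) (?J s)" by (rule f(1)[OF s])
      show "f s \<in> ?J s \<rightarrow> Dir" by (rule f2[OF s])
    qed (use f(3) fin p slot_index_nonempty in \<open>auto intro: prob_space_axioms\<close>)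
    have Sm: "?S \<in> sets (PiM Dir (\<lambda>_. \<mu>))"
    proof -
      have "Measurable.pred (PiM Dir (\<lambda>_. \<mu>)) (\<lambda>y. m \<le> card {s. s < slot_count j \<and> (\<lambda>r\<in>?J s. y (f s r)) \<in> ?A s})"
      proof (rule pred_card_Collect[where \<phi>="\<lambda>c. m \<le> c"])
        fix s assume s: "s < slot_count j"
        have "(\<lambda>y. \<lambda>r\<in>?J s. y (f s r)) \<in> PiM Dir (\<lambda>_. \<mu>) \<rightarrow>\<^sub>M ?Q s"
          using f2[OF s] by (intro measurable_restrict measurable_component_singleton) auto
        then show "Measurable.pred (PiM Dir (\<lambda>_. \<mu>)) (\<lambda>y. (\<lambda>r\<in>?J s. y (f s r)) \<in> ?A s)"
          by (rule pred_sets2[OF Am])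
      qed
      then show ?thesis by (rule predE)
    qed
    have "(\<integral>\<^sup>+ y. indicator W (merge Crs Dir (x, y)) \<partial>PiM Dir (\<lambda>_. \<mu>)) \<le> (\<integral>\<^sup>+ y. indicator ?S y \<partial>PiM Dir (\<lambda>_. \<mu>))"
    proof (rule nn_integral_mono)
      fix y assume y: "y \<in> space (PiM Dir (\<lambda>_. \<mu>))"
      let ?h = "merge Crs Dir (x, y)"
      have "cells ?h t = cells x t" if "t < n" for t
        using that by (auto simp: cells_def fun_eq_iff merge_def Crs_def)
      then have "history ?h = history x" by (auto simp: history_def)
      then have ps: "pairing ?h = ps" by (simp add: pairing_def ps_def)
      have "(\<lambda>r\<in>?J s. y (f s r)) \<in> ?A s \<longleftrightarrow> \<not> bounded_below \<eta> (slot_gain ps j s ?h)" if s: "s < slot_count j" for s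
      proof -
        have "y (f s (b, \<alpha>, \<beta>)) = ?h (slot_time ps s b, j, j, \<alpha>, \<beta>)" for b \<alpha> \<beta>
          using slot_time_bounds(1)[OF v s, of b] by (auto simp: f_def merge_def Crs_def Dir_def)
        then have "(\<lambda>r. y (f s r)) = (\<lambda>(b, \<alpha>, \<beta>). ?h (slot_time ps s b, j, j, \<alpha>, \<beta>))" by (auto simp: fun_eq_iff)
        then show ?thesis by (simp add: space_PiM slot_matrix_restrict slot_gain_def)
      qed
      then have "{s. s < slot_count j \<and> (\<lambda>r\<in>?J s. y (f s r)) \<in> ?A s} = {s. s < slot_count j \<and> \<not> bounded_below \<eta> (slot_gain ps j s ?h)}"
        by blast
      then show "indicator W ?h \<le> (indicator ?S y :: ennreal)"
        using y unfolding W_def by (auto simp: indicator_def ps)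
    qed
    also have "\<dots> = ennreal (PD.prob ?S)" by (subst nn_integral_indicator[OF Sm]) (rule PD.emeasure_eq_measure)
    also have "\<dots> \<le> ennreal (2 ^ slot_count j * p ^ m)" by (rule ennreal_leI[OF bound])
    finally show "(\<integral>\<^sup>+ y. indicator W (merge Crs Dir (x, y)) \<partial>PiM Dir (\<lambda>_. \<mu>)) \<le> ennreal (2 ^ slot_count j * p ^ m)" .
  qed
  also have "\<dots> = ennreal (2 ^ slot_count j * p ^ m)" by (simp add: PC.emeasure_space_1)
  finally show "C.prob W \<le> 2 ^ slot_count j * p ^ m" using p by (simp add: C.emeasure_eq_measure)
qed

text \<open>An error needs \<open>m\<close> weak or \<open>m\<close> noisy slots: otherwise fewer
  than \<open>2 * m\<close> slots are bad, which \<open>4 * m \<le> D\<close> makes less than half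
  the distance. The two kinds of failure give the factor 2.\<close>

lemma error_prob_le:
  assumes p: "0 \<le> p" "p \<le> 1" and m: "4 * m \<le> D"
    and gain_tail: "\<And>b. b \<in> {0, 1} \<Longrightarrow> measure (PiM (slot_index b) (\<lambda>_. \<mu>))
      {x \<in> space (PiM (slot_index b) (\<lambda>_. \<mu>)). \<not> bounded_below \<eta> (slot_matrix b x :: complex ^ 'm ^ 'm)} \<le> p"
    and noise_tail: "\<And>b. b \<in> {0, 1} \<Longrightarrow> measure (PiM (slot_index b) (\<lambda>_. std_complex_normal))
      {x \<in> space (PiM (slot_index b) (\<lambda>_. std_complex_normal)). \<rho> < norm (slot_noise b x :: complex ^ 'm)} \<le> p"
  shows "error_prob \<mu> n L encode decode j \<le> 2 * (2 ^ slot_count j * p ^ m)"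
proof -
  let ?\<Omega> = "joint_space \<mu> n L :: (('k, 'm) gains \<times> ('k \<Rightarrow> nat) \<times> ('k, 'm) noises) measure"
  let ?C = "channel_space \<mu> n :: ('k, 'm) gains measure"
  let ?N = "noise_space n :: ('k, 'm) noises measure"
  let ?M = "message_space L"
  interpret O: prob_space ?\<Omega> by (rule prob_space_joint_space[OF L_pos])
  interpret C: prob_space ?C by (rule prob_space_channel_space)
  interpret M: prob_space ?M by (rule prob_space_message_space[OF L_pos])
  interpret N: prob_space ?N by (rule prob_space_noise_space)
  interpret MN: pair_prob_space ?M ?N ..
  let ?c = "2 ^ slot_count j * p ^ m :: real"
  define E where "E = {(h, w, z) \<in> space ?\<Omega>. decode j h (received n encode j h w z) \<noteq> w j}"
  have E: "E \<in> sets ?\<Omega>" unfolding E_def by (rule error_event[OF block_code])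
  then have E': "E \<in> sets (?C \<Otimes>\<^sub>M (?M \<Otimes>\<^sub>M ?N))" by (simp add: joint_space_def)
  define W where "W = {h \<in> space ?C. m \<le> card {s. s < slot_count j \<and> \<not> bounded_below \<eta> (slot_gain (pairing h) j s h)}}"
  have W: "W \<in> sets ?C" and pW: "C.prob W \<le> ?c"
    unfolding W_def by (rule prob_weak_slots_le[OF p gain_tail]; assumption)+
  define Z where "Z = (\<lambda>h. {z \<in> space ?N. m \<le> card {s. s < slot_count j \<and> \<rho> < norm (slot_pert (pairing h) j s z)}})"
  have Z: "Z h \<in> sets ?N" for h
  proof -
    have "Measurable.pred ?N (\<lambda>z. m \<le> card {s. s < slot_count j \<and> \<rho> < norm (slot_pert (pairing h) j s z)})"
    proof (rule pred_card_Collect[where \<phi>="\<lambda>c. m \<le> c"])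
      fix s assume s: "s < slot_count j"
      note [measurable] = measurable_slot_pert[OF pairing(1) s]
      show "Measurable.pred ?N (\<lambda>z. \<rho> < norm (slot_pert (pairing h) j s z))" by measurable
    qed
    then show ?thesis unfolding Z_def by (rule predE)
  qed
  have pZ: "N.prob (Z h) \<le> ?c" for h
    unfolding Z_def by (rule prob_noisy_slots_le[OF pairing(1) p]) (rule noise_tail)
  have "emeasure ?\<Omega> E = (\<integral>\<^sup>+ x. indicator E x \<partial>?\<Omega>)" by (rule nn_integral_indicator[OF E, symmetric])
  also have "\<dots> = (\<integral>\<^sup>+ h. (\<integral>\<^sup>+ y. indicator E (h, y) \<partial>(?M \<Otimes>\<^sub>M ?N)) \<partial>?C)"
    unfolding joint_space_def by (rule MN.nn_integral_fst[OF borel_measurable_indicator[OF E'], symmetric])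
  also have "\<dots> \<le> (\<integral>\<^sup>+ h. indicator W h + ennreal ?c \<partial>?C)"
  proof (rule nn_integral_mono_AE)
    have "AE h in ?C. h \<in> space ?C" by simp
    with AE_gains_bounded[where 'k='k and 'm='m]
    show "AE h in ?C. (\<integral>\<^sup>+ y. indicator E (h, y) \<partial>(?M \<Otimes>\<^sub>M ?N)) \<le> indicator W h + ennreal ?c"
    proof eventually_elim
      case (elim h)
      have "(\<integral>\<^sup>+ y. indicator E (h, y) \<partial>(?M \<Otimes>\<^sub>M ?N)) \<le> (\<integral>\<^sup>+ y. indicator W h + indicator (Z h) (snd y) \<partial>(?M \<Otimes>\<^sub>M ?N))"
      proof (rule nn_integral_mono, clarify)
        fix w z assume wz: "(w, z) \<in> space (?M \<Otimes>\<^sub>M ?N)"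
        then have w: "\<And>k. w k < L k" and z: "z \<in> space ?N"
          by (auto simp: space_pair_measure message_space_def space_PiM space_uniform_count_measure)
        have "h \<in> W \<or> z \<in> Z h" if "(h, w, z) \<in> E"
        proof (rule ccontr)
          let ?w = "{s. s < slot_count j \<and> \<not> bounded_below \<eta> (slot_gain (pairing h) j s h)}"
          let ?z = "{s. s < slot_count j \<and> \<rho> < norm (slot_pert (pairing h) j s z)}"
          assume "\<not> (h \<in> W \<or> z \<in> Z h)"
          then have "card ?w < m" "card ?z < m" using elim(2) z by (auto simp: W_def Z_def not_le)
          then have "2 * card (?w \<union> ?z) < D" using m card_Un_le[of ?w ?z] by linarith
          then have "decode j h (received n encode j h w z) = w j"
            using elim(1) w by (intro decode_correct) auto
          then show False using that by (simp add: E_def)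
        qed
        then show "indicator E (h, w, z) \<le> (indicator W h + indicator (Z h) (snd (w, z)) :: ennreal)"
          by (auto simp: indicator_def)
      qed
      also have "\<dots> = indicator W h + (\<integral>\<^sup>+ y. indicator (Z h) (snd y) \<partial>(?M \<Otimes>\<^sub>M ?N))"
        using Z[of h] by (subst nn_integral_add) (auto simp: MN.emeasure_space_1)
      also have "(\<integral>\<^sup>+ y. indicator (Z h) (snd y) \<partial>(?M \<Otimes>\<^sub>M ?N)) = (\<integral>\<^sup>+ z. indicator (Z h) z \<partial>?N)"
        by (rule nn_integral_pair_snd[OF M.prob_space_axioms N.prob_space_axioms]) (use Z[of h] in simp)
      also have "\<dots> = ennreal (N.prob (Z h))" using Z[of h] by (simp add: N.emeasure_eq_measure)
      also have "indicator W h + ennreal (N.prob (Z h)) \<le> indicator W h + ennreal ?c"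
        by (intro add_left_mono ennreal_leI pZ)
      finally show ?case .
    qed
  qed
  also have "\<dots> = ennreal (C.prob W) + ennreal ?c"
    using W by (subst nn_integral_add) (auto simp: C.emeasure_eq_measure C.prob_space)
  also have "\<dots> \<le> ennreal ?c + ennreal ?c" by (intro add_right_mono ennreal_leI pW)
  also have "\<dots> = ennreal (2 * ?c)" using p by (subst ennreal_plus[symmetric]) auto
  finally have "O.prob E \<le> 2 * ?c" using p by (simp add: O.emeasure_eq_measure)
  then show ?thesis by (simp add: error_prob_def E_def)
qed

end

section \<open>Choice of parameters\<close>

context fading_channel
begin

lemma exists_alignment_block_code:
  fixes k0 :: "'k::finite"
  assumes "0 \<le> a" "2 * real CARD('m::finite) * (a * real Q)\<^sup>2 \<le> P" "0 < Q"
    and "0 < \<epsilon>" "real CARD('k) * (real CARD('m) * real CARD('m) * (2 * \<epsilon>) * sqrt P) \<le> 1"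
    and "gmax / \<epsilon> + 1 \<le> real_of_int B" "0 \<le> B"
    and "c = card (UNIV \<rightarrow>\<^sub>E {- B..B} \<times> {- B..B} :: ('k \<times> 'k \<times> 'm \<times> 'm \<Rightarrow> int \<times> int) set)"
    and "0 < \<eta>" "2 * (\<rho> + 1) < \<eta> * a" "n1 \<le> n"
    and p: "0 \<le> p" "p \<le> 1" and m: "4 * m \<le> D"
    and tails: "\<forall>b\<in>{0, 1}.
      measure (PiM (slot_index b) (\<lambda>_. \<mu>)) {x \<in> space (PiM (slot_index b) (\<lambda>_. \<mu>)).
        \<not> bounded_below \<eta> (slot_matrix b x :: complex ^ 'm ^ 'm)} \<le> p \<and>
      measure (PiM (slot_index b) (\<lambda>_. std_complex_normal)) {x \<in> space (PiM (slot_index b) (\<lambda>_. std_complex_normal)).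
        \<rho> < norm (slot_noise b x :: complex ^ 'm)} \<le> p"
  defines "N \<equiv> \<lambda>k. (n - n1 - c) div 2 + (if k = k0 then n1 else 0)"
  defines "q \<equiv> (Q * Q) ^ CARD('m)"
  shows "\<exists>L (enc :: ('k, 'm) encoders) dec. block_code \<mu> P n L enc dec \<and>
    (\<forall>k. q ^ N k \<le> L k * (2 ^ N k * q ^ D)) \<and>
    (\<forall>j. error_prob \<mu> n L enc dec j \<le> 2 * (2 ^ N j * p ^ m))"
proof -
  let ?A = "alphabet Q :: ('m \<Rightarrow> nat \<times> nat) set"
  have A: "finite ?A" "?A \<noteq> {}" using \<open>0 < Q\<close> by (auto intro: finite_PiE simp: PiE_eq_empty_iff)
  have "\<forall>k. \<exists>L cw. (\<forall>w<L. \<forall>s<N k. cw w s \<in> ?A) \<and>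
    (\<forall>w<L. \<forall>w'<L. w \<noteq> w' \<longrightarrow> D \<le> card {s. s < N k \<and> cw w s \<noteq> cw w' s}) \<and>
    q ^ N k \<le> L * (2 ^ N k * q ^ D)"
    using gilbert_varshamov[OF A] unfolding card_alphabet q_def by blast
  from choice[OF this] obtain L where "\<forall>k. \<exists>cw. (\<forall>w<L k. \<forall>s<N k. cw w s \<in> ?A) \<and>
    (\<forall>w<L k. \<forall>w'<L k. w \<noteq> w' \<longrightarrow> D \<le> card {s. s < N k \<and> cw w s \<noteq> cw w' s}) \<and>
    q ^ N k \<le> L k * (2 ^ N k * q ^ D)" ..
  from choice[OF this] obtain cw where "\<forall>k. (\<forall>w<L k. \<forall>s<N k. cw k w s \<in> ?A) \<and>
    (\<forall>w<L k. \<forall>w'<L k. w \<noteq> w' \<longrightarrow> D \<le> card {s. s < N k \<and> cw k w s \<noteq> cw k w' s}) \<and>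
    q ^ N k \<le> L k * (2 ^ N k * q ^ D)" ..
  then have
    cw_in: "\<And>k w s. w < L k \<Longrightarrow> s < N k \<Longrightarrow> cw k w s \<in> ?A" and
    cw_dist: "\<And>k w w'. w < L k \<Longrightarrow> w' < L k \<Longrightarrow> w \<noteq> w' \<Longrightarrow> D \<le> card {s. s < N k \<and> cw k w s \<noteq> cw k w' s}" and
    size: "\<And>k. q ^ N k \<le> L k * (2 ^ N k * q ^ D)" by blast+
  have "0 < q" using \<open>0 < Q\<close> by (simp add: q_def)
  \<comment> \<open>A code without words would contradict the size bound, as \<open>q\<close> is
    positive.\<close>
  then have L: "0 < L k" for k using size[of k] by (cases "L k = 0") auto
  interpret S: alignment_scheme \<mu> gmax P a \<epsilon> \<eta> \<rho> Q n n1 D c B k0 L cw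
    using assms(1-11) L by unfold_locales auto
  have N: "S.slot_count k = N k" for k by (simp add: S.slot_count_def S.pair_count_def N_def)
  interpret A: alignment_code \<mu> gmax P a \<epsilon> \<eta> \<rho> Q n n1 D c B k0 L cw
    by unfold_locales (use cw_in cw_dist in \<open>simp_all only: N\<close>)
  have "error_prob \<mu> n L S.encode S.decode j \<le> 2 * (2 ^ S.slot_count j * p ^ m)" for j
    by (rule A.error_prob_le[OF p m]) (use tails in auto)
  then show ?thesis using A.block_code size by (auto simp: N)
qed

text \<open>It fills in the short block lengths, where a code must exist but its error is
  irrelevant, and it serves the rate tuple 0.\<close>

lemma trivial_block_code:
  assumes "\<And>k. 0 < L k" "0 \<le> P"
  shows "block_code \<mu> P n L (\<lambda>_ _ _ _. 0 :: complex ^ 'm) ((\<lambda>_ _ _. 0) :: ('k::finite, 'm::finite) decoders)"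
  using assms by (simp add: block_code_def split_beta')

text \<open>The factor \<open>1 - \<delta>\<close> leaves room for the losses through the outer
  code, the grid spacing, rounding and unpaired times. The power is fixed before the block length
  grows, since the number \<open>c\<close> of cells depends on it.\<close>

lemma achievable_scaled:
  fixes d :: "real ^ 'k::finite"
  assumes K: "2 \<le> CARD('k)" and nonneg: "\<And>k. 0 \<le> d $ k"
    and pair: "\<And>i j. i \<noteq> j \<Longrightarrow> d $ i + d $ j \<le> real CARD('m::finite)"
    and \<delta>: "0 < \<delta>" "\<delta> < 1"
  shows "\<forall>\<^sub>F P in at_top. achievable TYPE('m) \<mu> P (\<chi> k. (1 - \<delta>) * d $ k * log 2 P)"
proof -
  define M where "M = real CARD('m)"
  have M: "1 \<le> M" by (simp add: M_def Suc_leI)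
  \<comment> \<open>At most one coordinate can exceed \<open>M / 2\<close>, and the largest one is
    the candidate for the reserved times.\<close>
  have "\<exists>k0. \<forall>k. d $ k \<le> d $ k0"
  proof -
    have "Max (range (($) d)) \<in> range (($) d)" by (rule Max_in) auto
    then obtain k0 where k0: "Max (range (($) d)) = d $ k0" by (rule imageE)
    have "d $ k \<le> Max (range (($) d))" for k by (rule Max_ge) auto
    then show ?thesis unfolding k0 by blast
  qed
  then obtain k0 where k0: "\<And>k. d $ k \<le> d $ k0" by blast
  \<comment> \<open>The bound \<open>d $ k0 \<le> M\<close> comes from a pair, so a second user is
    needed.\<close>
  have "\<exists>j. j \<noteq> k0"
  proof (rule ccontr)
    assume "\<nexists>j. j \<noteq> k0"
    then have "(UNIV :: 'k set) = {k0}" by auto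
    then have "CARD('k) = 1" by (metis card_1_singleton_iff One_nat_def)
    then show False using K by simp
  qed
  then have dM: "d $ k0 \<le> M" using pair nonneg unfolding M_def by (metis add_increasing2 order_trans order_refl)
  \<comment> \<open>The fraction of time reserved for \<open>k0\<close>: it solves
    \<open>M * (1 + lam) / 2 = d $ k0\<close> when \<open>d $ k0\<close> exceeds
    \<open>M / 2\<close>, and is 0 otherwise.\<close>
  define lam where "lam = max 0 (2 * d $ k0 / M - 1)"
  have lam: "0 \<le> lam" "lam \<le> 1" using dM M by (auto simp: lam_def field_simps)
  \<comment> \<open>The asymptotic number of slots of user \<open>k\<close> per channel use: a pair
    of times counts as one slot, a reserved time as a full slot.\<close>
  define \<nu> where "\<nu> = (\<lambda>k. (1 - lam) / 2 + (if k = k0 then lam else 0))"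
  have \<nu>: "d $ k \<le> M * \<nu> k" for k
  proof -
    have h: "2 * d $ k0 \<le> M * (1 + lam)"
    proof -
      have "2 * d $ k0 / M \<le> 1 + lam" by (simp add: lam_def)
      then show ?thesis using M by (simp add: divide_le_eq mult.commute)
    qed
    show ?thesis
    proof (cases "k = k0")
      case True then show ?thesis using h by (simp add: \<nu>_def field_simps)
    next
      case False
      show ?thesis
      proof (cases "lam = 0")
        case True then show ?thesis using h k0[of k] False by (simp add: \<nu>_def)
      next
        case False': False
        then have "lam = 2 * d $ k0 / M - 1" by (auto simp: lam_def max_def split: if_splits)
        then have "M * \<nu> k = M - d $ k0" using False M by (simp add: \<nu>_def field_simps)
        then show ?thesis using pair[OF False] by (simp add: M_def)
      qed
    qed
  qed
  \<comment> \<open>One small parameter for several losses: the outer code has distance about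
    \<open>\<delta>' * n\<close>, and the grid gives up the fraction \<open>\<delta>'\<close> of its
    bits so that its spacing grows with the power.\<close>
  obtain \<delta>' where \<delta>': "0 < \<delta>'" "\<delta>' < 1" and gap: "\<And>k. 0 < d $ k \<Longrightarrow> (1 - \<delta>) * d $ k < M * (\<nu> k - \<delta>') * (1 - \<delta>')"
  proof -
    have "\<forall>\<^sub>F x in at_right 0. 0 < d $ k \<longrightarrow> (1 - \<delta>) * d $ k < M * (\<nu> k - x) * (1 - x)" for k
    proof (cases "0 < d $ k")
      case True
      have "((\<lambda>x. M * (\<nu> k - x) * (1 - x)) \<longlongrightarrow> M * (\<nu> k - 0) * (1 - 0)) (at_right 0)"
        by (intro tendsto_intros)
      moreover have "(1 - \<delta>) * d $ k < M * (\<nu> k - 0) * (1 - 0)"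
        using \<nu>[of k] True \<delta> by (simp add: algebra_simps) (smt (verit) mult_pos_pos)
      ultimately have "\<forall>\<^sub>F x in at_right 0. (1 - \<delta>) * d $ k < M * (\<nu> k - x) * (1 - x)"
        by (rule order_tendstoD(1))
      then show ?thesis by eventually_elim simp
    qed simp
    then have "\<forall>\<^sub>F x in at_right 0. \<forall>k. 0 < d $ k \<longrightarrow> (1 - \<delta>) * d $ k < M * (\<nu> k - x) * (1 - x)"
      by (rule eventually_all_finite)
    moreover have "\<forall>\<^sub>F x in at_right (0::real). 0 < x \<and> x < 1"
      unfolding eventually_at_right_field by (intro exI[of _ 1]) auto
    ultimately have "\<forall>\<^sub>F x in at_right 0. (\<forall>k. 0 < d $ k \<longrightarrow> (1 - \<delta>) * d $ k < M * (\<nu> k - x) * (1 - x)) \<and> 0 < x \<and> x < 1"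
      by eventually_elim auto
    then show thesis using that eventually_happens'[OF trivial_limit_at_right_real] by blast
  qed
  have \<nu>\<delta>: "\<delta>' < \<nu> k" if "0 < d $ k" for k
  proof -
    have "0 < (1 - \<delta>) * d $ k" using that \<delta> by simp
    then have "0 < M * (\<nu> k - \<delta>') * (1 - \<delta>')" using gap[OF that] by linarith
    then show ?thesis using M \<delta>' by (simp add: zero_less_mult_iff)
  qed
  \<comment> \<open>With this \<open>r\<close>, \<open>p ^ (D div 4)\<close> is at most a constant
    times \<open>(1 / 4) ^ n\<close>, which beats the factor \<open>2 ^ n\<close> of the union
    bound.\<close>
  obtain r where r: "4 / \<delta>' \<le> real r" using real_arch_simple by blast
  define p where "p = (1 / 4 :: real) ^ r"
  have p: "0 < p" "p \<le> 1" by (auto simp: p_def power_le_one)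
  obtain \<eta> \<rho> where \<eta>: "0 < \<eta>" and \<rho>: "0 \<le> \<rho>" and tails: "\<forall>b\<in>{0, 1}.
      measure (PiM (slot_index b) (\<lambda>_. \<mu>)) {x \<in> space (PiM (slot_index b) (\<lambda>_. \<mu>)).
        \<not> bounded_below \<eta> (slot_matrix b x :: complex ^ 'm ^ 'm)} \<le> p \<and>
      measure (PiM (slot_index b) (\<lambda>_. std_complex_normal)) {x \<in> space (PiM (slot_index b) (\<lambda>_. std_complex_normal)).
        \<rho> < norm (slot_noise b x :: complex ^ 'm)} \<le> p"
    using ex_slot_thresholds[OF p(1)] by blast
  \<comment> \<open>A lower bound on the bits per symbol; the 2 per antenna pays for rounding the
    number of grid points down in both real dimensions.\<close>
  define lq where "lq = (\<lambda>P. M * ((1 - \<delta>') * log 2 P - 2))"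
  have logtop: "filterlim (\<lambda>P. log 2 P) at_top (at_top :: real filter)"
  proof -
    have "filterlim (\<lambda>P::real. ln P / ln 2) at_top at_top"
      using filterlim_tendsto_pos_mult_at_top[OF tendsto_const, of "1 / ln 2 :: real" "\<lambda>P. ln P" at_top] ln_at_top by simp
    then show ?thesis by (simp add: log_def)
  qed
  \<comment> \<open>The spare 2 is spent below: one bit per channel use on the factor
    \<open>2 ^ N k\<close> of the code size, one on the losses that do not grow with
    \<open>n\<close>.\<close>
  have ev_rate: "\<forall>\<^sub>F P in at_top. \<forall>k. 0 < d $ k \<longrightarrow> (1 - \<delta>) * d $ k * log 2 P + 2 \<le> (\<nu> k - \<delta>') * lq P"
  proof (rule eventually_all_finite)
    fix k
    show "\<forall>\<^sub>F P in at_top. 0 < d $ k \<longrightarrow> (1 - \<delta>) * d $ k * log 2 P + 2 \<le> (\<nu> k - \<delta>') * lq P"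
    proof (cases "0 < d $ k")
      case True
      define g where "g = M * (\<nu> k - \<delta>') * (1 - \<delta>') - (1 - \<delta>) * d $ k"
      have g: "0 < g" using gap[OF True] by (simp add: g_def)
      have "\<forall>\<^sub>F P in at_top. (2 + 2 * M * (\<nu> k - \<delta>')) / g \<le> log 2 P"
        using logtop by (simp add: filterlim_at_top)
      then show ?thesis
      proof eventually_elim
        case (elim P)
        then have "2 + 2 * M * (\<nu> k - \<delta>') \<le> log 2 P * g" using g by (simp add: divide_le_eq)
        also have "\<dots> = (\<nu> k - \<delta>') * lq P - (1 - \<delta>) * d $ k * log 2 P + 2 * M * (\<nu> k - \<delta>')"
          by (simp add: g_def lq_def algebra_simps)
        finally show ?case by simp
      qed
    qed simp
  qed
  \<comment> \<open>The spacing will be at least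
    \<open>P powr (\<delta>' / 2) / sqrt (2 * M)\<close>, so this is the separation
    condition.\<close>
  have ev_a: "\<forall>\<^sub>F P in at_top. 2 * (\<rho> + 1) * sqrt (2 * M) / \<eta> < P powr (\<delta>' / 2)"
  proof -
    have "filterlim (\<lambda>P :: real. exp (\<delta>' / 2 * ln P)) at_top at_top"
      by (rule filterlim_compose[OF exp_at_top filterlim_tendsto_pos_mult_at_top[OF tendsto_const _ ln_at_top]])
         (use \<delta>' in simp)
    then have "\<forall>\<^sub>F P in at_top. 2 * (\<rho> + 1) * sqrt (2 * M) / \<eta> < exp (\<delta>' / 2 * ln P)"
      by (simp add: filterlim_at_top_dense)
    with eventually_gt_at_top[of 0] show ?thesis by eventually_elim (simp add: powr_def)
  qed
  show ?thesis
    using ev_rate ev_a eventually_ge_at_top[of 1]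
  proof eventually_elim
    case (elim P)
    note rate = elim(1) and aP = elim(2) and P = elim(3)
    define lP where "lP = log 2 P"
    have lP: "0 \<le> lP" using P by (simp add: lP_def)
    \<comment> \<open>About \<open>sqrt P\<close> points per real dimension would use all degrees of
      freedom but leave a bounded spacing, so the exponent is lowered slightly.\<close>
    define T where "T = P powr ((1 - \<delta>') / 2)"
    have T: "1 \<le> T" using P \<delta>' by (simp add: T_def ge_one_powr_ge_zero)
    define Q where "Q = nat \<lfloor>T\<rfloor>"
    have Q: "0 < Q" "real Q \<le> T" "T \<le> 2 * real Q"
    proof -
      have f: "1 \<le> \<lfloor>T\<rfloor>" using T by (simp add: le_floor_iff)
      then have "real Q = real_of_int \<lfloor>T\<rfloor>" and pos: "0 < Q" by (auto simp: Q_def)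
      moreover have "real_of_int \<lfloor>T\<rfloor> \<le> T" "T \<le> real_of_int \<lfloor>T\<rfloor> + 1" by linarith+
      moreover have "1 \<le> real_of_int \<lfloor>T\<rfloor>" using f by linarith
      ultimately show "0 < Q" "real Q \<le> T" "T \<le> 2 * real Q" by linarith+
    qed
    \<comment> \<open>This spacing turns the power bound for the grid into an equality.\<close>
    define a where "a = sqrt (P / (2 * M)) / real Q"
    have a0: "0 \<le> a" using P M by (simp add: a_def)
    have power: "2 * real CARD('m) * (a * real Q)\<^sup>2 \<le> P"
      using P M Q by (simp add: a_def M_def[symmetric])
    have sep: "2 * (\<rho> + 1) < \<eta> * a"
    proof -
      have "P powr (\<delta>' / 2) * T = sqrt P"
        using P by (simp add: T_def powr_add[symmetric] powr_half_sqrt[symmetric] field_simps)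
      then have "P powr (\<delta>' / 2) = sqrt P / T" using T by (simp add: field_simps)
      also have "\<dots> \<le> sqrt P / real Q" using Q P by (intro divide_left_mono mult_pos_pos) auto
      also have "\<dots> = a * sqrt (2 * M)" using M by (simp add: a_def real_sqrt_divide)
      finally have "2 * (\<rho> + 1) * sqrt (2 * M) / \<eta> < a * sqrt (2 * M)" using aP by linarith
      then have "2 * (\<rho> + 1) * sqrt (2 * M) < (\<eta> * a) * sqrt (2 * M)" using \<eta> by (simp add: divide_less_eq mult_ac)
      then show ?thesis using M by simp
    qed
    \<comment> \<open>The cell size makes the bound on the surviving interference an
      equality.\<close>
    define \<epsilon> where "\<epsilon> = 1 / (2 * real CARD('k) * M * M * sqrt P)"
    have \<epsilon>: "0 < \<epsilon>" using P M by (simp add: \<epsilon>_def)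
    have res: "real CARD('k) * (real CARD('m) * real CARD('m) * (2 * \<epsilon>) * sqrt P) \<le> 1"
      using P M by (simp add: \<epsilon>_def M_def[symmetric])
    define B where "B = max 0 \<lceil>gmax / \<epsilon> + 1\<rceil>"
    have B: "gmax / \<epsilon> + 1 \<le> real_of_int B" "0 \<le> B" unfolding B_def by linarith+
    define c where "c = card (UNIV \<rightarrow>\<^sub>E {- B..B} \<times> {- B..B} :: ('k \<times> 'k \<times> 'm \<times> 'm \<Rightarrow> int \<times> int) set)"
    define q where "q = (Q * Q) ^ CARD('m)"
    define l where "l = log 2 (real q)"
    have q: "1 \<le> q" using Q by (simp add: q_def Suc_leI)
    have l0: "0 \<le> l" using q by (simp add: l_def)
    have lq: "lq P \<le> l"
    proof -
      have "(1 - \<delta>') / 2 * lP = log 2 T" using P by (simp add: T_def lP_def log_powr)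
      also have "\<dots> \<le> log 2 (2 * real Q)" using T Q by (subst log_le_cancel_iff) auto
      also have "\<dots> = 1 + log 2 (real Q)" using Q by (simp add: log_mult)
      finally have "(1 - \<delta>') * lP - 2 \<le> 2 * log 2 (real Q)" by (simp add: field_simps)
      then have "M * ((1 - \<delta>') * lP - 2) \<le> M * (2 * log 2 (real Q))" using M by (intro mult_left_mono) auto
      also have "\<dots> = l" using Q by (simp add: l_def q_def log_nat_power log_mult M_def)
      finally show ?thesis by (simp add: lq_def lP_def)
    qed
    define R where "R = (\<chi> k. (1 - \<delta>) * d $ k * log 2 P)"
    have R0: "0 \<le> R $ k" for k using nonneg \<delta> lP by (simp add: R_def lP_def)
    \<comment> \<open>From this length on, the slots lost to unpaired times and rounding cost at
      most \<open>n\<close> bits in all.\<close>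
    define n0 where "n0 = nat \<lceil>(real c + 4) * l\<rceil>"
    define err where "err = (\<lambda>n. 2 * (4 ^ r * (1 / 2 :: real) ^ n))"
    have code: "\<exists>L (enc :: ('k, 'm) encoders) dec. block_code \<mu> P n L enc dec \<and>
      (\<forall>k. 2 powr (real n * R $ k) \<le> real (L k)) \<and> (n0 \<le> n \<longrightarrow> (\<forall>j. error_prob \<mu> n L enc dec j \<le> err n))" for n
    proof (cases "n0 \<le> n")
      case False
      \<comment> \<open>Short blocks need enough messages for the rate, but nothing is asked of
        their error.\<close>
      let ?L = "\<lambda>k. nat \<lceil>2 powr (real n * R $ k)\<rceil>"
      have "0 < ?L k" "2 powr (real n * R $ k) \<le> real (?L k)" for k by (auto simp: real_nat_ceiling_ge)
      then show ?thesis using False trivial_block_code[of ?L P] P by (intro exI conjI allI) auto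
    next
      case True
      define n1 where "n1 = nat \<lfloor>lam * real n\<rfloor>"
      define D where "D = nat \<lceil>\<delta>' * real n\<rceil>"
      define N where "N = (\<lambda>k. (n - n1 - c) div 2 + (if k = k0 then n1 else 0))"
      have n1: "n1 \<le> n" "lam * real n - 1 \<le> real n1" "real n1 \<le> lam * real n"
      proof -
        have "lam * real n \<le> 1 * real n" using lam by (intro mult_right_mono) auto
        moreover have "0 \<le> lam * real n" using lam by simp
        ultimately show "n1 \<le> n" "lam * real n - 1 \<le> real n1" "real n1 \<le> lam * real n"
          unfolding n1_def by linarith+
      qed
      have D: "\<delta>' * real n \<le> real D" "real D \<le> \<delta>' * real n + 1"
      proof -
        have "0 \<le> \<delta>' * real n" using \<delta>' by simp
        then have "0 \<le> \<lceil>\<delta>' * real n\<rceil>" by linarith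
        then have "real D = real_of_int \<lceil>\<delta>' * real n\<rceil>" by (simp add: D_def)
        then show "\<delta>' * real n \<le> real D" "real D \<le> \<delta>' * real n + 1" by linarith+
      qed
      have Nn: "N k \<le> n" for k using n1(1) by (auto simp: N_def)
      \<comment> \<open>The loss \<open>c + 2\<close> covers the unpaired times, the rounding of
        \<open>n1\<close> and the truncated division by 2.\<close>
      have Nlow: "\<nu> k * real n - real c - 2 \<le> real (N k)" for k
      proof -
        have "n - n1 - c \<le> 2 * ((n - n1 - c) div 2) + 1" by presburger
        then have "real n - real n1 - real c \<le> 2 * real ((n - n1 - c) div 2) + 1" by linarith
        then have "((1 - lam) * real n - real c - 1) / 2 \<le> real ((n - n1 - c) div 2)"
          using n1(3) by (simp add: algebra_simps)
        moreover have "(1 - lam) * real n = real n - lam * real n" by (simp add: algebra_simps)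
        ultimately have b: "(real n - lam * real n - real c - 1) / 2 \<le> real ((n - n1 - c) div 2)" by simp
        have e: "\<nu> k * real n = (if k = k0 then (real n + lam * real n) / 2 else (real n - lam * real n) / 2)"
          by (simp add: \<nu>_def field_simps)
        have N: "real (N k) = real ((n - n1 - c) div 2) + (if k = k0 then real n1 else 0)" by (simp add: N_def)
        show ?thesis
        proof (cases "k = k0")
          case True then show ?thesis using b e N n1(2) by simp
        next
          case False
          have "(real n - lam * real n) / 2 - real c - 2 \<le> (real n - lam * real n - real c - 1) / 2" by simp
          then show ?thesis using b e N False by simp
        qed
      qed
      obtain L enc dec where bc: "block_code \<mu> P n L (enc :: ('k, 'm) encoders) dec"
        and size: "\<And>k. q ^ N k \<le> L k * (2 ^ N k * q ^ D)"
        and ep: "\<And>j. error_prob \<mu> n L enc dec j \<le> 2 * (2 ^ N j * p ^ (D div 4))"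
        using exists_alignment_block_code[OF a0 power Q(1) \<epsilon> res B c_def \<eta> sep n1(1) less_imp_le[OF p(1)] p(2) _ tails, of "D div 4" D k0]
        unfolding N_def q_def by auto
      have "2 powr (real n * R $ k) \<le> real (L k)" for k
      proof -
        have Lpos: "0 < L k" using bc by (simp add: block_code_def)
        show ?thesis
        proof (cases "0 < d $ k")
          case False
          then have "d $ k = 0" using nonneg[of k] by linarith
          then show ?thesis using Lpos by (simp add: R_def Suc_leI)
        next
          case True
          have "real (q ^ N k) \<le> real (L k * (2 ^ N k * q ^ D))" using size by (rule of_nat_mono)
          then have "log 2 (real q ^ N k) \<le> log 2 (real (L k) * (2 ^ N k * real q ^ D))"
            using q Lpos by (subst log_le_cancel_iff) auto
          then have "real (N k) * l \<le> log 2 (real (L k)) + real (N k) + real D * l"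
            using q Lpos by (simp add: log_mult log_nat_power l_def)
          then have "(real (N k) - real D) * l - real (N k) \<le> log 2 (real (L k))" by (simp add: algebra_simps)
          moreover have "real n * R $ k \<le> (real (N k) - real D) * l - real (N k)"
          proof -
            have "(real c + 4) * l \<le> real n" using True \<open>n0 \<le> n\<close> unfolding n0_def by linarith
            moreover have "((\<nu> k - \<delta>') * real n - (real c + 3)) * l \<le> (real (N k) - real D) * l"
              using Nlow[of k] D(2) l0 by (intro mult_right_mono) (auto simp: algebra_simps)
            moreover have "(1 - \<delta>) * d $ k * log 2 P + 2 \<le> (\<nu> k - \<delta>') * l"
              using rate[rule_format, OF True] mult_left_mono[OF lq, of "\<nu> k - \<delta>'"] \<nu>\<delta>[OF True] by linarith
            then have "real n * ((1 - \<delta>) * d $ k * log 2 P + 2) \<le> real n * ((\<nu> k - \<delta>') * l)"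
              by (rule mult_left_mono) simp
            ultimately show ?thesis using Nn[of k] l0 by (simp add: R_def algebra_simps)
          qed
          ultimately have "2 powr (real n * R $ k) \<le> 2 powr (log 2 (real (L k)))" by simp
          then show ?thesis using Lpos by simp
        qed
      qed
      moreover have "error_prob \<mu> n L enc dec j \<le> err n" for j
      proof -
        \<comment> \<open>The rounding in \<open>D div 4\<close> costs at most the constant factor
          \<open>4 ^ r\<close> in the error bound.\<close>
        have "n \<le> r * (D div 4) + r"
        proof -
          have "real n = (4 / \<delta>') * (\<delta>' * real n / 4)" using \<delta>' by simp
          also have "\<dots> \<le> real r * (\<delta>' * real n / 4)" using r \<delta>' by (intro mult_right_mono) auto
          also have "\<dots> \<le> real r * (real (D div 4) + 1)"
          proof (rule mult_left_mono)
            have "D \<le> 4 * (D div 4) + 4" by presburger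
            then have "real D \<le> 4 * real (D div 4) + 4" by linarith
            then show "\<delta>' * real n / 4 \<le> real (D div 4) + 1" using D(1) by linarith
          qed simp
          also have "\<dots> = real (r * (D div 4) + r)" by (simp add: algebra_simps)
          finally show ?thesis by linarith
        qed
        then have "(1 / 4 :: real) ^ (r * (D div 4) + r) \<le> (1 / 4) ^ n" by (intro power_decreasing) auto
        then have "4 ^ r * (1 / 4 :: real) ^ (r * (D div 4) + r) \<le> 4 ^ r * (1 / 4) ^ n" by (intro mult_left_mono) auto
        moreover have "p ^ (D div 4) = 4 ^ r * (1 / 4 :: real) ^ (r * (D div 4) + r)"
          by (simp add: p_def power_add power_mult[symmetric] power_one_over)
        ultimately have pm: "p ^ (D div 4) \<le> 4 ^ r * (1 / 4) ^ n" by simp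
        have "(2::real) ^ N j * p ^ (D div 4) \<le> 2 ^ n * (4 ^ r * (1 / 4) ^ n)"
          using pm p Nn[of j] by (intro mult_mono power_increasing) auto
        also have "\<dots> = 4 ^ r * (1 / 2) ^ n"
        proof -
          have "(2::real) ^ n * (1 / 4) ^ n = (1 / 2) ^ n" by (simp add: power_mult_distrib[symmetric])
          then show ?thesis by simp
        qed
        finally show ?thesis using ep[of j] by (simp add: err_def)
      qed
      ultimately show ?thesis using bc by blast
    qed
    have "\<forall>n. \<exists>L (enc :: ('k, 'm) encoders) dec. block_code \<mu> P n L enc dec \<and>
      (\<forall>k. 2 powr (real n * R $ k) \<le> real (L k)) \<and> (n0 \<le> n \<longrightarrow> (\<forall>j. error_prob \<mu> n L enc dec j \<le> err n))"
      by (rule allI) (rule code)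
    from choice[OF this] obtain L where "\<forall>n. \<exists>(enc :: ('k, 'm) encoders) dec. block_code \<mu> P n (L n) enc dec \<and>
      (\<forall>k. 2 powr (real n * R $ k) \<le> real (L n k)) \<and> (n0 \<le> n \<longrightarrow> (\<forall>j. error_prob \<mu> n (L n) enc dec j \<le> err n))" ..
    from choice[OF this] obtain enc :: "nat \<Rightarrow> ('k, 'm) encoders" where "\<forall>n. \<exists>dec. block_code \<mu> P n (L n) (enc n) dec \<and>
      (\<forall>k. 2 powr (real n * R $ k) \<le> real (L n k)) \<and> (n0 \<le> n \<longrightarrow> (\<forall>j. error_prob \<mu> n (L n) (enc n) dec j \<le> err n))" ..
    from choice[OF this] obtain dec where all: "\<And>n. block_code \<mu> P n (L n) (enc n) (dec n)"
      "\<And>n k. 2 powr (real n * R $ k) \<le> real (L n k)" "\<And>n j. n0 \<le> n \<Longrightarrow> error_prob \<mu> n (L n) (enc n) (dec n) j \<le> err n" by blast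
    have err: "err \<longlonglongrightarrow> 0"
      unfolding err_def by (intro tendsto_mult_right_zero LIMSEQ_realpow_zero) auto
    have "(\<lambda>n. error_prob \<mu> n (L n) (enc n) (dec n) j) \<longlonglongrightarrow> 0" for j
    proof (rule tendsto_sandwich[OF _ _ tendsto_const err])
      show "\<forall>\<^sub>F n in sequentially. 0 \<le> error_prob \<mu> n (L n) (enc n) (dec n) j" by (simp add: error_prob_def)
      show "\<forall>\<^sub>F n in sequentially. error_prob \<mu> n (L n) (enc n) (dec n) j \<le> err n"
        using all(3) by (intro eventually_sequentiallyI[of n0])
    qed
    then show ?case unfolding achievable_def R_def[symmetric] using R0 all(1,2) by blast
  qed
qed

section \<open>From rates at large power to the region\<close>

lemma zero_mem_capacity_region:
  assumes "0 \<le> P"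
  shows "(0 :: real ^ 'k::finite) \<in> capacity_region TYPE('m::finite) \<mu> P"
proof -
  have "achievable TYPE('m) \<mu> P (0 :: real ^ 'k)"
    unfolding achievable_def
  proof (intro conjI exI allI)
    let ?e = "\<lambda>_ _ _ _ _. 0 :: complex ^ 'm" and ?d = "(\<lambda>_ _ _ _. 0) :: nat \<Rightarrow> ('k, 'm) decoders"
    show "block_code \<mu> P n ((\<lambda>_ _. 1) n) (?e n) (?d n)" for n by (rule trivial_block_code) (use assms in auto)
    show "2 powr (real n * (0 :: real ^ 'k) $ k) \<le> real ((\<lambda>_ _. 1) n k)" for n k by simp
    \<comment> \<open>The only message is 0, so the constant decision 0 is never wrong.\<close>
    have "{(h, w, z) \<in> space (joint_space \<mu> n (\<lambda>_. 1) :: (('k, 'm) gains \<times> ('k \<Rightarrow> nat) \<times> ('k, 'm) noises) measure). 0 \<noteq> w j} = {}" for n and j :: 'k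
      by (auto simp: joint_space_def space_pair_measure message_space_def space_PiM space_uniform_count_measure PiE_iff)
    then show "(\<lambda>n. error_prob \<mu> n ((\<lambda>_ _. 1) n) (?e n) (?d n) j) \<longlonglongrightarrow> 0" for j
      unfolding error_prob_def by (simp only: measure_empty tendsto_const)
  qed simp
  then show ?thesis unfolding capacity_region_def by (simp add: closure_subset[THEN subsetD])
qed

text \<open>Each \<open>\<delta>\<close> gives rates for large power only, while membership asks for
  one family of tuples over all powers. So the largest admissible fraction
  \<open>s P \<le> 1\<close> on the ray through \<open>d\<close> is taken: it is attained because
  the capacity region is closed, and it tends to 1.\<close>

lemma mem_dof_region:
  fixes d :: "real ^ 'k::finite"
  assumes K: "2 \<le> CARD('k)" and nonneg: "\<And>k. 0 \<le> d $ k"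
    and pair: "\<And>i j. i \<noteq> j \<Longrightarrow> d $ i + d $ j \<le> real CARD('m::finite)"
  shows "d \<in> dof_region TYPE('m) \<mu>"
proof -
  let ?C = "\<lambda>P. capacity_region TYPE('m) \<mu> P :: (real ^ 'k) set"
  define S where "S = (\<lambda>P. {s \<in> {0..1}. (s * log 2 P) *\<^sub>R d \<in> ?C P})"
  define s where "s = (\<lambda>P. Sup (S P))"
  have S: "s P \<in> S P" if "0 < P" for P
  proof -
    have "closed (?C P)" by (simp add: capacity_region_def)
    moreover have "continuous_on {0..1} (\<lambda>s. (s * log 2 P) *\<^sub>R d)" by (intro continuous_intros)
    ultimately have "closed ({0..1} \<inter> (\<lambda>s. (s * log 2 P) *\<^sub>R d) -` ?C P)"
      by (intro continuous_closed_preimage) auto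
    then have "closed (S P)" by (simp add: S_def vimage_def Int_def)
    moreover have "0 \<in> S P" using zero_mem_capacity_region[of P] that by (simp add: S_def)
    moreover have "bdd_above (S P)" by (intro bdd_aboveI[of _ 1]) (auto simp: S_def)
    ultimately show ?thesis unfolding s_def by (intro closed_contains_Sup) auto
  qed
  have "(s \<longlongrightarrow> 1) at_top"
  proof (rule order_tendstoI)
    fix y :: real assume "y < 1"
    define \<delta> where "\<delta> = min ((1 - y) / 2) (1 / 2)"
    have \<delta>: "0 < \<delta>" "\<delta> < 1" "y < 1 - \<delta>" using \<open>y < 1\<close> by (auto simp: \<delta>_def min_def field_simps)
    have "\<forall>\<^sub>F P in at_top. achievable TYPE('m) \<mu> P (\<chi> k. (1 - \<delta>) * d $ k * log 2 P)"
      by (rule achievable_scaled[OF K nonneg pair \<delta>(1,2)])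
    then show "\<forall>\<^sub>F P in at_top. y < s P"
    proof eventually_elim
      case (elim P)
      have "(\<chi> k. (1 - \<delta>) * d $ k * log 2 P) = ((1 - \<delta>) * log 2 P) *\<^sub>R d" by (simp add: vec_eq_iff)
      then have "((1 - \<delta>) * log 2 P) *\<^sub>R d \<in> ?C P"
        unfolding capacity_region_def by (intro subsetD[OF closure_subset]) (use elim in simp)
      then have "1 - \<delta> \<in> S P" using \<delta> by (simp add: S_def)
      then have "1 - \<delta> \<le> s P" unfolding s_def by (intro cSup_upper bdd_aboveI[of _ 1]) (auto simp: S_def)
      then show ?case using \<delta>(3) by linarith
    qed
  next
    fix y :: real assume "1 < y"
    show "\<forall>\<^sub>F P in at_top. s P < y"
      using eventually_gt_at_top[of 0]
    proof eventually_elim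
      case (elim P)
      then have "s P \<le> 1" using S[of P] by (simp add: S_def)
      then show ?case using \<open>1 < y\<close> by linarith
    qed
  qed
  then have lim: "((\<lambda>P. s P * d $ k) \<longlongrightarrow> d $ k) at_top" for k
    using tendsto_mult[OF _ tendsto_const, of s 1 at_top "d $ k"] by simp
  define R where "R = (\<lambda>P. (s P * log 2 P) *\<^sub>R d)"
  have "((\<lambda>P. R P $ k / log 2 P) \<longlongrightarrow> d $ k) at_top" for k
  proof (rule Lim_transform_eventually[OF lim])
    show "\<forall>\<^sub>F P in at_top. s P * d $ k = R P $ k / log 2 P"
      using eventually_gt_at_top[of 1]
    proof eventually_elim
      case (elim P)
      then have "0 < log 2 P" by simp
      then show ?case by (simp add: R_def)
    qed
  qed
  moreover have "R P \<in> ?C P" if "0 < P" for P using S[OF that] by (simp add: S_def R_def)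
  ultimately show ?thesis unfolding dof_region_def using nonneg by blast
qed

end

theorem corollary2:
  fixes \<mu> :: "complex measure" and hmin hmax :: real
  assumes "prob_space \<mu>" and "sets \<mu> = sets borel"
    and continuous: "\<And>x. measure \<mu> {x} = 0"
    and "0 < hmin" and bounded: "AE x in \<mu>. hmin \<le> cmod x \<and> cmod x \<le> hmax"
    and "2 \<le> CARD('k::finite)"
  shows "(dof_region TYPE('m::finite) \<mu> :: (real ^ 'k) set) =
    {d. (\<forall>k. 0 \<le> d $ k) \<and> (\<forall>i j. i \<noteq> j \<longrightarrow> d $ i + d $ j \<le> real CARD('m))}"
proof -
  have "AE x in \<mu>. cmod x \<le> hmax" using bounded by eventually_elim simp
  then interpret fading_channel \<mu> hmax
    using assms(1-3) by (intro fading_channel.intro fading_channel_axioms.intro)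
  show ?thesis
  proof (intro equalityI subsetI)
    fix d :: "real ^ 'k" assume d: "d \<in> dof_region TYPE('m) \<mu>"
    then have "\<forall>k. 0 \<le> d $ k" by (simp add: dof_region_def)
    with d show "d \<in> {d. (\<forall>k. 0 \<le> d $ k) \<and> (\<forall>i j. i \<noteq> j \<longrightarrow> d $ i + d $ j \<le> real CARD('m))}"
      by (auto intro: dof_region_pair_le)
  next
    fix d :: "real ^ 'k"
    assume "d \<in> {d. (\<forall>k. 0 \<le> d $ k) \<and> (\<forall>i j. i \<noteq> j \<longrightarrow> d $ i + d $ j \<le> real CARD('m))}"
    then show "d \<in> dof_region TYPE('m) \<mu>" using assms(6) by (intro mem_dof_region) auto
  qed
qed

end
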